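(* Let $p_1,p_2,r\ge1$, $\sigma>0$, and $\Sigma\in\mathbb{R}^{p_1p_2\times p_1p_2}$ a covariance matrix. Let $\mathcal{A}_r=\{B\in\mathbb{R}^{p_1\times p_2}\setminus\{0\}:\mathrm{rank}(B)\le r\}$. For $B\in\mathcal{A}_r$ let $P_B$ be the law of $(X,y)\in\mathbb{R}^{p_1\times p_2}\times\mathbb{R}$ with $\mathrm{vec}(X)\sim N(0,\Sigma)$ and $y\mid X\sim N(\mathrm{Tr}(X^TB),\sigma^2)$. For $\epsilon\in[0,1)$ and an arbitrary $Q$, let $(X_1,y_1),\dots,(X_n,y_n)$ be i.i.d. from $\mathbb{P}_{(\epsilon,B,Q)}=(1-\epsilon)P_B+\epsilon Q$. For $\mathcal{U}\subset\mathbb{R}^{p_1\times p_2}$ and a distribution $\mathbb{P}$ of $(X,y)$ define $\mathcal{D}_{\mathcal{U}}(B,\mathbb{P})=\inf_{U\in\mathcal{U}}\mathbb{P}\{\langle U,X\rangle(y-\langle B,X\rangle)\ge0\}$, with $\langle A,B\rangle=\mathrm{Tr}(AB^T)$, and let $\widehat B$ be any maximizer over $B\in\mathcal{A}_r$ of $\mathcal{D}_{\mathcal{A}_{2r}}(B,\mathbb{P}_n)$, $\mathbb{P}_n$ the empirical measure. Let $\kappa=\inf_{\mathrm{rank}(A)=2r}\|\Sigma^{1/2}\mathrm{vec}(A)\|/\|A\|_{\rm F}$. Then there exist absolute constants $c_0,C,C'>0$ such that whenever $\epsilon^2+\frac{r(p_1+p_2)}{n}\le c_0$, $$\|\Sigma^{1/2}\mathrm{vec}(\widehat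 B-B)\|^2\le C\sigma^2\Big(\frac{r(p_1+p_2)}{n}\vee\epsilon^2\Big),\quad \|\widehat B-B\|_{\rm F}^2\le C\frac{\sigma^2}{\kappa^2}\Big(\frac{r(p_1+p_2)}{n}\vee\epsilon^2\Big),$$ $$\|\widehat B-B\|_{\rm N}^2\le C\frac{\sigma^2}{\kappa^2}\Big(\frac{r^2(p_1+p_2)}{n}\vee r\epsilon^2\Big),$$ with $\mathbb{P}_{(\epsilon,B,Q)}$-probability at least $1-\exp\big(-C'(r(p_1+p_2)+n\epsilon^2)\big)$, uniformly over all $Q$ and $B\in\mathcal{A}_r$.
   Context: $\mathrm{vec}(A)$ is the vectorization, $\|A\|_{\rm F}$ the Frobenius norm, $\|A\|_{\rm N}$ the nuclear norm (sum of singular values). $a\vee b=\max(a,b)$.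
   Formalization: The infimum defining κ is taken over nonzero A with rank(A) ≤ 2r instead of rank(A) = 2r: the latter set is empty when 2r > min(p1,p2) (e.g. p1=p2=r=1), and the two infima agree by density when 2r ≤ min(p1,p2). *)

theory Defs
  imports "HOL-Probability.Probability" "Jordan_Normal_Form.DL_Rank" "Jordan_Normal_Form.Char_Poly"
begin

text \<open>Matrices are Jordan_Normal_Form matrices of type real mat with explicit dimensions.
  A data point (X,y) is a pair of a p1 x p2 matrix X, encoded as an extensional function on
  index pairs {..<p1} x {..<p2}, and a real response y.\<close>

definition data_space :: "nat \<Rightarrow> nat \<Rightarrow> ((nat \<times> nat \<Rightarrow> real) \<times> real) measure" where
  "data_space p1 p2 = (PiM ({..<p1} \<times> {..<p2}) (\<lambda>_. borel)) \<Otimes>\<^sub>M borel"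

definition to_mat :: "nat \<Rightarrow> nat \<Rightarrow> (nat \<times> nat \<Rightarrow> real) \<Rightarrow> real mat" where
  "to_mat p1 p2 X = mat p1 p2 X"

definition vec_of_mat :: "nat \<Rightarrow> nat \<Rightarrow> real mat \<Rightarrow> real vec" where
  "vec_of_mat p1 p2 A = vec (p1 * p2) (\<lambda>k. A $$ (k mod p1, k div p1))"

definition unvec :: "nat \<Rightarrow> nat \<Rightarrow> real vec \<Rightarrow> (nat \<times> nat \<Rightarrow> real)" where
  "unvec p1 p2 w = restrict (\<lambda>(i,j). w $ (i + j * p1)) ({..<p1} \<times> {..<p2})"

definition psd :: "real mat \<Rightarrow> bool" where
  "psd S \<longleftrightarrow> S \<in> carrier_mat (dim_row S) (dim_row S) \<and> S\<^sup>T = S \<and>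
     (\<forall>v \<in> carrier_vec (dim_row S). 0 \<le> v \<bullet> (S *\<^sub>v v))"

definition covariance_matrix :: "nat \<Rightarrow> real mat \<Rightarrow> bool" where
  "covariance_matrix d S \<longleftrightarrow> S \<in> carrier_mat d d \<and> psd S"

definition psd_sqrt :: "real mat \<Rightarrow> real mat" where
  "psd_sqrt S = (SOME R. R \<in> carrier_mat (dim_row S) (dim_row S) \<and> psd R \<and> R * R = S)"

definition frob_norm :: "real mat \<Rightarrow> real" where
  "frob_norm A = sqrt (\<Sum>i<dim_row A. \<Sum>j<dim_col A. (A $$ (i,j))\<^sup>2)"

text \<open>Nuclear norm: sum of singular values, i.e. of square roots of the eigenvalues
  (with multiplicity) of A^T A.\<close>
definition nuclear_norm :: "real mat \<Rightarrow> real" where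
  "nuclear_norm A = sum_mset (image_mset sqrt (proots (char_poly (A\<^sup>T * A))))"

definition mat_rank :: "real mat \<Rightarrow> nat" where
  "mat_rank A = vec_space.rank (dim_row A) A"

definition low_rank_set :: "nat \<Rightarrow> nat \<Rightarrow> nat \<Rightarrow> real mat set" where
  "low_rank_set p1 p2 r = {B \<in> carrier_mat p1 p2. B \<noteq> 0\<^sub>m p1 p2 \<and> mat_rank B \<le> r}"

definition mtrace :: "real mat \<Rightarrow> real" where
  "mtrace A = (\<Sum>i<dim_row A. A $$ (i,i))"

definition mat_inner :: "real mat \<Rightarrow> real mat \<Rightarrow> real" where
  "mat_inner A B = mtrace (A * B\<^sup>T)"

text \<open>Standard Gaussian vector in R^d, and the model P_B:
  vec(X) = S^(1/2) Z with Z ~ N(0, I_d) (so vec(X) ~ N(0,S)),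
  y = Tr(X^T B) + sig * xi with xi ~ N(0,1) independent of Z.\<close>
definition std_gauss_vec :: "nat \<Rightarrow> (nat \<Rightarrow> real) measure" where
  "std_gauss_vec d = PiM {..<d} (\<lambda>_. density lborel std_normal_density)"

definition model :: "nat \<Rightarrow> nat \<Rightarrow> real mat \<Rightarrow> real \<Rightarrow> real mat \<Rightarrow> ((nat \<times> nat \<Rightarrow> real) \<times> real) measure" where
  "model p1 p2 S sig B =
     distr (std_gauss_vec (p1 * p2) \<Otimes>\<^sub>M density lborel std_normal_density) (data_space p1 p2)
       (\<lambda>(z, \<xi>). let X = unvec p1 p2 (psd_sqrt S *\<^sub>v vec (p1 * p2) z)
                  in (X, mtrace ((to_mat p1 p2 X)\<^sup>T * B) + sig * \<xi>))"

definition mixture :: "real \<Rightarrow> 'a measure \<Rightarrow> 'a measure \<Rightarrow> 'a measure" where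
  "mixture eps P Q = measure_of (space P) (sets P)
     (\<lambda>A. ennreal (1 - eps) * emeasure P A + ennreal eps * emeasure Q A)"

definition empirical :: "'a measure \<Rightarrow> nat \<Rightarrow> (nat \<Rightarrow> 'a) \<Rightarrow> 'a measure" where
  "empirical M n \<omega> = measure_of (space M) (sets M)
     (\<lambda>A. ennreal (real (card {i \<in> {..<n}. \<omega> i \<in> A}) / real n))"

definition depth :: "nat \<Rightarrow> nat \<Rightarrow> real mat set \<Rightarrow> real mat \<Rightarrow> ((nat \<times> nat \<Rightarrow> real) \<times> real) measure \<Rightarrow> real" where
  "depth p1 p2 \<U> B P = (INF U \<in> \<U>. measure P
     {(X, y) \<in> space P. mat_inner U (to_mat p1 p2 X) * (y - mat_inner B (to_mat p1 p2 X)) \<ge> 0})"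

definition is_depth_maximizer :: "nat \<Rightarrow> nat \<Rightarrow> nat \<Rightarrow> nat \<Rightarrow> (nat \<Rightarrow> (nat \<times> nat \<Rightarrow> real) \<times> real) \<Rightarrow> real mat \<Rightarrow> bool" where
  "is_depth_maximizer p1 p2 r n \<omega> Bh \<longleftrightarrow> Bh \<in> low_rank_set p1 p2 r \<and>
     (\<forall>B' \<in> low_rank_set p1 p2 r.
        depth p1 p2 (low_rank_set p1 p2 (2*r)) B' (empirical (data_space p1 p2) n \<omega>)
        \<le> depth p1 p2 (low_rank_set p1 p2 (2*r)) Bh (empirical (data_space p1 p2) n \<omega>))"

definition kappa :: "nat \<Rightarrow> nat \<Rightarrow> nat \<Rightarrow> real mat \<Rightarrow> real" where
  "kappa p1 p2 r S = (INF A \<in> low_rank_set p1 p2 (2*r).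
     sqrt ((psd_sqrt S *\<^sub>v vec_of_mat p1 p2 A) \<bullet> (psd_sqrt S *\<^sub>v vec_of_mat p1 p2 A)) / frob_norm A)"

end

theory Submission
  imports Defs "Jordan_Normal_Form.Schur_Decomposition"
begin

text \<open>Write d = r (p1 + p2), beta = d / n + eps^2, and measure a direction U by
  rho(U) = |S^(1/2) vec(U)|. At the true B every normalized direction has population depth 1/2. If
  rho(Bh - B) / sig exceeds t, then in the direction Bh - B, where the depth is decreasing in the
  distance, the population depth at Bh is at most 1/2 - t / 729. Hence everything reduces to a
  uniform deviation bound of order sqrt beta, without logarithms, for the half space counts
  indexed by normalized matrices of rank at most 2 r, for one fixed tilt t.

  Covering numbers: the T-th powers of the inner products of N normalized low rank matrices form a
  matrix that factors through the monomials of degree 2 T in O(d) variables. If the matrices are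
  well separated and T is of order log N, this matrix is a perturbation of the identity, so its
  rank is at least N / 2. This bounds N by exp(C d (j + 1)) at scale 8^(- j), for an arbitrary
  covariance S, singular or not.

  Chaining: down to the scale where 2^J is about 1 / sqrt beta, the counts are controlled by
  Bernstein's inequality directly under the contaminated law, where the contamination only adds eps
  to the variances. Below this scale the empirical L2 norms of the links are controlled by a
  chi-square bound on the sample points that are not contaminated.\<close>

section \<open>Rank of Gram matrices and homogeneous polynomials\<close>

text \<open>Distances are measured between whitened matrices S^(1/2) vec(U). Whitening destroys low
  rank, and a net built in Frobenius norm would bring in the conditioning of S. The packing argument
  sees only that a whitened matrix is quadratic in 2 r (p1 + p2) parameters, so no property of S
  enters the constants. The second obstacle is Q. Under the mixture a link keeps a variance of up to
  eps however short it is, so the error terms eps 2^j sqrt \<beta> grow along the chain and it has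
  to stop. Between the last net point and U the argument is pointwise: membership in the region
  changes only at a contaminated point, at a point near the boundary of the region of the net point,
  or where the residual covariate is large. The three kinds are counted separately. Directions with
  rho(U) = 0 exist for singular S and cannot be normalized. On the support of the clean law they
  satisfy <U, X> = 0, so the clean points all count for the depth at B and such directions do no
  harm.\<close>

lemma orthonormalize:
  fixes a :: "nat \<Rightarrow> 'i \<Rightarrow> real"
  assumes I: "finite I"
  shows "\<exists>w. (\<forall>l<K. \<forall>m<K. l \<noteq> m \<longrightarrow> (\<Sum>i\<in>I. w l i * w m i) = 0)
    \<and> (\<forall>l<K. (\<Sum>i\<in>I. (w l i)\<^sup>2) = 1 \<or> (\<forall>i\<in>I. w l i = 0))
    \<and> (\<forall>l<K. \<exists>c. \<forall>i\<in>I. a l i = (\<Sum>m\<le>l. c m * w m i))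
    \<and> (\<forall>l<K. \<exists>c. \<forall>i\<in>I. w l i = (\<Sum>m\<le>l. c m * a m i))"
proof (induction K)
  case 0
  then show ?case by simp
next
  case (Suc K)
  then obtain w where w:
    "\<forall>l<K. \<forall>m<K. l \<noteq> m \<longrightarrow> (\<Sum>i\<in>I. w l i * w m i) = 0"
    "\<forall>l<K. (\<Sum>i\<in>I. (w l i)\<^sup>2) = 1 \<or> (\<forall>i\<in>I. w l i = 0)"
    "\<forall>l<K. \<exists>c. \<forall>i\<in>I. a l i = (\<Sum>m\<le>l. c m * w m i)"
    "\<forall>l<K. \<exists>c. \<forall>i\<in>I. w l i = (\<Sum>m\<le>l. c m * a m i)"
    by (elim exE conjE) (rule that)
  note orth = w(1)[rule_format] and norm = w(2)[rule_format]
    and aw = w(3)[rule_format] and wa = w(4)[rule_format]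
  define c where "c m = (\<Sum>i\<in>I. a K i * w m i)" for m
  define v where "v i = a K i - (\<Sum>m<K. c m * w m i)" for i
  define q where "q = sqrt (\<Sum>i\<in>I. (v i)\<^sup>2)"
  define u where "u i = v i / q" for i
  have v_orth: "(\<Sum>i\<in>I. v i * w l i) = 0" if l: "l < K" for l
  proof -
    have "(\<Sum>i\<in>I. v i * w l i) = c l - (\<Sum>m<K. c m * (\<Sum>i\<in>I. w m i * w l i))"
      unfolding v_def c_def left_diff_distrib sum_subtractf sum_distrib_left sum_distrib_right
      by (subst sum.swap) (simp add: mult.assoc)
    also have "(\<Sum>m<K. c m * (\<Sum>i\<in>I. w m i * w l i)) = c l * (\<Sum>i\<in>I. w l i * w l i)"
      using l orth by (subst sum.remove[of _ l]) auto
    also have "c l - c l * (\<Sum>i\<in>I. w l i * w l i) = 0"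
      using norm[OF l] by (auto simp: power2_eq_square c_def)
    finally show ?thesis .
  qed
  have u_orth: "(\<Sum>i\<in>I. u i * w l i) = 0" if l: "l < K" for l
    using v_orth[OF l] by (simp add: u_def sum_divide_distrib[symmetric])
  have q2: "q\<^sup>2 = (\<Sum>i\<in>I. (v i)\<^sup>2)" by (simp add: q_def sum_nonneg)
  \<comment> \<open>If the new vector depends on the earlier ones, then q = 0, and the convention x
    / 0 = 0 makes u vanish. A zero vector thus fills the slot, the indices stay aligned, and both
    changes of basis stay triangular.\<close>
  have u_norm: "(\<Sum>i\<in>I. (u i)\<^sup>2) = 1 \<or> (\<forall>i\<in>I. u i = 0)"
  proof (cases "q = 0")
    case False
    then show ?thesis by (simp add: u_def power_divide sum_divide_distrib[symmetric] q2[symmetric])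
  qed (simp add: u_def)
  have vq: "v i = q * u i" if "i \<in> I" for i
  proof (cases "q = 0")
    case True
    then have "(\<Sum>i\<in>I. (v i)\<^sup>2) = 0" using q2 by simp
    then have "v i = 0" using I that by (simp add: sum_nonneg_eq_0_iff)
    then show ?thesis using True by simp
  qed (simp add: u_def)
  define w' where "w' = w(K := u)"
  have aw': "\<exists>c. \<forall>i\<in>I. a l i = (\<Sum>m\<le>l. c m * w' m i)" if "l < Suc K" for l
  proof (cases "l = K")
    case True
    have "a K i = (\<Sum>m\<le>K. (c(K := q)) m * w' m i)" if "i \<in> I" for i
    proof -
      have "a K i = (\<Sum>m<K. c m * w m i) + q * u i" using vq[OF that] by (simp add: v_def)
      then show ?thesis by (simp add: w'_def lessThan_Suc_atMost[symmetric])
    qed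
    then show ?thesis using True by blast
  next
    case False
    then have "l < K" using that by simp
    then show ?thesis using aw[of l] by (auto simp: w'_def)
  qed
  have wa': "\<exists>c. \<forall>i\<in>I. w' l i = (\<Sum>m\<le>l. c m * a m i)" if "l < Suc K" for l
  proof (cases "l = K")
    case True
    obtain e where e: "\<And>l i. l < K \<Longrightarrow> i \<in> I \<Longrightarrow> w l i = (\<Sum>m\<le>l. e l m * a m i)"
      using wa by metis
    have e': "w l i = (\<Sum>m<K. (if m \<le> l then e l m else 0) * a m i)" if "l < K" "i \<in> I" for l i
      unfolding e[OF that] using that
      by (intro sum.mono_neutral_cong_left) auto
    have "w' K i = (\<Sum>m\<le>K. ((\<lambda>m. - (\<Sum>l<K. c l * (if m \<le> l then e l m else 0)) / q)(K := 1 / q)) m * a m i)"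
      if "i \<in> I" for i
    proof -
      have "v i = a K i - (\<Sum>l<K. c l * (\<Sum>m<K. (if m \<le> l then e l m else 0) * a m i))"
        unfolding v_def using e' that by simp
      also have "(\<Sum>l<K. c l * (\<Sum>m<K. (if m \<le> l then e l m else 0) * a m i)) =
          (\<Sum>m<K. (\<Sum>l<K. c l * (if m \<le> l then e l m else 0)) * a m i)"
        unfolding sum_distrib_left sum_distrib_right
        by (subst sum.swap) (simp add: mult.assoc)
      finally show ?thesis
        by (simp add: w'_def u_def lessThan_Suc_atMost[symmetric] diff_divide_distrib
            sum_divide_distrib[symmetric] sum_negf)
    qed
    then show ?thesis using True by blast
  next
    case False
    then have "l < K" using that by simp
    then show ?thesis using wa[of l] by (auto simp: w'_def)
  qed
  have "\<forall>l<Suc K. \<forall>m<Suc K. l \<noteq> m \<longrightarrow> (\<Sum>i\<in>I. w' l i * w' m i) = 0"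
    using orth u_orth by (auto simp: w'_def less_Suc_eq mult.commute)
  moreover have "\<forall>l<Suc K. (\<Sum>i\<in>I. (w' l i)\<^sup>2) = 1 \<or> (\<forall>i\<in>I. w' l i = 0)"
    using norm u_norm by (auto simp: w'_def less_Suc_eq)
  ultimately show ?case using aw' wa' by blast
qed

text \<open>Expand G = w^T H in an orthonormal system \<open>w\<close>. The trace is then the inner
  product of \<open>w\<close> with \<open>H\<close>, and \<open>H\<close> has the Frobenius norm of
  G, so Cauchy-Schwarz leaves only the squared norm of \<open>w\<close>, at most \<open>K\<close>.
  The inequality serves twice: for packing numbers and for the nuclear norm.\<close>

lemma trace_square_le_rank:
  fixes a b :: "nat \<Rightarrow> 'i \<Rightarrow> real"
  assumes I: "finite I"
    and G: "\<And>i j. i \<in> I \<Longrightarrow> j \<in> I \<Longrightarrow> G i j = (\<Sum>l<K. a l i * b l j)"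
  shows "(\<Sum>i\<in>I. G i i)\<^sup>2 \<le> real K * (\<Sum>i\<in>I. \<Sum>j\<in>I. (G i j)\<^sup>2)"
proof -
  obtain w where w:
    "\<forall>l<K. \<forall>m<K. l \<noteq> m \<longrightarrow> (\<Sum>i\<in>I. w l i * w m i) = 0"
    "\<forall>l<K. (\<Sum>i\<in>I. (w l i)\<^sup>2) = 1 \<or> (\<forall>i\<in>I. w l i = 0)"
    "\<forall>l<K. \<exists>c. \<forall>i\<in>I. a l i = (\<Sum>m\<le>l. c m * w m i)"
    using orthonormalize[OF I, of K a] by (elim exE conjE) (rule that)
  note orth = w(1)[rule_format] and norm = w(2)[rule_format] and aw = w(3)[rule_format]
  obtain c where c: "\<And>l i. l < K \<Longrightarrow> i \<in> I \<Longrightarrow> a l i = (\<Sum>m\<le>l. c l m * w m i)"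
    using aw by metis
  define H where "H m j = (\<Sum>l<K. (if m \<le> l then c l m else 0) * b l j)" for m j
  have GH: "G i j = (\<Sum>m<K. w m i * H m j)" if "i \<in> I" "j \<in> I" for i j
  proof -
    have "a l i = (\<Sum>m<K. (if m \<le> l then c l m else 0) * w m i)" if "l < K" for l
      unfolding c[OF that \<open>i \<in> I\<close>] using that
      by (intro sum.mono_neutral_cong_left) auto
    then have "G i j = (\<Sum>l<K. (\<Sum>m<K. (if m \<le> l then c l m else 0) * w m i) * b l j)"
      using G[OF that] by simp
    also have "\<dots> = (\<Sum>m<K. w m i * H m j)"
      unfolding H_def sum_distrib_left sum_distrib_right
      by (subst sum.swap) (intro sum.cong refl, simp)
    finally show ?thesis .
  qed
  \<comment> \<open>Rows that belong to a zero slot of \<open>w\<close> are set to 0. This does not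
    change G, and pairing G with \<open>w m\<close> now returns row m of \<open>H'\<close> for the
    zero slots too.\<close>
  define H' where "H' m j = (if \<forall>i\<in>I. w m i = 0 then 0 else H m j)" for m j
  have GH': "G i j = (\<Sum>m<K. w m i * H' m j)" if "i \<in> I" "j \<in> I" for i j
    unfolding GH[OF that] by (intro sum.cong refl) (use that in \<open>auto simp: H'_def\<close>)
  have wG: "(\<Sum>i\<in>I. w m i * G i j) = H' m j" if m: "m < K" and j: "j \<in> I" for m j
  proof -
    have "(\<Sum>i\<in>I. w m i * G i j) = (\<Sum>l<K. (\<Sum>i\<in>I. w m i * w l i) * H' l j)"
    proof -
      have "(\<Sum>i\<in>I. w m i * G i j) = (\<Sum>i\<in>I. \<Sum>l<K. w m i * (w l i * H' l j))"
        using j by (simp add: GH' sum_distrib_left)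
      then show ?thesis by (subst (asm) sum.swap) (simp add: sum_distrib_right mult.assoc)
    qed
    also have "\<dots> = (\<Sum>i\<in>I. w m i * w m i) * H' m j"
      using m orth by (subst sum.remove[of _ m]) auto
    also have "\<dots> = H' m j"
      using norm[OF m] by (auto simp: power2_eq_square H'_def)
    finally show ?thesis .
  qed
  have sumG: "(\<Sum>i\<in>I. \<Sum>j\<in>I. (G i j)\<^sup>2) = (\<Sum>j\<in>I. \<Sum>m<K. (H' m j)\<^sup>2)"
  proof -
    have "(\<Sum>i\<in>I. (G i j)\<^sup>2) = (\<Sum>m<K. (H' m j)\<^sup>2)" if j: "j \<in> I" for j
    proof -
      have "(\<Sum>i\<in>I. (G i j)\<^sup>2) = (\<Sum>i\<in>I. \<Sum>m<K. H' m j * (w m i * G i j))"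
        using j by (intro sum.cong refl)
          (simp add: power2_eq_square GH'[symmetric] sum_distrib_right[symmetric] mult.assoc[symmetric]
            mult.commute[of "H' _ _"])
      also have "\<dots> = (\<Sum>m<K. H' m j * (\<Sum>i\<in>I. w m i * G i j))"
        by (subst sum.swap) (simp add: sum_distrib_left)
      also have "\<dots> = (\<Sum>m<K. (H' m j)\<^sup>2)"
        using wG j by (simp add: power2_eq_square)
      finally show ?thesis .
    qed
    then show ?thesis by (subst sum.swap) simp
  qed
  have "(\<Sum>i\<in>I. G i i) = (\<Sum>i\<in>I. \<Sum>m<K. w m i * H' m i)"
    by (intro sum.cong refl) (simp add: GH')
  also have "\<dots> = (\<Sum>(i,m)\<in>I \<times> {..<K}. w m i * H' m i)" by (simp add: sum.cartesian_product)
  finally have "(\<Sum>i\<in>I. G i i)\<^sup>2 \<le> (\<Sum>(i,m)\<in>I \<times> {..<K}. (w m i)\<^sup>2) * (\<Sum>(i,m)\<in>I \<times> {..<K}. (H' m i)\<^sup>2)"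
    using Cauchy_Schwarz_ineq_sum[of "\<lambda>(i,m). w m i" "\<lambda>(i,m). H' m i" "I \<times> {..<K}"]
    by (simp add: case_prod_beta)
  also have "(\<Sum>(i,m)\<in>I \<times> {..<K}. (H' m i)\<^sup>2) = (\<Sum>i\<in>I. \<Sum>j\<in>I. (G i j)\<^sup>2)"
    by (simp only: sumG sum.cartesian_product[symmetric])
  also have "(\<Sum>(i,m)\<in>I \<times> {..<K}. (w m i)\<^sup>2) = (\<Sum>m<K. \<Sum>i\<in>I. (w m i)\<^sup>2)"
    by (subst sum.swap) (simp add: sum.cartesian_product)
  finally have *: "(\<Sum>i\<in>I. G i i)\<^sup>2 \<le> (\<Sum>m<K. \<Sum>i\<in>I. (w m i)\<^sup>2) * (\<Sum>i\<in>I. \<Sum>j\<in>I. (G i j)\<^sup>2)" .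
  have "(\<Sum>m<K. \<Sum>i\<in>I. (w m i)\<^sup>2) \<le> (\<Sum>m<K. 1)"
    using norm by (intro sum_mono) fastforce
  then have "(\<Sum>m<K. \<Sum>i\<in>I. (w m i)\<^sup>2) \<le> real K" by simp
  then have "(\<Sum>m<K. \<Sum>i\<in>I. (w m i)\<^sup>2) * (\<Sum>i\<in>I. \<Sum>j\<in>I. (G i j)\<^sup>2) \<le> real K * (\<Sum>i\<in>I. \<Sum>j\<in>I. (G i j)\<^sup>2)"
    by (intro mult_right_mono sum_nonneg) auto
  with * show ?thesis by linarith
qed

section \<open>Homogeneous polynomials as combinations of monomials\<close>

definition monomials :: "nat \<Rightarrow> nat \<Rightarrow> nat list set" where
  "monomials m D = {l. length l = m \<and> sum_list l = D}"

definition monom_val :: "(nat \<Rightarrow> real) \<Rightarrow> nat list \<Rightarrow> real" where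
  "monom_val t l = (\<Prod>x<length l. t x ^ (l ! x))"

text \<open>A polynomial is a function for which coefficients exist. Later only the number of
  monomials counts: it bounds the rank of a matrix whose rows depend on parameters through such a
  function.\<close>

definition homogeneous :: "nat \<Rightarrow> nat \<Rightarrow> ((nat \<Rightarrow> real) \<Rightarrow> real) \<Rightarrow> bool" where
  "homogeneous m D F \<longleftrightarrow> (\<exists>c. \<forall>t. F t = (\<Sum>l\<in>monomials m D. c l * monom_val t l))"

lemma finite_monomials [simp]: "finite (monomials m D)"
proof (rule finite_subset)
  show "monomials m D \<subseteq> {l. set l \<subseteq> {..D} \<and> length l = m}"
    unfolding monomials_def using member_le_sum_list by auto
qed (use finite_lists_length_eq[of "{..D}" m] in auto)

lemma card_monomials: "card (monomials m D) = (D + m - 1) choose D"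
  unfolding monomials_def by (rule card_length_sum_list)

lemma homogeneous_monom: "l \<in> monomials m D \<Longrightarrow> homogeneous m D (\<lambda>t. monom_val t l)"
  unfolding homogeneous_def
  by (rule exI[of _ "\<lambda>l'. if l' = l then 1 else 0"]) (simp add: if_distrib if_distribR sum.delta cong: if_cong)

lemma homogeneous_scale: "homogeneous m D F \<Longrightarrow> homogeneous m D (\<lambda>t. c * F t)"
  unfolding homogeneous_def
proof (elim exE)
  fix c' assume "\<forall>t. F t = (\<Sum>l\<in>monomials m D. c' l * monom_val t l)"
  then show "\<exists>c'. \<forall>t. c * F t = (\<Sum>l\<in>monomials m D. c' l * monom_val t l)"
    by (intro exI[of _ "\<lambda>l. c * c' l"]) (simp add: sum_distrib_left mult.assoc)
qed

lemma homogeneous_sum: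
  assumes "finite A" "\<And>x. x \<in> A \<Longrightarrow> homogeneous m D (F x)"
  shows "homogeneous m D (\<lambda>t. \<Sum>x\<in>A. F x t)"
proof -
  obtain c where c: "\<And>x t. x \<in> A \<Longrightarrow> F x t = (\<Sum>l\<in>monomials m D. c x l * monom_val t l)"
    using assms(2) unfolding homogeneous_def by metis
  show ?thesis unfolding homogeneous_def
    by (rule exI[of _ "\<lambda>l. \<Sum>x\<in>A. c x l"], intro allI)
      (subst sum_distrib_right, subst sum.swap, simp add: c)
qed

lemma homogeneous_monom_mult:
  assumes l: "l \<in> monomials m D" and l': "l' \<in> monomials m D'"
  shows "homogeneous m (D + D') (\<lambda>t. monom_val t l * monom_val t l')"
proof -
  have len: "length l = m" "length l' = m" using l l' by (auto simp: monomials_def)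
  have "sum_list (map2 (+) l l') = sum_list l + sum_list l'"
    using len(1)[folded len(2)] by (induction l l' rule: list_induct2) auto
  then have "map2 (+) l l' \<in> monomials m (D + D')"
    using l l' by (simp add: monomials_def)
  moreover have "monom_val t (map2 (+) l l') = monom_val t l * monom_val t l'" for t
    using len by (simp add: monom_val_def power_add prod.distrib)
  ultimately show ?thesis using homogeneous_monom[of "map2 (+) l l'" m "D + D'"] by simp
qed

lemma homogeneous_mult:
  assumes F: "homogeneous m D F" and G: "homogeneous m D' G"
  shows "homogeneous m (D + D') (\<lambda>t. F t * G t)"
proof -
  obtain c c' where c: "\<And>t. F t = (\<Sum>l\<in>monomials m D. c l * monom_val t l)"
    and c': "\<And>t. G t = (\<Sum>l\<in>monomials m D'. c' l * monom_val t l)"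
    using F G unfolding homogeneous_def by metis
  have eq: "(\<lambda>t. F t * G t) =
      (\<lambda>t. \<Sum>l\<in>monomials m D. \<Sum>l'\<in>monomials m D'. (c l * c' l') * (monom_val t l * monom_val t l'))"
    unfolding c c' sum_product by (intro ext sum.cong refl) simp
  show ?thesis unfolding eq
    by (intro homogeneous_sum homogeneous_scale homogeneous_monom_mult) auto
qed

lemma homogeneous_power: "homogeneous m D F \<Longrightarrow> homogeneous m (T * D) (\<lambda>t. F t ^ T)"
proof (induction T)
  case 0
  have "replicate m 0 \<in> monomials m 0" by (simp add: monomials_def)
  from homogeneous_monom[OF this] show ?case by (simp add: monom_val_def)
next
  case (Suc T)
  then show ?case using homogeneous_mult[of m D F "T * D" "\<lambda>t. F t ^ T"] by simp
qed

lemma homogeneous_coordinate: "x < m \<Longrightarrow> homogeneous m 1 (\<lambda>t. t x)"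
proof -
  assume x: "x < m"
  have "(replicate m 0)[x := Suc 0] \<in> monomials m 1"
    using x by (simp add: monomials_def sum_list_update)
  moreover have "monom_val t ((replicate m 0)[x := 1]) = t x" for t
  proof -
    have "monom_val t ((replicate m 0)[x := 1]) = (\<Prod>y<m. if y = x then t x else 1)"
      unfolding monom_val_def length_list_update length_replicate
      by (intro prod.cong refl) (auto simp: nth_list_update)
    then show ?thesis using x by (simp add: prod.delta)
  qed
  ultimately show ?thesis using homogeneous_monom[of "(replicate m 0)[x := Suc 0]" m 1] by simp
qed

section \<open>Packing bounds and nets\<close>

text \<open>Take the Gram matrix with entries raised to the power \<open>T\<close>. Its diagonal is
  1, every row has square sum at most 2, and its rank is at most the number \<open>K\<close> of
  monomials of degree 2 T, because row i is a polynomial in \<open>t i\<close>. The trace inequality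
  reads N^2 <= K * 2 N.\<close>

lemma packing_card_le:
  fixes u :: "'i \<Rightarrow> 'e \<Rightarrow> real"
  assumes I: "finite I" and E: "finite E"
    and quad: "\<And>e. e \<in> E \<Longrightarrow> homogeneous m 2 (\<phi> e)"
    and param: "\<And>i e. i \<in> I \<Longrightarrow> e \<in> E \<Longrightarrow> u i e = \<phi> e (t i)"
    and unit: "\<And>i. i \<in> I \<Longrightarrow> (\<Sum>e\<in>E. (u i e)\<^sup>2) = 1"
    and sep: "\<And>i j. i \<in> I \<Longrightarrow> j \<in> I \<Longrightarrow> i \<noteq> j \<Longrightarrow> \<bar>\<Sum>e\<in>E. u i e * u j e\<bar> \<le> \<rho>"
    and T: "\<rho> ^ (2 * T) * real (card I) \<le> 1"
  shows "card I \<le> 2 * card (monomials m (2 * T))"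
proof -
  define K where "K = card (monomials m (2 * T))"
  define G where "G i j = (\<Sum>e\<in>E. u i e * u j e) ^ T" for i j
  have "homogeneous m (T * 2) (\<lambda>s. (\<Sum>e\<in>E. u j e * \<phi> e s) ^ T)" for j
    by (intro homogeneous_power homogeneous_sum homogeneous_scale quad E)
  then have "\<forall>j. \<exists>c. \<forall>s. (\<Sum>e\<in>E. u j e * \<phi> e s) ^ T = (\<Sum>l\<in>monomials m (2 * T). c l * monom_val s l)"
    by (simp add: homogeneous_def mult.commute[of T 2])
  from choice[OF this] obtain c where
    c: "(\<Sum>e\<in>E. u j e * \<phi> e s) ^ T = (\<Sum>l\<in>monomials m (2 * T). c j l * monom_val s l)" for j s
    by auto
  obtain h where h: "bij_betw h {0..<K} (monomials m (2 * T))"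
    using ex_bij_betw_nat_finite[of "monomials m (2 * T)"] by (auto simp: K_def)
  have G_sep: "G i j = (\<Sum>l<K. monom_val (t i) (h l) * c j (h l))" if "i \<in> I" "j \<in> I" for i j
  proof -
    have "G i j = (\<Sum>e\<in>E. u j e * \<phi> e (t i)) ^ T"
      using that param by (simp add: G_def mult.commute)
    also have "\<dots> = (\<Sum>l\<in>monomials m (2 * T). c j l * monom_val (t i) l)" by (rule c)
    also have "\<dots> = (\<Sum>l<K. c j (h l) * monom_val (t i) (h l))"
      using sum.reindex_bij_betw[OF h, of "\<lambda>l. c j l * monom_val (t i) l"] by (simp add: atLeast0LessThan)
    finally show ?thesis by (simp add: mult.commute)
  qed
  have tr: "(\<Sum>i\<in>I. G i i)\<^sup>2 \<le> real K * (\<Sum>i\<in>I. \<Sum>j\<in>I. (G i j)\<^sup>2)"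
    by (rule trace_square_le_rank[OF I G_sep])
  have diag: "G i i = 1" if "i \<in> I" for i
    using unit[OF that] by (simp add: G_def power2_eq_square)
  have off: "(G i j)\<^sup>2 \<le> \<rho> ^ (2 * T)" if "i \<in> I" "j \<in> I" "i \<noteq> j" for i j
  proof -
    have "(G i j)\<^sup>2 = \<bar>\<Sum>e\<in>E. u i e * u j e\<bar> ^ (2 * T)"
      by (simp add: G_def power_mult[symmetric] mult.commute power_even_abs)
    also have "\<dots> \<le> \<rho> ^ (2 * T)" by (intro power_mono sep that) simp
    finally show ?thesis .
  qed
  have row: "(\<Sum>j\<in>I. (G i j)\<^sup>2) \<le> 2" if i: "i \<in> I" for i
  proof -
    have "(\<Sum>j\<in>I. (G i j)\<^sup>2) = 1 + (\<Sum>j\<in>I - {i}. (G i j)\<^sup>2)"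
      using I i diag by (simp add: sum.remove)
    also have "(\<Sum>j\<in>I - {i}. (G i j)\<^sup>2) \<le> (\<Sum>j\<in>I - {i}. \<rho> ^ (2 * T))"
      by (intro sum_mono off) (use i in auto)
    also have "\<dots> \<le> real (card I) * \<rho> ^ (2 * T)"
      using I i by (simp, intro mult_right_mono) (auto simp: card_Diff_subset)
    finally show ?thesis using T by (simp add: mult.commute)
  qed
  have "(\<Sum>i\<in>I. \<Sum>j\<in>I. (G i j)\<^sup>2) \<le> (\<Sum>i\<in>I. 2)" by (intro sum_mono row)
  then have "(\<Sum>i\<in>I. \<Sum>j\<in>I. (G i j)\<^sup>2) \<le> 2 * real (card I)" by simp
  then have "real K * (\<Sum>i\<in>I. \<Sum>j\<in>I. (G i j)\<^sup>2) \<le> real K * (2 * real (card I))"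
    by (intro mult_left_mono) auto
  moreover have "(\<Sum>i\<in>I. G i i) = real (card I)" using diag by simp
  ultimately have "real (card I) * real (card I) \<le> (2 * real K) * real (card I)"
    using tr by (simp add: power2_eq_square)
  then have "real (card I) \<le> 2 * real K"
    by (cases "card I = 0") (auto simp: mult_le_cancel_right)
  then show ?thesis unfolding K_def by linarith
qed

lemma power_self_le_fact: "real m ^ m \<le> 3 ^ m * fact m"
proof -
  have "(real m ^ m) /\<^sub>R fact m \<le> exp (real m)"
    using sum_le_suminf[OF summable_exp_generic[of "real m"], of "{m}"] by (simp add: exp_def)
  also have "exp (real m) = exp 1 ^ m" by (simp add: exp_of_nat_mult[symmetric])
  also have "\<dots> \<le> 3 ^ m" using exp_le by (intro power_mono) auto
  finally show ?thesis by (simp add: field_simps)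
qed

text \<open>The degree is a multiple of the number of variables, so m^m / m! <= 3^m applies and the
  count is exponential in m with a base linear in q. A factor m^m would cost a logarithm in the
  final rate.\<close>

lemma card_monomials_le:
  assumes m: "1 \<le> m"
  shows "real (card (monomials m (m * q))) \<le> (3 * (real q + 1)) ^ m"
proof -
  have "card (monomials m (m * q)) = (m * q + m - 1) choose (m - 1)"
    unfolding card_monomials using m by (subst binomial_symmetric) auto
  also have "\<dots> \<le> (m * q + m) choose m"
    using m by (cases m) auto
  finally have "real (card (monomials m (m * q))) * fact m \<le> real (((m * q + m) choose m) * fact m)"
    by (simp add: mult_right_mono)
  also have "\<dots> \<le> real ((m * q + m) ^ m)"
    using binomial_fact_pow by (metis of_nat_mono of_nat_fact of_nat_id)
  also have "\<dots> = (real q + 1) ^ m * real m ^ m"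
    by (simp add: power_mult_distrib[symmetric] algebra_simps)
  also have "\<dots> \<le> (real q + 1) ^ m * (3 ^ m * fact m)"
    by (intro mult_left_mono power_self_le_fact) auto
  finally have "real (card (monomials m (m * q))) * fact m \<le> (3 * (real q + 1)) ^ m * fact m"
    by (simp only: power_mult_distrib mult_ac)
  then show ?thesis by (rule mult_right_le_imp_le) simp
qed

text \<open>Argue with a subfamily of exactly 4096^(m (k + 1)) points, which fixes the exponent T
  beforehand. The packing bound then has base at most 150 * 128^k per variable, where 64^k comes
  from the separation and k + 1 <= 2^k supplies the remaining 2^k. This is less than 4096^(k +
  1).\<close>

lemma separated_card_less:
  fixes u :: "'i \<Rightarrow> 'e \<Rightarrow> real"
  assumes I: "finite I" and E: "finite E" and m: "1 \<le> m"
    and quad: "\<And>e. e \<in> E \<Longrightarrow> homogeneous m 2 (\<phi> e)"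
    and param: "\<And>i e. i \<in> I \<Longrightarrow> e \<in> E \<Longrightarrow> u i e = \<phi> e (t i)"
    and unit: "\<And>i. i \<in> I \<Longrightarrow> (\<Sum>e\<in>E. (u i e)\<^sup>2) = 1"
    and sep: "\<And>i j. i \<in> I \<Longrightarrow> j \<in> I \<Longrightarrow> i \<noteq> j \<Longrightarrow> \<bar>\<Sum>e\<in>E. u i e * u j e\<bar> \<le> 1 - (1 / 64) ^ k / 2"
  shows "card I < 4096 ^ (m * (k + 1))"
proof (rule ccontr)
  assume "\<not> card I < 4096 ^ (m * (k + 1))"
  then obtain J where J: "J \<subseteq> I" "card J = 4096 ^ (m * (k + 1))"
    by (meson not_less obtain_subset_with_card_n)
  \<comment> \<open>Chosen so that T / 64^k = 12 m (k + 1). With exp 1 >= 2 this gives \<rho>^(2 T)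
    <= 2^(- 12 m (k + 1)), the reciprocal of the number of points, as 4096 = 2^12.\<close>
  define q where "q = 12 * (k + 1) * 64 ^ k"
  define T where "T = m * q"
  define \<rho> :: real where "\<rho> = 1 - (1 / 64) ^ k / 2"
  have p1: "(1 / 64 :: real) ^ k \<le> 1" by (simp add: power_le_one)
  have "\<rho> \<le> exp (- ((1 / 64) ^ k / 2))"
    using exp_ge_add_one_self[of "- ((1 / 64 :: real) ^ k / 2)"] by (simp add: \<rho>_def)
  moreover have "0 \<le> \<rho>" using p1 by (simp add: \<rho>_def)
  ultimately have "\<rho> ^ (2 * T) \<le> exp (- ((1 / 64) ^ k / 2)) ^ (2 * T)"
    by (intro power_mono)
  also have "\<dots> = exp (- (real T * (1 / 64) ^ k))"
    by (simp add: exp_of_nat_mult[symmetric] field_simps)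
  also have "real T * (1 / 64) ^ k = real (12 * (m * (k + 1)))"
    by (simp add: T_def q_def power_one_over field_simps)
  also have "exp (- real (12 * (m * (k + 1)))) = 1 / exp 1 ^ (12 * (m * (k + 1)))"
    by (simp only: exp_minus exp_of_nat_mult[symmetric] inverse_eq_divide mult_1_right)
  also have "\<dots> \<le> 1 / 2 ^ (12 * (m * (k + 1)))"
    using exp_ge_add_one_self[of 1] by (intro divide_left_mono power_mono) auto
  also have "(2::real) ^ (12 * (m * (k + 1))) = 4096 ^ (m * (k + 1))"
    by (subst power_mult) simp
  finally have "\<rho> ^ (2 * T) * real (card J) \<le> 1"
    by (simp add: J field_simps)
  then have "card J \<le> 2 * card (monomials m (2 * T))"
    using J(1) by (intro packing_card_le[OF finite_subset[OF J(1) I] E quad, where u=u and t=t and \<rho>=\<rho>])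
      (auto simp: \<rho>_def intro!: param unit sep)
  then have "real (card J) \<le> 2 * real (card (monomials m (m * (2 * q))))"
    by (simp add: T_def mult.left_commute)
  also have "\<dots> \<le> 2 * (3 * (real (2 * q) + 1)) ^ m"
    using card_monomials_le[OF m, of "2 * q"] by simp
  also have "\<dots> \<le> 2 ^ m * (3 * (real (2 * q) + 1)) ^ m"
    using m self_le_power[of "2::real" m] by (intro mult_right_mono) auto
  also have "\<dots> = (2 * (3 * (real (2 * q) + 1))) ^ m" by (rule power_mult_distrib[symmetric])
  also have "\<dots> < (4096 ^ (k + 1)) ^ m"
  proof (rule power_strict_mono)
    have k: "real (k + 1) \<le> 2 ^ k" using less_exp[of k] by (metis Suc_eq_plus1 Suc_leI of_nat_le_iff of_nat_numeral of_nat_power)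
    have "2 * (3 * (real (2 * q) + 1)) = 144 * (real (k + 1) * 64 ^ k) + 6"
      by (simp add: q_def algebra_simps)
    also have "\<dots> \<le> 144 * (2 ^ k * 64 ^ k) + 6"
      using k by (intro add_right_mono mult_left_mono mult_right_mono) auto
    also have "\<dots> = 144 * 128 ^ k + 6" by (simp add: power_mult_distrib[symmetric])
    also have "\<dots> \<le> 150 * 128 ^ k" using one_le_power[of "128::real" k] by linarith
    also have "\<dots> < 4096 ^ (k + 1)"
      using power_mono[of "128::real" 4096 k] zero_less_power[of "128::real" k] by (simp; linarith)
    finally show "2 * (3 * (real (2 * q) + 1)) < 4096 ^ (k + 1)" .
  qed (use m in auto)
  also have "\<dots> = real (card J)" by (simp only: J of_nat_power of_nat_numeral power_mult[symmetric] mult.commute)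
  finally show False by simp
qed

text \<open>A separated family of maximal size exists because sizes are bounded. Even powers of
  inner products cannot tell a vector from its antipode, so maximality yields closeness only up to
  sign; adding the negatives repairs this and costs the factor 2. For unit vectors the squared
  distance is 2 - 2 <u, a>, which turns the separation 1 - 64^(-k) / 2 into distance 8^(-k).\<close>

lemma net_exists:
  fixes v :: "'u \<Rightarrow> 'e \<Rightarrow> real"
  assumes E: "finite E" and m: "1 \<le> m"
    and quad: "\<And>e. e \<in> E \<Longrightarrow> homogeneous m 2 (\<phi> e)"
    and param: "\<And>u. u \<in> C \<Longrightarrow> \<exists>t. \<forall>e\<in>E. v u e = \<phi> e t"
    and unit: "\<And>u. u \<in> C \<Longrightarrow> (\<Sum>e\<in>E. (v u e)\<^sup>2) = 1"
    and neg: "\<And>u. u \<in> C \<Longrightarrow> \<exists>u'\<in>C. \<forall>e\<in>E. v u' e = - v u e"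
  shows "\<exists>N\<subseteq>C. finite N \<and> card N \<le> 2 * 4096 ^ (m * (k + 1))
    \<and> (\<forall>u\<in>C. \<exists>a\<in>N. (\<Sum>e\<in>E. (v u e - v a e)\<^sup>2) \<le> (1 / 64) ^ k)"
proof -
  define ip where "ip a b = (\<Sum>e\<in>E. v a e * v b e)" for a b
  define sepd where "sepd I \<longleftrightarrow> I \<subseteq> C \<and> finite I \<and>
    (\<forall>a\<in>I. \<forall>b\<in>I. a \<noteq> b \<longrightarrow> \<bar>ip a b\<bar> \<le> 1 - (1 / 64) ^ k / 2)" for I
  obtain t where t: "\<And>u e. u \<in> C \<Longrightarrow> e \<in> E \<Longrightarrow> v u e = \<phi> e (t u)"
    using param by metis
  obtain ng where ng: "\<And>u. u \<in> C \<Longrightarrow> ng u \<in> C" "\<And>u e. u \<in> C \<Longrightarrow> e \<in> E \<Longrightarrow> v (ng u) e = - v u e"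
    using neg by metis
  have bound: "card I < 4096 ^ (m * (k + 1))" if "sepd I" for I
    using that by (intro separated_card_less[OF _ E m quad, where u=v and t=t])
      (auto simp: sepd_def ip_def intro!: t unit)
  have "sepd {}" by (simp add: sepd_def)
  then obtain I where I: "sepd I" and max: "\<And>I'. sepd I' \<Longrightarrow> card I' \<le> card I"
    using ex_has_greatest_nat[of sepd "{}" card "4096 ^ (m * (k + 1))"] bound by auto
  have I': "I \<subseteq> C" "finite I" using I by (auto simp: sepd_def)
  have ip_self: "ip u u = 1" if "u \<in> C" for u
    using unit[OF that] by (simp add: ip_def power2_eq_square)
  have close: "\<exists>a\<in>I. \<bar>ip u a\<bar> > 1 - (1 / 64) ^ k / 2" if u: "u \<in> C" for u
  proof (rule ccontr)
    assume "\<not> ?thesis"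
    then have le: "\<bar>ip u a\<bar> \<le> 1 - (1 / 64) ^ k / 2" if "a \<in> I" for a
      using that by force
    have "u \<notin> I"
    proof
      assume "u \<in> I"
      from le[OF this] ip_self[OF u] zero_less_power[of "1 / 64 :: real" k] show False by linarith
    qed
    have "sepd (insert u I)"
      using I u le by (auto simp: sepd_def ip_def mult.commute)
    from max[OF this] \<open>u \<notin> I\<close> I' show False by simp
  qed
  show ?thesis
  proof (intro exI[of _ "I \<union> ng ` I"] conjI ballI)
    show "I \<union> ng ` I \<subseteq> C" using I' ng by auto
    show "finite (I \<union> ng ` I)" using I' by simp
    have "card (I \<union> ng ` I) \<le> card I + card I"
      using card_Un_le[of I "ng ` I"] card_image_le[OF I'(2), of ng] by linarith
    then show "card (I \<union> ng ` I) \<le> 2 * 4096 ^ (m * (k + 1))"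
      using bound[OF I] by linarith
  next
    fix u assume u: "u \<in> C"
    from close[OF u] obtain a where a: "a \<in> I" "\<bar>ip u a\<bar> > 1 - (1 / 64) ^ k / 2" by blast
    then have aC: "a \<in> C" using I' by auto
    have ex: "(\<Sum>e\<in>E. (v u e - s * v a e)\<^sup>2) = 1 + s\<^sup>2 - 2 * s * ip u a" for s
    proof -
      have "(\<Sum>e\<in>E. (v u e - s * v a e)\<^sup>2) = (\<Sum>e\<in>E. (v u e)\<^sup>2) + s\<^sup>2 * (\<Sum>e\<in>E. (v a e)\<^sup>2) - 2 * s * ip u a"
        unfolding ip_def sum_distrib_left sum.distrib[symmetric] sum_subtractf[symmetric]
        by (intro sum.cong refl) (simp add: power2_eq_square algebra_simps)
      then show ?thesis using unit[OF u] unit[OF aC] by simp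
    qed
    show "\<exists>a\<in>I \<union> ng ` I. (\<Sum>e\<in>E. (v u e - v a e)\<^sup>2) \<le> (1 / 64) ^ k"
    proof (cases "ip u a \<ge> 0")
      case True
      then show ?thesis using a ex[of 1] by (intro bexI[of _ a]) auto
    next
      case False
      then show ?thesis using a ex[of "-1"] ng(2)[OF aC] by (intro bexI[of _ "ng a"]) auto
    qed
  qed
qed

section \<open>Rank factorization and the spectral theorem\<close>

text \<open>A maximal independent set of columns has rank many elements and spans all columns.
  Padding with zero terms to length \<open>k\<close> gives all matrices of rank at most
  \<open>k\<close> the same number of parameters, as the packing argument requires.\<close>

lemma low_rank_factorization:
  fixes A :: "real mat"
  assumes A: "A \<in> carrier_mat p1 p2" and r: "mat_rank A \<le> k"
  shows "\<exists>a b. \<forall>i<p1. \<forall>j<p2. A $$ (i, j) = (\<Sum>l<k. a l i * b l j)"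
proof -
  interpret V: vec_space "TYPE(real)" p1 .
  let ?cs = "set (cols A)"
  have cs: "?cs \<subseteq> carrier_vec p1" using A cols_dim by blast
  obtain S where S: "finite S" "maximal S (\<lambda>T. T \<subseteq> ?cs \<and> V.lin_indpt T)"
    using maximal_exists_superset[of ?cs "\<lambda>T. T \<subseteq> ?cs \<and> V.lin_indpt T" "{}"]
    by (auto simp: V.lin_dep_def)
  have Scs: "S \<subseteq> ?cs" and Si: "V.lin_indpt S" using S(2) by (auto simp: maximal_def)
  have "V.rank A = card S" by (rule V.rank_card_indpt[OF A S(2)])
  then have card: "card S \<le> k" using r A by (simp add: mat_rank_def)
  have SC: "S \<subseteq> carrier_vec p1" using Scs cs by blast
  have "\<exists>c. \<forall>i<p1. A $$ (i, j) = (\<Sum>v\<in>S. c v * v $ i)" if j: "j < p2" for j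
  proof -
    have cj: "col A j \<in> ?cs" using j A by (metis carrier_matD(2) cols_length cols_nth nth_mem)
    have "col A j \<in> V.span S"
    proof (cases "col A j \<in> S")
      case True
      then show ?thesis using SC V.in_own_span by blast
    next
      case False
      have "\<not> (insert (col A j) S \<subseteq> ?cs \<and> V.lin_indpt (insert (col A j) S))"
      proof
        assume "insert (col A j) S \<subseteq> ?cs \<and> V.lin_indpt (insert (col A j) S)"
        then have "insert (col A j) S = S" using S(2) unfolding maximal_def by blast
        then show False using False by blast
      qed
      then have "V.lin_dep (insert (col A j) S)" using Scs cj by blast
      moreover have "col A j \<in> carrier_vec p1" using cj cs by blast
      ultimately show ?thesis
        using V.lin_dep_iff_in_span[OF SC Si _ False] by simp
    qed
    from V.finite_in_span[OF S(1) SC this]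
    obtain c where c: "V.lincomb c S = col A j" by (elim exE conjE) (rule that)
    have "A $$ (i, j) = (\<Sum>v\<in>S. c v * v $ i)" if i: "i < p1" for i
    proof -
      have "A $$ (i, j) = col A j $ i" using A i j by simp
      then show ?thesis using V.lincomb_index[OF i SC, of c] c by simp
    qed
    then show ?thesis by blast
  qed
  then have "\<forall>j. \<exists>c. j < p2 \<longrightarrow> (\<forall>i<p1. A $$ (i, j) = (\<Sum>v\<in>S. c v * v $ i))" by blast
  from choice[OF this] obtain c where
    c: "\<And>i j. j < p2 \<Longrightarrow> i < p1 \<Longrightarrow> A $$ (i, j) = (\<Sum>v\<in>S. c j v * v $ i)" by blast
  obtain h where h: "bij_betw h {0..<card S} S" using ex_bij_betw_nat_finite[OF S(1)] by blast
  define a where "a l i = (if l < card S then h l $ i else 0)" for l i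
  define b where "b l j = (if l < card S then c j (h l) else 0)" for l j
  have "A $$ (i, j) = (\<Sum>l<k. a l i * b l j)" if "i < p1" "j < p2" for i j
  proof -
    have "A $$ (i, j) = (\<Sum>l<card S. c j (h l) * h l $ i)"
      using c[OF that(2,1)] sum.reindex_bij_betw[OF h, of "\<lambda>v. c j v * v $ i"]
      by (simp add: atLeast0LessThan)
    also have "\<dots> = (\<Sum>l<card S. a l i * b l j)" by (simp add: a_def b_def mult.commute)
    also have "\<dots> = (\<Sum>l<k. a l i * b l j)"
      using card by (intro sum.mono_neutral_left) (auto simp: a_def)
    finally show ?thesis .
  qed
  then show ?thesis by blast
qed

lemma mat_rank_le_factorization:
  fixes A :: "real mat"
  assumes A: "A \<in> carrier_mat p1 p2"
    and fac: "\<And>i j. i < p1 \<Longrightarrow> j < p2 \<Longrightarrow> A $$ (i, j) = (\<Sum>l<k. a l i * b l j)"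
  shows "mat_rank A \<le> k"
proof -
  interpret V: vec_space "TYPE(real)" p1 .
  have "V.rank (mat p1 p2 (\<lambda>(i, j). \<Sum>l<k. a l i * b l j)) \<le> k"
  proof (induction k)
    case 0
    have "mat p1 p2 (\<lambda>(i, j). \<Sum>l<0. a l i * b l j) = 0\<^sub>m p1 p2" by (rule eq_matI) auto
    then show ?case using V.rank_0I[of p2] by (simp only:)
  next
    case (Suc k)
    let ?X = "mat p1 p2 (\<lambda>(i, j). \<Sum>l<k. a l i * b l j)" and ?Y = "mat p1 p2 (\<lambda>(i, j). a k i * b k j)"
    have "mat p1 p2 (\<lambda>(i, j). \<Sum>l<Suc k. a l i * b l j) = ?X + ?Y" by (rule eq_matI) auto
    moreover have "V.rank (?X + ?Y) \<le> V.rank ?X + V.rank ?Y" by (rule V.rank_subadditive) auto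
    moreover have "V.rank ?Y \<le> 1"
      by (rule V.rank_le_1_product_entries[where f="a k" and g="b k"]) auto
    ultimately show ?case using Suc.IH by simp
  qed
  moreover have "mat p1 p2 (\<lambda>(i, j). \<Sum>l<k. a l i * b l j) = A"
    using A fac by (intro eq_matI) auto
  ultimately show ?thesis using A by (simp add: mat_rank_def)
qed

lemma mat_rank_smult_le:
  fixes A :: "real mat"
  assumes A: "A \<in> carrier_mat p1 p2"
  shows "mat_rank (c \<cdot>\<^sub>m A) \<le> mat_rank A"
proof -
  obtain a b where ab: "\<And>i j. i < p1 \<Longrightarrow> j < p2 \<Longrightarrow> A $$ (i, j) = (\<Sum>l<mat_rank A. a l i * b l j)"
    using low_rank_factorization[OF A order_refl] by blast
  show ?thesis
    by (rule mat_rank_le_factorization[where a="\<lambda>l i. c * a l i" and b=b])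
      (use A ab in \<open>auto simp: sum_distrib_left mult.assoc\<close>)
qed

lemma mat_rank_diff_le:
  fixes A B :: "real mat"
  assumes A: "A \<in> carrier_mat p1 p2" and B: "B \<in> carrier_mat p1 p2"
  shows "mat_rank (A - B) \<le> mat_rank A + mat_rank B"
proof -
  interpret V: vec_space "TYPE(real)" p1 .
  have "A - B = A + (- 1) \<cdot>\<^sub>m B" using A B by (intro eq_matI) auto
  then have "mat_rank (A - B) \<le> mat_rank A + mat_rank ((- 1) \<cdot>\<^sub>m B)"
    using V.rank_subadditive[OF A, of "(- 1) \<cdot>\<^sub>m B"] A B by (simp add: mat_rank_def)
  then show ?thesis using mat_rank_smult_le[OF B, of "- 1"] by simp
qed

section \<open>Spectral theorem for real symmetric matrices\<close>

lemma symmetric_eigenvalue_real: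
  assumes A: "A \<in> carrier_mat n n" and sym: "A\<^sup>T = (A :: real mat)"
    and ev: "eigenvalue (map_mat complex_of_real A) z"
  shows "z \<in> \<real>"
proof -
  obtain v where v: "v \<in> carrier_vec n" "v \<noteq> 0\<^sub>v n" "map_mat complex_of_real A *\<^sub>v v = z \<cdot>\<^sub>v v"
    using ev A by (auto simp: eigenvalue_def eigenvector_def)
  have symA: "A $$ (i, j) = A $$ (j, i)" if "i < n" "j < n" for i j
    using that A arg_cong[OF sym, of "\<lambda>M. M $$ (j, i)"] by simp
  have Av: "(\<Sum>j<n. complex_of_real (A $$ (i, j)) * v $ j) = z * v $ i" if "i < n" for i
    using arg_cong[OF v(3), of "\<lambda>x. x $ i"] that A v(1)
    by (simp add: scalar_prod_def atLeast0LessThan)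
  define q where "q = (\<Sum>i<n. \<Sum>j<n. cnj (v $ i) * (complex_of_real (A $$ (i, j)) * v $ j))"
  have "q = (\<Sum>i<n. cnj (v $ i) * (z * v $ i))"
    unfolding q_def by (intro sum.cong refl) (simp add: Av sum_distrib_left[symmetric])
  also have "\<dots> = z * complex_of_real (\<Sum>i<n. (cmod (v $ i))\<^sup>2)"
    by (simp add: sum_distrib_left mult_ac complex_norm_square del: of_real_power)
  finally have qz: "q = z * complex_of_real (\<Sum>i<n. (cmod (v $ i))\<^sup>2)" .
  have "cnj q = (\<Sum>i<n. \<Sum>j<n. cnj (v $ j) * (complex_of_real (A $$ (j, i)) * v $ i))"
    unfolding q_def cnj_sum by (intro sum.cong refl) (simp add: symA mult_ac)
  also have "\<dots> = q" unfolding q_def by (rule sum.swap)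
  finally have "cnj q = q" .
  then have "q \<in> \<real>" by (simp add: Reals_cnj_iff)
  moreover have "(\<Sum>i<n. (cmod (v $ i))\<^sup>2) \<noteq> 0"
  proof
    assume "(\<Sum>i<n. (cmod (v $ i))\<^sup>2) = 0"
    then have "\<forall>i<n. v $ i = 0" by (simp add: sum_nonneg_eq_0_iff)
    then have "v = 0\<^sub>v n" using v(1) by (intro eq_vecI) auto
    then show False using v(2) by simp
  qed
  then have "z = q / complex_of_real (\<Sum>i<n. (cmod (v $ i))\<^sup>2)"
    unfolding qz by (metis nonzero_mult_div_cancel_right of_real_eq_0_iff)
  ultimately show ?thesis by (simp only: Reals_divide Reals_of_real)
qed

text \<open>Over the complex numbers the polynomial always splits. The roots are real, so the
  factorization descends by comparing coefficients. The Schur decomposition takes it as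
  input.\<close>

lemma symmetric_char_poly_splits:
  assumes A: "A \<in> carrier_mat n n" and sym: "A\<^sup>T = (A :: real mat)"
  shows "\<exists>es. char_poly A = (\<Prod>e\<leftarrow>es. [:- e, 1:])"
proof -
  interpret mp: map_poly_comm_ring_hom complex_of_real ..
  let ?Ac = "map_mat complex_of_real A"
  have Ac: "?Ac \<in> carrier_mat n n" using A by simp
  obtain as where as: "char_poly ?Ac = (\<Prod>a\<leftarrow>as. [:- a, 1:])" using char_poly_factorized[OF Ac] by blast
  have "a \<in> \<real>" if a: "a \<in> set as" for a
  proof (rule symmetric_eigenvalue_real[OF A sym])
    have "poly (char_poly ?Ac) a = 0"
      using a unfolding as by (induction as) auto
    then show "eigenvalue ?Ac a" using eigenvalue_root_char_poly[OF Ac] by simp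
  qed
  then have "map complex_of_real (map Re as) = as"
    by (intro nth_equalityI) auto
  then have "char_poly ?Ac = (\<Prod>a\<leftarrow>map complex_of_real (map Re as). [:- a, 1:])" using as by simp
  also have "\<dots> = map_poly complex_of_real (\<Prod>e\<leftarrow>map Re as. [:- e, 1:])"
  proof (induction as)
    case (Cons a as)
    have "map_poly complex_of_real ([:- Re a, 1:] * (\<Prod>e\<leftarrow>map Re as. [:- e, 1:]))
        = map_poly complex_of_real [:- Re a, 1:] * map_poly complex_of_real (\<Prod>e\<leftarrow>map Re as. [:- e, 1:])"
      by (rule mp.hom_mult)
    then show ?case using Cons by (simp add: map_poly_pCons)
  qed simp
  finally have "char_poly ?Ac = map_poly complex_of_real (\<Prod>e\<leftarrow>map Re as. [:- e, 1:])" .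
  moreover have "char_poly ?Ac = map_poly complex_of_real (char_poly A)" by (rule of_real_hom.char_poly_hom[OF A])
  ultimately have eqp: "map_poly complex_of_real (char_poly A) = map_poly complex_of_real (\<Prod>e\<leftarrow>map Re as. [:- e, 1:])"
    by (simp only:)
  have "coeff (char_poly A) i = coeff (\<Prod>e\<leftarrow>map Re as. [:- e, 1:]) i" for i
  proof -
    have "coeff (map_poly complex_of_real (char_poly A)) i
        = coeff (map_poly complex_of_real (\<Prod>e\<leftarrow>map Re as. [:- e, 1:])) i" by (simp only: eqp)
    then show ?thesis by (subst (asm) (1 2) coeff_map_poly) (simp_all only: of_real_0 of_real_eq_iff)
  qed
  then have "char_poly A = (\<Prod>e\<leftarrow>map Re as. [:- e, 1:])" by (rule poly_eqI)
  then show ?thesis by blast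
qed

text \<open>The Schur form gives A P = P B with B upper triangular, so A preserves the span of the
  first columns of P. Gram-Schmidt on these columns keeps the spans, hence <w_k, A w_l> = 0 for l <
  k, and symmetry of A gives the other half.\<close>

lemma symmetric_spectral:
  assumes A: "A \<in> carrier_mat n n" and sym: "A\<^sup>T = (A :: real mat)"
  shows "\<exists>W D. W \<in> carrier_mat n n \<and> D \<in> carrier_mat n n \<and> W * W\<^sup>T = 1\<^sub>m n \<and> W\<^sup>T * W = 1\<^sub>m n
    \<and> (\<forall>i<n. \<forall>j<n. i \<noteq> j \<longrightarrow> D $$ (i, j) = 0) \<and> A = W\<^sup>T * D * W"
proof -
  obtain es where es: "char_poly A = (\<Prod>e\<leftarrow>es. [:- e, 1:])"
    using symmetric_char_poly_splits[OF A sym] by blast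
  obtain B P Q where schur: "schur_decomposition A es = (B, P, Q)" by (cases "schur_decomposition A es") auto
  from schur_decomposition[OF A es schur] have wit: "similar_mat_wit A B P Q" and ut: "upper_triangular B" by auto
  note w = similar_mat_witD2[OF A wit]
  have dims: "B \<in> carrier_mat n n" "P \<in> carrier_mat n n" "Q \<in> carrier_mat n n"
    and PQ: "P * Q = 1\<^sub>m n" "Q * P = 1\<^sub>m n" and ABQ: "A = P * B * Q" using w by auto
  have "A * P = P * B * (Q * P)" using dims A ABQ by (simp add: assoc_mult_mat[of _ n n _ n _ n])
  then have AP: "A * P = P * B" using dims PQ by simp
  define p where "p k i = P $$ (i, k)" for k i
  have symA: "A $$ (i, j) = A $$ (j, i)" if "i < n" "j < n" for i j
    using that A arg_cong[OF sym, of "\<lambda>M. M $$ (j, i)"] by simp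
  have Ap: "(\<Sum>j<n. A $$ (i, j) * p k j) = (\<Sum>l\<le>k. B $$ (l, k) * p l i)" if "i < n" "k < n" for i k
  proof -
    have "(\<Sum>j<n. A $$ (i, j) * p k j) = (A * P) $$ (i, k)"
      using that A dims by (simp add: scalar_prod_def atLeast0LessThan p_def)
    also have "\<dots> = (\<Sum>l<n. B $$ (l, k) * p l i)"
      unfolding AP using that dims by (simp add: scalar_prod_def atLeast0LessThan p_def mult.commute)
    also have "\<dots> = (\<Sum>l\<le>k. B $$ (l, k) * p l i)"
      using that ut dims by (intro sum.mono_neutral_right) (auto simp: upper_triangular_def)
    finally show ?thesis .
  qed
  obtain w where w:
    "\<forall>l<n. \<forall>m<n. l \<noteq> m \<longrightarrow> (\<Sum>i<n. w l i * w m i) = 0"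
    "\<forall>l<n. (\<Sum>i<n. (w l i)\<^sup>2) = 1 \<or> (\<forall>i\<in>{..<n}. w l i = 0)"
    "\<forall>l<n. \<exists>c. \<forall>i\<in>{..<n}. p l i = (\<Sum>m\<le>l. c m * w m i)"
    "\<forall>l<n. \<exists>c. \<forall>i\<in>{..<n}. w l i = (\<Sum>m\<le>l. c m * p m i)"
    using orthonormalize[OF finite_lessThan, of n n p] by (elim exE conjE) (rule that)
  have "\<forall>l. \<exists>c. l < n \<longrightarrow> (\<forall>i<n. p l i = (\<Sum>m\<le>l. c m * w m i))"
  proof
    fix l show "\<exists>c. l < n \<longrightarrow> (\<forall>i<n. p l i = (\<Sum>m\<le>l. c m * w m i))"
      using spec[OF w(3), of l] by (simp only: Ball_def lessThan_iff) blast
  qed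
  from choice[OF this] obtain cp where cp: "\<And>l i. l < n \<Longrightarrow> i < n \<Longrightarrow> p l i = (\<Sum>m\<le>l. cp l m * w m i)" by blast
  have "\<forall>l. \<exists>c. l < n \<longrightarrow> (\<forall>i<n. w l i = (\<Sum>m\<le>l. c m * p m i))"
  proof
    fix l show "\<exists>c. l < n \<longrightarrow> (\<forall>i<n. w l i = (\<Sum>m\<le>l. c m * p m i))"
      using spec[OF w(4), of l] by (simp only: Ball_def lessThan_iff) blast
  qed
  from choice[OF this] obtain cw where cw: "\<And>l i. l < n \<Longrightarrow> i < n \<Longrightarrow> w l i = (\<Sum>m\<le>l. cw l m * p m i)" by blast
  have Qp: "(\<Sum>i<n. Q $$ (k, i) * p l i) = (if k = l then 1 else 0)" if "k < n" "l < n" for k l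
    using that dims arg_cong[OF PQ(2), of "\<lambda>M. M $$ (k, l)"]
    by (simp add: scalar_prod_def atLeast0LessThan p_def)
  \<comment> \<open>Zero slots do not occur. If \<open>w k\<close> vanished, column k of P would be
    a combination of earlier columns; row k of Q annihilates these but pairs to 1 with column
    k.\<close>
  have unit: "(\<Sum>i<n. (w k i)\<^sup>2) = 1" if k: "k < n" for k
  proof (rule ccontr)
    assume "(\<Sum>i<n. (w k i)\<^sup>2) \<noteq> 1"
    then have zero: "w k i = 0" if "i < n" for i using w(2) k that by auto
    have Qw: "(\<Sum>i<n. Q $$ (k, i) * w m i) = 0" if m: "m < k" for m
    proof -
      have "(\<Sum>i<n. Q $$ (k, i) * w m i) = (\<Sum>i<n. \<Sum>l\<le>m. cw m l * (Q $$ (k, i) * p l i))"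
        using m k by (intro sum.cong refl) (simp add: cw sum_distrib_left mult_ac)
      also have "\<dots> = (\<Sum>l\<le>m. cw m l * (\<Sum>i<n. Q $$ (k, i) * p l i))"
        by (subst sum.swap) (simp add: sum_distrib_left)
      also have "\<dots> = 0" using m k by (intro sum.neutral) (auto simp: Qp)
      finally show ?thesis .
    qed
    have "(\<Sum>i<n. Q $$ (k, i) * p k i) = (\<Sum>i<n. \<Sum>m\<le>k. cp k m * (Q $$ (k, i) * w m i))"
      using k by (intro sum.cong refl) (simp add: cp sum_distrib_left mult_ac)
    also have "\<dots> = (\<Sum>m\<le>k. cp k m * (\<Sum>i<n. Q $$ (k, i) * w m i))"
      by (subst sum.swap) (simp add: sum_distrib_left)
    also have "\<dots> = 0"
    proof (intro sum.neutral ballI)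
      fix m assume "m \<in> {..k}"
      then have "m < k \<or> m = k" by auto
      then show "cp k m * (\<Sum>i<n. Q $$ (k, i) * w m i) = 0" using Qw zero by auto
    qed
    finally show False using Qp[OF k k] by simp
  qed
  define F where "F k l = (\<Sum>i<n. w k i * (\<Sum>j<n. A $$ (i, j) * w l j))" for k l
  have Fsym: "F k l = F l k" for k l
  proof -
    have "F k l = (\<Sum>i<n. \<Sum>j<n. w l j * (A $$ (j, i) * w k i))"
      unfolding F_def sum_distrib_left by (intro sum.cong refl) (simp add: symA mult_ac)
    also have "\<dots> = F l k" unfolding F_def sum_distrib_left by (rule sum.swap)
    finally show ?thesis .
  qed
  have orth_p: "(\<Sum>i<n. w k i * p l i) = 0" if "l < k" "k < n" for k l
  proof -
    have "(\<Sum>i<n. w k i * p l i) = (\<Sum>i<n. \<Sum>m\<le>l. cp l m * (w k i * w m i))"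
      using that by (intro sum.cong refl) (simp add: cp sum_distrib_left mult_ac)
    also have "\<dots> = (\<Sum>m\<le>l. cp l m * (\<Sum>i<n. w k i * w m i))"
      by (subst sum.swap) (simp add: sum_distrib_left)
    also have "\<dots> = 0" using that w(1) by (intro sum.neutral) auto
    finally show ?thesis .
  qed
  have F0: "F k l = 0" if "l < k" "k < n" for k l
  proof -
    have "(\<Sum>j<n. A $$ (i, j) * w l j) = (\<Sum>m\<le>l. \<Sum>s\<le>m. cw l m * (B $$ (s, m) * p s i))" if i: "i < n" for i
    proof -
      have "(\<Sum>j<n. A $$ (i, j) * w l j) = (\<Sum>j<n. \<Sum>m\<le>l. cw l m * (A $$ (i, j) * p m j))"
        using \<open>l < k\<close> \<open>k < n\<close> by (intro sum.cong refl) (simp add: cw sum_distrib_left mult_ac)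
      also have "\<dots> = (\<Sum>m\<le>l. cw l m * (\<Sum>j<n. A $$ (i, j) * p m j))"
        by (subst sum.swap) (simp add: sum_distrib_left)
      also have "\<dots> = (\<Sum>m\<le>l. cw l m * (\<Sum>s\<le>m. B $$ (s, m) * p s i))"
        using \<open>l < k\<close> \<open>k < n\<close> i by (intro sum.cong refl) (simp add: Ap)
      finally show ?thesis by (simp add: sum_distrib_left)
    qed
    then have "F k l = (\<Sum>i<n. \<Sum>m\<le>l. \<Sum>s\<le>m. cw l m * B $$ (s, m) * (w k i * p s i))"
      unfolding F_def by (intro sum.cong refl) (simp add: sum_distrib_left mult_ac)
    also have "\<dots> = (\<Sum>m\<le>l. \<Sum>i<n. \<Sum>s\<le>m. cw l m * B $$ (s, m) * (w k i * p s i))" by (rule sum.swap)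
    also have "\<dots> = (\<Sum>m\<le>l. \<Sum>s\<le>m. cw l m * B $$ (s, m) * (\<Sum>i<n. w k i * p s i))"
      by (rule sum.cong[OF refl], subst sum.swap) (simp add: sum_distrib_left)
    also have "\<dots> = 0" using that by (intro sum.neutral ballI) (auto simp: orth_p)
    finally show ?thesis .
  qed
  have Fdiag: "F k l = 0" if "k < n" "l < n" "k \<noteq> l" for k l
    using that F0[of l k] F0[of k l] Fsym[of k l] by (cases "l < k") auto
  define W where "W = mat n n (\<lambda>(k, i). w k i)"
  have W: "W \<in> carrier_mat n n" by (simp add: W_def)
  have WW: "W * W\<^sup>T = 1\<^sub>m n"
    using w(1) unit
    by (intro eq_matI) (auto simp: W_def scalar_prod_def atLeast0LessThan power2_eq_square)
  have WW': "W\<^sup>T * W = 1\<^sub>m n"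
    by (rule mat_mult_left_right_inverse[OF W _ WW]) (use W in simp)
  define D where "D = W * A * W\<^sup>T"
  have D: "D \<in> carrier_mat n n" using W A by (simp add: D_def)
  have "D $$ (k, l) = F k l" if "k < n" "l < n" for k l
  proof -
    have "D = W * (A * W\<^sup>T)" using W A by (simp add: D_def assoc_mult_mat[of _ n n _ n _ n])
    then show ?thesis using that W A
      by (simp add: F_def W_def scalar_prod_def atLeast0LessThan)
  qed
  then have "\<forall>i<n. \<forall>j<n. i \<noteq> j \<longrightarrow> D $$ (i, j) = 0" using Fdiag by auto
  moreover have "A = W\<^sup>T * D * W"
  proof -
    have "W\<^sup>T * D * W = (W\<^sup>T * W) * A * (W\<^sup>T * W)"
      using W A by (simp add: D_def assoc_mult_mat[of _ n n _ n _ n])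
    then show ?thesis using WW' A by simp
  qed
  ultimately show ?thesis using W D WW WW' by blast
qed

section \<open>Diagonal matrices, square roots and generalized inverses\<close>

definition diagonal :: "nat \<Rightarrow> (nat \<Rightarrow> real) \<Rightarrow> real mat" where
  "diagonal n f = mat n n (\<lambda>(i, j). if i = j then f i else 0)"

lemma diagonal_carrier [simp]: "diagonal n f \<in> carrier_mat n n" "dim_row (diagonal n f) = n" "dim_col (diagonal n f) = n"
  by (auto simp: diagonal_def)

lemma diagonal_mult: "diagonal n f * diagonal n h = diagonal n (\<lambda>i. f i * h i)"
proof (rule eq_matI)
  fix i j assume "i < dim_row (diagonal n (\<lambda>i. f i * h i))" "j < dim_col (diagonal n (\<lambda>i. f i * h i))"
  then have ij: "i < n" "j < n" by auto
  have "(diagonal n f * diagonal n h) $$ (i, j) = (\<Sum>k<n. (if i = k then f i else 0) * (if k = j then h k else 0))"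
    using ij by (auto simp: diagonal_def scalar_prod_def atLeast0LessThan intro!: sum.cong)
  also have "\<dots> = (\<Sum>k<n. if k = i then (if i = j then f i * h i else 0) else 0)"
    by (intro sum.cong refl) auto
  also have "\<dots> = diagonal n (\<lambda>i. f i * h i) $$ (i, j)"
    using ij by (auto simp: diagonal_def)
  finally show "(diagonal n f * diagonal n h) $$ (i, j) = diagonal n (\<lambda>i. f i * h i) $$ (i, j)" .
qed auto

lemma diagonal_transpose: "(diagonal n f)\<^sup>T = diagonal n f"
  by (rule eq_matI) (auto simp: diagonal_def)

lemma symmetric_diagonalization:
  assumes A: "A \<in> carrier_mat n n" and sym: "A\<^sup>T = (A :: real mat)"
  shows "\<exists>W f. W \<in> carrier_mat n n \<and> W * W\<^sup>T = 1\<^sub>m n \<and> W\<^sup>T * W = 1\<^sub>m n \<and> A = W\<^sup>T * diagonal n f * W"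
proof -
  obtain W D where W: "W \<in> carrier_mat n n" "D \<in> carrier_mat n n" "W * W\<^sup>T = 1\<^sub>m n" "W\<^sup>T * W = 1\<^sub>m n"
    and D: "\<forall>i<n. \<forall>j<n. i \<noteq> j \<longrightarrow> D $$ (i, j) = 0" and eq: "A = W\<^sup>T * D * W"
    using symmetric_spectral[OF A sym] by (elim exE conjE) (rule that)
  have "D = diagonal n (\<lambda>i. D $$ (i, i))"
    using W D by (intro eq_matI) (auto simp: diagonal_def)
  then show ?thesis using W eq by metis
qed

lemma conjugate_mult:
  assumes W: "W \<in> carrier_mat n n" "W * W\<^sup>T = 1\<^sub>m n"
    and E: "E \<in> carrier_mat n n" and F: "F \<in> carrier_mat n n"
  shows "(W\<^sup>T * E * W) * (W\<^sup>T * F * W) = W\<^sup>T * (E * F) * (W :: real mat)"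
proof -
  have c: "W * (W\<^sup>T * X) = X" if X: "X \<in> carrier_mat n n" for X
  proof -
    have "W * (W\<^sup>T * X) = W * W\<^sup>T * X"
      by (rule assoc_mult_mat[symmetric, of _ n n _ n _ n]) (use W X in auto)
    then show ?thesis using W X by simp
  qed
  show ?thesis
    using W E F by (simp add: assoc_mult_mat[of _ n n _ n _ n] c)
qed

text \<open>Invert the eigenvalues, with inverse 0 = 0. Applied to the root of S, the equation (R G)
  x = x is a measurable description of the range of R, which carries the clean covariates.\<close>

lemma generalized_inverse:
  assumes R: "R \<in> carrier_mat n n" and sym: "R\<^sup>T = (R :: real mat)"
  shows "\<exists>G\<in>carrier_mat n n. R * G * R = R"
proof -
  obtain W f where W: "W \<in> carrier_mat n n" "W * W\<^sup>T = 1\<^sub>m n" and RW: "R = W\<^sup>T * diagonal n f * W"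
    using symmetric_diagonalization[OF R sym] by blast
  define G where "G = W\<^sup>T * diagonal n (\<lambda>i. inverse (f i)) * W"
  have "R * G * R = W\<^sup>T * (diagonal n f * diagonal n (\<lambda>i. inverse (f i)) * diagonal n f) * W"
    unfolding RW G_def by (subst conjugate_mult[OF W], simp, simp, subst conjugate_mult[OF W]) auto
  also have "diagonal n f * diagonal n (\<lambda>i. inverse (f i)) * diagonal n f = diagonal n f"
  proof -
    have "(\<lambda>i. f i * inverse (f i) * f i) = f"
    proof
      fix i show "f i * inverse (f i) * f i = f i" by (cases "f i = 0") auto
    qed
    then show ?thesis by (simp add: diagonal_mult)
  qed
  finally have "R * G * R = R" by (simp add: RW)
  moreover have "G \<in> carrier_mat n n"
    unfolding G_def using W(1) by (intro mult_carrier_mat[of _ n n _ n]) auto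
  ultimately show ?thesis by blast
qed

lemma diagonal_quadratic_form:
  assumes "x \<in> carrier_vec n"
  shows "x \<bullet> (diagonal n f *\<^sub>v x) = (\<Sum>k<n. f k * (x $ k)\<^sup>2)"
proof -
  have "(diagonal n f *\<^sub>v x) $ k = f k * x $ k" if k: "k < n" for k
  proof -
    have "(diagonal n f *\<^sub>v x) $ k = (\<Sum>j<n. (if k = j then f k else 0) * x $ j)"
      using k assms by (simp add: diagonal_def scalar_prod_def atLeast0LessThan)
    also have "\<dots> = (\<Sum>j<n. if j = k then f k * x $ k else 0)"
      by (intro sum.cong refl) auto
    finally show ?thesis using k by simp
  qed
  then show ?thesis using assms
    by (simp add: scalar_prod_def atLeast0LessThan power2_eq_square mult_ac)
qed

lemma conjugate_quadratic_form:
  assumes W: "W \<in> carrier_mat n n" and v: "v \<in> carrier_vec n"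
  shows "v \<bullet> ((W\<^sup>T * diagonal n f * W) *\<^sub>v v) = (\<Sum>k<n. f k * ((W *\<^sub>v v) $ k)\<^sup>2)"
proof -
  have WT: "W\<^sup>T \<in> carrier_mat n n" using W by simp
  have x: "W *\<^sub>v v \<in> carrier_vec n" using W v by simp
  have eq: "(W\<^sup>T * diagonal n f * W) *\<^sub>v v = W\<^sup>T *\<^sub>v (diagonal n f *\<^sub>v (W *\<^sub>v v))"
    using W v WT by (simp add: assoc_mult_mat_vec[of _ n n _ n])
  have "v \<bullet> ((W\<^sup>T * diagonal n f * W) *\<^sub>v v) = (W\<^sup>T *\<^sub>v (diagonal n f *\<^sub>v (W *\<^sub>v v))) \<bullet> v"
    unfolding eq by (intro comm_scalar_prod[of _ n] v mult_mat_vec_carrier[OF WT] mult_mat_vec_carrier[of _ n n] x) simp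
  also have "\<dots> = (diagonal n f *\<^sub>v (W *\<^sub>v v)) \<bullet> (W *\<^sub>v v)"
    using W v by (intro transpose_vec_mult_scalar[of _ n n] mult_mat_vec_carrier[of _ n n] x) auto
  also have "\<dots> = (W *\<^sub>v v) \<bullet> (diagonal n f *\<^sub>v (W *\<^sub>v v))"
    by (intro comm_scalar_prod[of _ n] mult_mat_vec_carrier[of _ n n] x) simp
  also have "\<dots> = (\<Sum>k<n. f k * ((W *\<^sub>v v) $ k)\<^sup>2)" by (rule diagonal_quadratic_form[OF x])
  finally show ?thesis .
qed

text \<open>\<open>psd_sqrt\<close> is a choice, so it inherits the defining properties as soon as
  one root is exhibited. Taking roots of the eigenvalues works; their nonnegativity follows by
  testing S on the eigenvectors W^T e_k.\<close>

lemma psd_sqrt_symmetric: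
  assumes S: "covariance_matrix n S"
  shows "psd_sqrt S \<in> carrier_mat n n" "(psd_sqrt S)\<^sup>T = psd_sqrt S"
proof -
  have Sc: "S \<in> carrier_mat n n" and sym: "S\<^sup>T = S"
    and pos: "\<And>v. v \<in> carrier_vec n \<Longrightarrow> 0 \<le> v \<bullet> (S *\<^sub>v v)"
    using S by (auto simp: covariance_matrix_def psd_def)
  obtain W f where W: "W \<in> carrier_mat n n" "W * W\<^sup>T = 1\<^sub>m n" and SW: "S = W\<^sup>T * diagonal n f * W"
    using symmetric_diagonalization[OF Sc sym] by blast
  have f: "0 \<le> f k" if k: "k < n" for k
  proof -
    define v where "v = W\<^sup>T *\<^sub>v unit_vec n k"
    have v: "v \<in> carrier_vec n" using W by (simp add: v_def)
    have "W *\<^sub>v v = (W * W\<^sup>T) *\<^sub>v unit_vec n k"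
      unfolding v_def by (rule assoc_mult_mat_vec[symmetric, of _ n n _ n]) (use W in auto)
    then have Wv: "W *\<^sub>v v = unit_vec n k"
      by (simp only: W(2) one_mult_mat_vec[OF unit_vec_carrier])
    have "v \<bullet> (S *\<^sub>v v) = (\<Sum>j<n. f j * (unit_vec n k $ j)\<^sup>2)"
      unfolding SW conjugate_quadratic_form[OF W(1) v] Wv ..
    also have "\<dots> = (\<Sum>j<n. if j = k then f k else 0)"
      using k by (intro sum.cong refl) auto
    finally show ?thesis using pos[OF v] k by simp
  qed
  define R where "R = W\<^sup>T * diagonal n (\<lambda>i. sqrt (f i)) * W"
  have Rc: "R \<in> carrier_mat n n"
    unfolding R_def using W(1) by (intro mult_carrier_mat[of _ n n _ n]) auto
  have "diagonal n (\<lambda>i. sqrt (f i) * sqrt (f i)) = diagonal n f"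
    using f by (intro eq_matI) (auto simp: diagonal_def)
  then have RR: "R * R = S"
    unfolding R_def SW by (subst conjugate_mult[OF W]) (auto simp: diagonal_mult)
  have Rsym: "R\<^sup>T = R"
  proof -
    have "R\<^sup>T = W\<^sup>T * (W\<^sup>T * diagonal n (\<lambda>i. sqrt (f i)))\<^sup>T"
      unfolding R_def using W by (subst transpose_mult[of _ n n _ n]) auto
    also have "(W\<^sup>T * diagonal n (\<lambda>i. sqrt (f i)))\<^sup>T = diagonal n (\<lambda>i. sqrt (f i)) * W"
      using W by (subst transpose_mult[of _ n n _ n]) (auto simp: diagonal_transpose)
    finally show ?thesis using W by (simp add: R_def assoc_mult_mat[of _ n n _ n _ n])
  qed
  have "psd R"
    unfolding psd_def
  proof (intro conjI ballI)
    fix v :: "real vec" assume "v \<in> carrier_vec (dim_row R)"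
    then have "v \<in> carrier_vec n" using Rc by simp
    from conjugate_quadratic_form[OF W(1) this] show "0 \<le> v \<bullet> (R *\<^sub>v v)"
      using f by (auto simp: R_def intro!: sum_nonneg mult_nonneg_nonneg)
  qed (use Rc Rsym in auto)
  then have "R \<in> carrier_mat (dim_row S) (dim_row S) \<and> psd R \<and> R * R = S"
    using Rc RR Sc by auto
  from someI[of "\<lambda>R. R \<in> carrier_mat (dim_row S) (dim_row S) \<and> psd R \<and> R * R = S", OF this]
  show "psd_sqrt S \<in> carrier_mat n n" "(psd_sqrt S)\<^sup>T = psd_sqrt S"
    using Sc unfolding psd_sqrt_def by (auto simp: psd_def)
qed

text \<open>Y = A W^T has orthogonal columns with squared lengths \<open>f\<close>, the eigenvalues
  of A^T A. Pairing the normalized columns with Y gives the diagonal matrix of singular values. It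
  factors through \<open>k\<close> terms like A, its trace is the nuclear norm and its Frobenius
  norm that of A, so \<open>trace_square_le_rank\<close> applies.\<close>

lemma nuclear_norm_le_frobenius:
  fixes A :: "real mat"
  assumes A: "A \<in> carrier_mat p1 p2" and r: "mat_rank A \<le> k"
  shows "(nuclear_norm A)\<^sup>2 \<le> real k * (frob_norm A)\<^sup>2"
proof -
  let ?S = "A\<^sup>T * A"
  have S: "?S \<in> carrier_mat p2 p2" using A by simp
  have symS: "?S\<^sup>T = ?S" using A by (subst transpose_mult[of _ p2 p1 _ p2]) auto
  obtain W f where W: "W \<in> carrier_mat p2 p2" "W * W\<^sup>T = 1\<^sub>m p2" "W\<^sup>T * W = 1\<^sub>m p2"
    and SW: "?S = W\<^sup>T * diagonal p2 f * W"
    using symmetric_diagonalization[OF S symS] by blast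
  let ?D = "diagonal p2 f"
  have "similar_mat_wit ?S ?D (W\<^sup>T) W"
    by (rule similar_mat_witI[OF W(3,2) SW S]) (use W in auto)
  then have "char_poly ?S = char_poly ?D"
    by (intro char_poly_similar) (auto simp: similar_mat_def)
  also have "\<dots> = (\<Prod>a\<leftarrow>diag_mat ?D. [:- a, 1:])"
    by (rule char_poly_upper_triangular[of _ p2]) (auto simp: upper_triangular_def diagonal_def)
  also have "diag_mat ?D = map f [0..<p2]"
    by (auto simp: diag_mat_def diagonal_def)
  finally have cp: "char_poly ?S = (\<Prod>p\<leftarrow>map (\<lambda>i. [:- f i, 1:]) [0..<p2]. p)" by (simp add: comp_def)
  have "proots (char_poly ?S) = (\<Sum>p\<leftarrow>map (\<lambda>i. [:- f i, 1:]) [0..<p2]. proots p)"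
    unfolding cp by (rule proots_prod_list) auto
  also have "\<dots> = mset (map f [0..<p2])"
    by (induction p2) auto
  finally have nuc: "nuclear_norm A = (\<Sum>i<p2. sqrt (f i))"
    by (simp add: nuclear_norm_def sum_mset_sum_list mset_map[symmetric] comp_def interv_sum_list_conv_sum_set_nat
        atLeast0LessThan del: mset_map)
  define Y where "Y = A * W\<^sup>T"
  have Y: "Y \<in> carrier_mat p1 p2" using A W by (simp add: Y_def)
  have "Y\<^sup>T * Y = W * (A\<^sup>T * A) * W\<^sup>T"
  proof -
    have YT: "Y\<^sup>T = W * A\<^sup>T" using A W by (simp add: Y_def transpose_mult[of A p1 p2 "W\<^sup>T" p2])
    have "W * A\<^sup>T * (A * W\<^sup>T) = W * (A\<^sup>T * (A * W\<^sup>T))"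
      using A W by (intro assoc_mult_mat[of _ p2 p2 _ p1 _ p2]) auto
    also have "A\<^sup>T * (A * W\<^sup>T) = A\<^sup>T * A * W\<^sup>T"
      using A W by (intro assoc_mult_mat[symmetric, of _ p2 p1 _ p2 _ p2]) auto
    also have "W * (A\<^sup>T * A * W\<^sup>T) = W * (A\<^sup>T * A) * W\<^sup>T"
      using A W by (intro assoc_mult_mat[symmetric, of _ p2 p2 _ p2 _ p2]) auto
    finally show ?thesis unfolding YT unfolding Y_def .
  qed
  also have "\<dots> = (W * W\<^sup>T) * ?D * (W * W\<^sup>T)"
  proof -
    have "(W * W\<^sup>T) * ?D * (W * W\<^sup>T) = W * (W\<^sup>T * (?D * (W * W\<^sup>T)))"
      using W(1) by (simp only: assoc_mult_mat[of _ p2 p2 _ p2 _ p2] mult_carrier_mat[of _ p2 p2 _ p2]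
          transpose_carrier_mat diagonal_carrier)
    also have "\<dots> = W * (W\<^sup>T * ?D * W) * W\<^sup>T"
      using W(1) by (simp only: assoc_mult_mat[of _ p2 p2 _ p2 _ p2] mult_carrier_mat[of _ p2 p2 _ p2]
          transpose_carrier_mat diagonal_carrier)
    finally show ?thesis unfolding SW ..
  qed
  also have "\<dots> = ?D" using W by simp
  finally have YY: "Y\<^sup>T * Y = ?D" .
  have Yprod: "(\<Sum>i<p1. Y $$ (i, k) * Y $$ (i, l)) = (if k = l then f k else 0)" if "k < p2" "l < p2" for k l
    using arg_cong[OF YY, of "\<lambda>M. M $$ (k, l)"] that Y
    by (simp add: scalar_prod_def atLeast0LessThan diagonal_def)
  have f: "0 \<le> f l" if "l < p2" for l
  proof -
    have "f l = (\<Sum>i<p1. Y $$ (i, l) * Y $$ (i, l))" using Yprod[OF that that] by simp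
    also have "0 \<le> \<dots>" by (intro sum_nonneg) simp
    finally show ?thesis .
  qed
  have "Y * Y\<^sup>T = A * A\<^sup>T"
  proof -
    have YT: "Y\<^sup>T = W * A\<^sup>T" using A W by (simp add: Y_def transpose_mult[of A p1 p2 "W\<^sup>T" p2])
    have "A * W\<^sup>T * (W * A\<^sup>T) = A * (W\<^sup>T * (W * A\<^sup>T))"
      using A W by (intro assoc_mult_mat[of _ p1 p2 _ p2 _ p1]) auto
    also have "W\<^sup>T * (W * A\<^sup>T) = W\<^sup>T * W * A\<^sup>T"
      using A W by (intro assoc_mult_mat[symmetric, of _ p2 p2 _ p2 _ p1]) auto
    finally show ?thesis unfolding YT unfolding Y_def using W A by simp
  qed
  then have rows: "(\<Sum>l<p2. (Y $$ (i, l))\<^sup>2) = (\<Sum>j<p2. (A $$ (i, j))\<^sup>2)" if "i < p1" for i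
  proof -
    have "(Y * Y\<^sup>T) $$ (i, i) = (A * A\<^sup>T) $$ (i, i)" using \<open>Y * Y\<^sup>T = A * A\<^sup>T\<close> by (simp only:)
    then show ?thesis using that Y A
      by (simp add: scalar_prod_def atLeast0LessThan power2_eq_square)
  qed
  have "(\<Sum>l<p2. f l) = (\<Sum>l<p2. \<Sum>i<p1. (Y $$ (i, l))\<^sup>2)"
    by (intro sum.cong refl) (simp add: Yprod power2_eq_square)
  also have "\<dots> = (\<Sum>i<p1. \<Sum>j<p2. (A $$ (i, j))\<^sup>2)"
    by (subst sum.swap) (simp add: rows)
  also have "\<dots> = (frob_norm A)\<^sup>2" using A by (simp add: frob_norm_def sum_nonneg)
  finally have fro: "(\<Sum>l<p2. f l) = (frob_norm A)\<^sup>2" .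
  obtain a b where ab: "\<And>i j. i < p1 \<Longrightarrow> j < p2 \<Longrightarrow> A $$ (i, j) = (\<Sum>l<k. a l i * b l j)"
    using low_rank_factorization[OF A r] by blast
  define b' where "b' l j = (\<Sum>t<p2. b l t * W $$ (j, t))" for l j
  have Yab: "Y $$ (i, j) = (\<Sum>l<k. a l i * b' l j)" if "i < p1" "j < p2" for i j
  proof -
    have "Y $$ (i, j) = (\<Sum>t<p2. (\<Sum>l<k. a l i * b l t) * W $$ (j, t))"
      using that A W ab by (simp add: Y_def scalar_prod_def atLeast0LessThan)
    also have "\<dots> = (\<Sum>l<k. a l i * b' l j)"
      unfolding b'_def sum_distrib_left sum_distrib_right
      by (subst sum.swap) (simp add: mult.assoc)
    finally show ?thesis .
  qed
  \<comment> \<open>For f i = 0 the quotient is 0 by convention; column i of Y is then zero anyway,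
    so G is diagonal in all cases.\<close>
  define G where "G i j = (\<Sum>s<p1. Y $$ (s, i) / sqrt (f i) * Y $$ (s, j))" for i j
  define a' where "a' l i = (\<Sum>s<p1. Y $$ (s, i) / sqrt (f i) * a l s)" for l i
  have Gf: "G i j = (if i = j then sqrt (f i) else 0)" if "i < p2" "j < p2" for i j
  proof -
    have "G i j = (\<Sum>s<p1. Y $$ (s, i) * Y $$ (s, j)) / sqrt (f i)"
      by (simp add: G_def sum_divide_distrib)
    then show ?thesis using that f[OF that(1)] by (auto simp: Yprod real_div_sqrt)
  qed
  have "(\<Sum>i<p2. G i i)\<^sup>2 \<le> real k * (\<Sum>i<p2. \<Sum>j<p2. (G i j)\<^sup>2)"
  proof (rule trace_square_le_rank[where a=a' and b=b'])
    fix i j assume ij: "i \<in> {..<p2}" "j \<in> {..<p2}"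
    have "G i j = (\<Sum>s<p1. \<Sum>l<k. Y $$ (s, i) / sqrt (f i) * a l s * b' l j)"
      unfolding G_def
    proof (intro sum.cong refl)
      fix s assume "s \<in> {..<p1}"
      then have "Y $$ (s, j) = (\<Sum>l<k. a l s * b' l j)" using ij by (intro Yab) auto
      then show "Y $$ (s, i) / sqrt (f i) * Y $$ (s, j) = (\<Sum>l<k. Y $$ (s, i) / sqrt (f i) * a l s * b' l j)"
        by (simp only: sum_distrib_left mult.assoc)
    qed
    also have "\<dots> = (\<Sum>l<k. a' l i * b' l j)"
      unfolding a'_def sum_distrib_right by (rule sum.swap)
    finally show "G i j = (\<Sum>l<k. a' l i * b' l j)" .
  qed simp
  moreover have "(\<Sum>i<p2. G i i) = nuclear_norm A" by (simp add: nuc Gf)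
  moreover have "(\<Sum>i<p2. \<Sum>j<p2. (G i j)\<^sup>2) = (\<Sum>i<p2. f i)"
  proof (intro sum.cong refl)
    fix i assume "i \<in> {..<p2}"
    then have i: "i < p2" by simp
    have "(\<Sum>j<p2. (G i j)\<^sup>2) = (\<Sum>j<p2. if j = i then f i else 0)"
      using i f by (intro sum.cong refl) (auto simp: Gf)
    then show "(\<Sum>j<p2. (G i j)\<^sup>2) = f i" using i by simp
  qed
  ultimately show ?thesis by (simp add: fro)
qed

section \<open>Concentration and Gaussian measures\<close>

lemma exp_le_quadratic:
  fixes x :: real
  assumes "\<bar>x\<bar> \<le> 1"
  shows "exp x \<le> 1 + x + x\<^sup>2"
proof (cases "0 \<le> x")
  case True
  then show ?thesis using exp_bound[of x] assms by simp
next
  case False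
  define y where "y = - x"
  have y: "0 \<le> y" using False by (simp add: y_def)
  \<comment> \<open>For x = - y the Taylor lower bound of exp y is multiplied by 1 - y + y^2; the
    product is 1 plus nonnegative terms.\<close>
  have "1 \<le> (1 - y + y\<^sup>2) * (1 + y + y\<^sup>2 / 2)"
  proof -
    have "(1 - y + y\<^sup>2) * (1 + y + y\<^sup>2 / 2) = 1 + y\<^sup>2 / 2 + y ^ 3 / 2 + y ^ 4 / 2"
      by (simp add: field_simps power2_eq_square power3_eq_cube power4_eq_xxxx)
    then show ?thesis using y by simp
  qed
  also have "\<dots> \<le> (1 - y + y\<^sup>2) * exp y"
  proof (rule mult_left_mono)
    show "1 + y + y\<^sup>2 / 2 \<le> exp y" using exp_lower_Taylor_quadratic[OF y] .
    have "0 \<le> (y - 1 / 2)\<^sup>2 + 3 / 4" by (intro add_nonneg_nonneg) auto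
    then show "0 \<le> 1 - y + y\<^sup>2" by (simp add: power2_eq_square algebra_simps)
  qed
  finally show ?thesis by (simp add: y_def exp_minus field_simps)
qed

text \<open>Stated for an arbitrary exponential moment because it serves both the bounded counts and
  the unbounded chi-square sums.\<close>

lemma chernoff_PiM:
  fixes f :: "'a \<Rightarrow> real"
  assumes K: "prob_space K" and f[measurable]: "f \<in> borel_measurable K"
    and c: "(\<integral>\<^sup>+x. exp (f x) \<partial>K) \<le> ennreal (exp c)"
  shows "measure (PiM {..<n} (\<lambda>_. K)) {\<omega> \<in> space (PiM {..<n} (\<lambda>_. K)). s \<le> (\<Sum>i<n. f (\<omega> i))}
    \<le> exp (real n * c - s)"
proof -
  interpret K: prob_space K by fact
  interpret P: product_sigma_finite "\<lambda>_. K" by unfold_locales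
  let ?P = "PiM {..<n} (\<lambda>_. K)"
  interpret PP: prob_space ?P by (rule prob_space_PiM) (rule K)
  have "emeasure ?P {\<omega> \<in> space ?P. s \<le> (\<Sum>i<n. f (\<omega> i))}
      = emeasure ?P {\<omega> \<in> space ?P. 1 \<le> ennreal (exp (- s)) * ennreal (exp (\<Sum>i<n. f (\<omega> i)))}"
    by (intro arg_cong[where f="emeasure ?P"] Collect_cong conj_cong refl)
      (simp add: ennreal_mult[symmetric] exp_add[symmetric] flip: ennreal_1)
  also have "\<dots> \<le> ennreal (exp (- s)) * (\<integral>\<^sup>+\<omega>. ennreal (exp (\<Sum>i<n. f (\<omega> i))) * indicator (space ?P) \<omega> \<partial>?P)"
    by (rule nn_integral_Markov_inequality) auto
  also have "(\<integral>\<^sup>+\<omega>. ennreal (exp (\<Sum>i<n. f (\<omega> i))) * indicator (space ?P) \<omega> \<partial>?P)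
      = (\<integral>\<^sup>+\<omega>. (\<Prod>i<n. ennreal (exp (f (\<omega> i)))) \<partial>?P)"
    by (intro nn_integral_cong) (simp add: exp_sum prod_ennreal)
  also have "\<dots> = (\<Prod>i<n. \<integral>\<^sup>+x. ennreal (exp (f x)) \<partial>K)"
    by (rule P.product_nn_integral_prod) auto
  also have "\<dots> \<le> ennreal (exp c) ^ n"
  proof (induction n)
    case (Suc n)
    then show ?case using mult_mono[OF c Suc.IH] by (simp add: mult.commute)
  qed simp
  also have "\<dots> = ennreal (exp (real n * c))"
    by (simp add: ennreal_power exp_of_nat_mult)
  finally have "emeasure ?P {\<omega> \<in> space ?P. s \<le> (\<Sum>i<n. f (\<omega> i))} \<le> ennreal (exp (- s)) * ennreal (exp (real n * c))"
    by (simp add: mult_left_mono)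
  also have "\<dots> = ennreal (exp (real n * c - s))"
    by (simp add: ennreal_mult[symmetric] exp_add[symmetric])
  finally show ?thesis by (simp add: PP.emeasure_eq_measure)
qed

lemma bernstein_mgf:
  fixes f :: "'a \<Rightarrow> real"
  assumes K: "prob_space K" and f[measurable]: "f \<in> borel_measurable K"
    and bound: "\<And>x. x \<in> space K \<Longrightarrow> \<bar>f x\<bar> \<le> 1"
    and v: "(\<integral>x. (f x)\<^sup>2 \<partial>K) \<le> v" and h: "0 \<le> h" "h \<le> 1"
  shows "(\<integral>\<^sup>+x. exp (h * f x) \<partial>K) \<le> ennreal (exp (h * (\<integral>x. f x \<partial>K) + h\<^sup>2 * v))"
proof -
  interpret K: prob_space K by fact
  have int1: "integrable K f"
    by (rule K.integrable_const_bound[of _ 1]) (use bound in auto)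
  have sq: "(f x)\<^sup>2 \<le> 1" if "x \<in> space K" for x
    using bound[OF that] by (simp add: abs_square_le_1)
  have int2: "integrable K (\<lambda>x. (f x)\<^sup>2)"
    by (rule K.integrable_const_bound[of _ 1]) (use sq in auto)
  have pw: "exp (h * f x) \<le> 1 + h * f x + h\<^sup>2 * (f x)\<^sup>2" if "x \<in> space K" for x
    using exp_le_quadratic[of "h * f x"] h mult_le_one[of h "\<bar>f x\<bar>"] bound[OF that]
    by (simp add: abs_mult power_mult_distrib)
  have "(\<integral>\<^sup>+x. exp (h * f x) \<partial>K) \<le> (\<integral>\<^sup>+x. ennreal (1 + h * f x + h\<^sup>2 * (f x)\<^sup>2) \<partial>K)"
    by (intro nn_integral_mono ennreal_leI pw)
  also have "\<dots> = ennreal (\<integral>x. 1 + h * f x + h\<^sup>2 * (f x)\<^sup>2 \<partial>K)"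
    using int1 int2 by (intro nn_integral_eq_integral AE_I2) (auto intro: order_trans[OF _ pw])
  also have "(\<integral>x. 1 + h * f x + h\<^sup>2 * (f x)\<^sup>2 \<partial>K) = 1 + h * (\<integral>x. f x \<partial>K) + h\<^sup>2 * (\<integral>x. (f x)\<^sup>2 \<partial>K)"
    using int1 int2 by (simp add: K.prob_space)
  also have "\<dots> \<le> 1 + (h * (\<integral>x. f x \<partial>K) + h\<^sup>2 * v)"
    using v by (simp add: mult_left_mono)
  also have "\<dots> \<le> exp (h * (\<integral>x. f x \<partial>K) + h\<^sup>2 * v)" by (rule exp_ge_add_one_self)
  finally show ?thesis by (simp add: ennreal_leI)
qed

text \<open>The parameter \<open>h\<close> stays free instead of being optimized. In the chaining it
  is tied to the level, which balances h * v against x / h.\<close>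

lemma bernstein_PiM:
  fixes f :: "'a \<Rightarrow> real"
  assumes K: "prob_space K" and f[measurable]: "f \<in> borel_measurable K"
    and bound: "\<And>x. x \<in> space K \<Longrightarrow> \<bar>f x\<bar> \<le> 1"
    and v: "(\<integral>x. (f x)\<^sup>2 \<partial>K) \<le> v" and h: "0 < h" "h \<le> 1"
  shows "measure (PiM {..<n} (\<lambda>_. K)) {\<omega> \<in> space (PiM {..<n} (\<lambda>_. K)).
      real n * ((\<integral>x. f x \<partial>K) + h * v + x / h) \<le> (\<Sum>i<n. f (\<omega> i))}
    \<le> exp (- (real n * x))"
proof -
  have eq: "(real n * ((\<integral>x. f x \<partial>K) + h * v + x / h) \<le> (\<Sum>i<n. f (\<omega> i))) \<longleftrightarrow>
      real n * (h * (\<integral>x. f x \<partial>K) + h\<^sup>2 * v) + real n * x \<le> (\<Sum>i<n. h * f (\<omega> i))" for \<omega>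
  proof -
    have "real n * (h * (\<integral>x. f x \<partial>K) + h\<^sup>2 * v) + real n * x
        = h * (real n * ((\<integral>x. f x \<partial>K) + h * v + x / h))"
      using h by (simp add: field_simps power2_eq_square)
    then show ?thesis using h by (simp add: sum_distrib_left[symmetric])
  qed
  show ?thesis unfolding eq
    using chernoff_PiM[OF K _ bernstein_mgf[OF K f bound v less_imp_le[OF h(1)] h(2)],
        of n "real n * (h * (\<integral>x. f x \<partial>K) + h\<^sup>2 * v) + real n * x"]
    by simp
qed

lemma bernstein_union:
  fixes F :: "'b \<Rightarrow> 'a \<Rightarrow> real"
  assumes K: "prob_space K" and A: "finite A" and f[measurable]: "\<And>a. a \<in> A \<Longrightarrow> F a \<in> borel_measurable K"
    and bound: "\<And>a x. a \<in> A \<Longrightarrow> x \<in> space K \<Longrightarrow> \<bar>F a x\<bar> \<le> 1"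
    and v: "\<And>a. a \<in> A \<Longrightarrow> (\<integral>x. (F a x)\<^sup>2 \<partial>K) \<le> v" and h: "0 < h" "h \<le> 1"
    and card: "real (card A) \<le> exp L"
  shows "measure (PiM {..<n} (\<lambda>_. K)) {\<omega> \<in> space (PiM {..<n} (\<lambda>_. K)).
      \<exists>a\<in>A. real n * ((\<integral>x. F a x \<partial>K) + h * v + x / h) \<le> (\<Sum>i<n. F a (\<omega> i))}
    \<le> exp (L - real n * x)"
proof -
  let ?P = "PiM {..<n} (\<lambda>_. K)"
  interpret K: prob_space K by fact
  interpret PP: prob_space ?P by (rule prob_space_PiM) (rule K)
  define X where "X a = {\<omega> \<in> space ?P. real n * ((\<integral>x. F a x \<partial>K) + h * v + x / h) \<le> (\<Sum>i<n. F a (\<omega> i))}" for a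
  have X[measurable]: "X a \<in> sets ?P" if "a \<in> A" for a
    unfolding X_def using f[OF that] by measurable
  have "{\<omega> \<in> space ?P. \<exists>a\<in>A. real n * ((\<integral>x. F a x \<partial>K) + h * v + x / h) \<le> (\<Sum>i<n. F a (\<omega> i))}
      = (\<Union>a\<in>A. X a)" by (auto simp: X_def)
  also have "PP.prob \<dots> \<le> (\<Sum>a\<in>A. PP.prob (X a))"
    by (rule PP.finite_measure_subadditive_finite[OF A]) (use X in auto)
  also have "\<dots> \<le> (\<Sum>a\<in>A. exp (- (real n * x)))"
    unfolding X_def by (intro sum_mono bernstein_PiM K f bound v h)
  also have "\<dots> = real (card A) * exp (- (real n * x))" by simp
  also have "\<dots> \<le> exp L * exp (- (real n * x))" by (intro mult_right_mono card) auto
  also have "\<dots> = exp (L - real n * x)" by (simp add: exp_add[symmetric])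
  finally show ?thesis .
qed

section \<open>The standard Gaussian law and linear forms of Gaussian vectors\<close>

abbreviation std_gauss :: "real measure" where
  "std_gauss \<equiv> density lborel std_normal_density"

lemma prob_space_std_gauss: "prob_space std_gauss"
  by (rule prob_space_normal_density) simp

interpretation gauss: prob_space std_gauss by (rule prob_space_std_gauss)

lemma std_gauss_interval_le:
  assumes "0 \<le> b" shows "measure std_gauss {a..a + b} \<le> b / 2"
proof -
  have d: "std_normal_density x \<le> 1 / 2" for x
  proof -
    have "2 \<le> sqrt (2 * pi)" using pi_gt3 by (intro real_le_rsqrt) auto
    then have "1 / sqrt (2 * pi) \<le> 1 / 2" by (intro divide_left_mono) auto
    then have "1 / sqrt (2 * pi) * exp (- x\<^sup>2 / 2) \<le> 1 / 2 * 1" by (intro mult_mono) auto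
    then show ?thesis by (simp add: std_normal_density_def)
  qed
  have "emeasure std_gauss {a..a + b} = (\<integral>\<^sup>+x. ennreal (std_normal_density x) * indicator {a..a + b} x \<partial>lborel)"
    by (rule emeasure_density) auto
  also have "\<dots> \<le> (\<integral>\<^sup>+x. ennreal (1 / 2) * indicator {a..a + b} x \<partial>lborel)"
    by (intro nn_integral_mono mult_right_mono ennreal_leI d) auto
  also have "\<dots> = ennreal (1 / 2) * ennreal b"
    using assms by (subst nn_integral_cmult_indicator) auto
  also have "\<dots> = ennreal (b / 2)" using assms by (subst ennreal_mult[symmetric]) auto
  finally show ?thesis using assms by (simp add: gauss.emeasure_eq_measure)
qed

lemma std_gauss_singleton: "measure std_gauss {a} = 0"
  using std_gauss_interval_le[of 0 a] by (simp add: measure_le_0_iff)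

lemma std_gauss_tail_le:
  assumes t: "0 < t" shows "measure std_gauss {x. t < \<bar>x\<bar>} \<le> 1 / t\<^sup>2"
proof -
  have "emeasure std_gauss {x. t < \<bar>x\<bar>} \<le> emeasure std_gauss {x \<in> space std_gauss. 1 \<le> ennreal (1 / t\<^sup>2) * ennreal (x\<^sup>2)}"
  proof (rule emeasure_mono)
    show "{x. t < \<bar>x\<bar>} \<subseteq> {x \<in> space std_gauss. 1 \<le> ennreal (1 / t\<^sup>2) * ennreal (x\<^sup>2)}"
    proof safe
      fix x :: real assume "t < \<bar>x\<bar>"
      then have "t\<^sup>2 \<le> x\<^sup>2" using t by (simp add: abs_le_square_iff[symmetric])
      then have "1 \<le> 1 / t\<^sup>2 * x\<^sup>2" using t by (simp add: field_simps)
      then show "1 \<le> ennreal (1 / t\<^sup>2) * ennreal (x\<^sup>2)"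
        by (simp add: ennreal_mult[symmetric] flip: ennreal_1)
    qed simp
  qed measurable
  also have "\<dots> \<le> ennreal (1 / t\<^sup>2) * (\<integral>\<^sup>+x. ennreal (x\<^sup>2) * indicator (space std_gauss) x \<partial>std_gauss)"
    by (rule nn_integral_Markov_inequality) auto
  also have "(\<integral>\<^sup>+x. ennreal (x\<^sup>2) * indicator (space std_gauss) x \<partial>std_gauss) = (\<integral>\<^sup>+x. ennreal (x\<^sup>2) \<partial>std_gauss)"
    by (intro nn_integral_cong) simp
  also have "\<dots> = (\<integral>\<^sup>+x. ennreal (std_normal_density x * x\<^sup>2) \<partial>lborel)"
    by (subst nn_integral_density) (auto simp: ennreal_mult)
  also have "\<dots> = ennreal 1"
    using std_normal_moment_even[of 1]
    by (subst nn_integral_eq_integral) (auto simp: has_bochner_integral_iff fact_numeral)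
  finally show ?thesis by (simp add: gauss.emeasure_eq_measure)
qed

lemma std_gauss_chi_square_mgf: "(\<integral>\<^sup>+x. ennreal (exp (x\<^sup>2 / 4)) \<partial>std_gauss) \<le> ennreal (exp 1)"
proof -
  have "(\<integral>\<^sup>+x. ennreal (exp (x\<^sup>2 / 4)) \<partial>std_gauss) = (\<integral>\<^sup>+x. ennreal (std_normal_density x * exp (x\<^sup>2 / 4)) \<partial>lborel)"
    by (subst nn_integral_density) (auto simp: ennreal_mult)
  \<comment> \<open>The factor exp (x^2 / 4) halves the Gaussian exponent, which leaves sqrt 2 times
    a normal density of variance 2.\<close>
  also have "\<dots> = (\<integral>\<^sup>+x. ennreal (sqrt 2 * normal_density 0 (sqrt 2) x) \<partial>lborel)"
  proof (intro nn_integral_cong arg_cong[where f=ennreal])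
    fix x :: real
    have "exp (- x\<^sup>2 / 2) * exp (x\<^sup>2 / 4) = exp (- x\<^sup>2 / 4)"
      by (simp add: exp_add[symmetric])
    then show "std_normal_density x * exp (x\<^sup>2 / 4) = sqrt 2 * normal_density 0 (sqrt 2) x"
      by (simp add: normal_density_def real_sqrt_mult) (simp add: field_simps)
  qed
  also have "\<dots> = ennreal (sqrt 2)"
    by (subst nn_integral_eq_integral) (auto intro!: integrable_mult_right)
  also have "sqrt 2 \<le> exp 1"
    using exp_ge_add_one_self[of 1] sqrt2_less_2 by linarith
  finally show ?thesis by (simp add: ennreal_leI)
qed

lemma distr_std_gauss_uminus: "distr std_gauss borel uminus = std_gauss"
proof -
  have "distributed std_gauss lborel (\<lambda>x. x) std_normal_density"
    by (auto simp: distributed_def distr_id2)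
  from gauss.normal_density_affine[OF this, of "-1" 0]
  have "distr std_gauss lborel uminus = std_gauss"
    by (auto simp: distributed_def)
  then show ?thesis by (metis distr_cong sets_lborel)
qed

lemma distr_linear_form_std_gauss_vec:
  assumes unit: "(\<Sum>k<d. (w k)\<^sup>2) = 1"
  shows "distr (std_gauss_vec d) borel (\<lambda>z. \<Sum>k<d. w k * z k) = std_gauss"
proof -
  let ?P = "std_gauss_vec d"
  interpret P: product_prob_space "\<lambda>_. std_gauss" "{..<d}" by unfold_locales
  interpret PP: prob_space ?P unfolding std_gauss_vec_def by (rule prob_space_PiM) (rule prob_space_std_gauss)
  have "d \<noteq> 0" using unit by (intro notI) simp
  have comp: "distr ?P borel (\<lambda>z. z k) = std_gauss" if "k < d" for k
  proof -
    have "distr ?P std_gauss (\<lambda>z. z k) = std_gauss"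
      unfolding std_gauss_vec_def using that by (intro P.PiM_component) auto
    then show ?thesis by (metis (no_types, lifting) distr_cong sets_density sets_lborel)
  qed
  have [measurable]: "(\<lambda>z. z k) \<in> borel_measurable ?P" if "k < d" for k
  proof -
    have "(\<lambda>z. z k) \<in> measurable ?P std_gauss"
      unfolding std_gauss_vec_def using that by (intro measurable_component_singleton) auto
    then show ?thesis by simp
  qed
  have "PP.indep_vars (\<lambda>_. borel) (\<lambda>k z. z k) {..<d}"
  proof (subst PP.indep_vars_iff_distr_eq_PiM')
    have "distr ?P (PiM {..<d} (\<lambda>_. borel)) (\<lambda>x. \<lambda>i\<in>{..<d}. x i) = distr ?P ?P (\<lambda>x. x)"
      by (rule distr_cong) (auto simp: std_gauss_vec_def space_PiM PiE_def extensional_def intro!: sets_PiM_cong)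
    also have "\<dots> = ?P" by (rule distr_id2) simp
    also have "\<dots> = PiM {..<d} (\<lambda>k. distr ?P borel (\<lambda>z. z k))"
      unfolding std_gauss_vec_def by (rule PiM_cong) (use comp in \<open>auto simp: std_gauss_vec_def\<close>)
    finally show "distr ?P (PiM {..<d} (\<lambda>_. borel)) (\<lambda>x. \<lambda>i\<in>{..<d}. x i)
      = PiM {..<d} (\<lambda>k. distr ?P borel (\<lambda>z. z k))" .
  qed (use \<open>d \<noteq> 0\<close> in auto)
  then have ind: "PP.indep_vars (\<lambda>_. borel) (\<lambda>k z. w k * z k) {..<d}"
    by (rule PP.indep_vars_compose2[where Y="\<lambda>k x. w k * x" and N="\<lambda>_. borel"]) auto
  \<comment> \<open>The sum rule for independent normal variables asks for positive standard
    deviations, so zero weights are dropped first.\<close>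
  define I where "I = {k\<in>{..<d}. w k \<noteq> 0}"
  have "(\<Sum>k\<in>I. (w k)\<^sup>2) = 1"
    unfolding unit[symmetric] I_def by (intro sum.mono_neutral_left) auto
  then have "I \<noteq> {}" by auto
  have "distributed ?P lborel (\<lambda>z. \<Sum>k\<in>I. w k * z k) (normal_density (\<Sum>k\<in>I. 0) (sqrt (\<Sum>k\<in>I. \<bar>w k\<bar>\<^sup>2)))"
  proof (rule PP.sum_indep_normal)
    show "PP.indep_vars (\<lambda>_. borel) (\<lambda>k z. w k * z k) I"
      by (rule PP.indep_vars_subset[OF ind]) (auto simp: I_def)
    fix k assume k: "k \<in> I"
    have "distributed ?P lborel (\<lambda>z. z k) std_normal_density"
      using comp[of k] k by (auto simp: distributed_def I_def cong: distr_cong)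
    from PP.normal_density_affine[OF this, of "w k" 0] k
    show "distributed ?P lborel (\<lambda>z. w k * z k) (normal_density 0 \<bar>w k\<bar>)" by (simp add: I_def)
  qed (use \<open>I \<noteq> {}\<close> in \<open>auto simp: I_def\<close>)
  then have "distr ?P lborel (\<lambda>z. \<Sum>k\<in>I. w k * z k) = std_gauss"
    using \<open>(\<Sum>k\<in>I. (w k)\<^sup>2) = 1\<close> by (simp add: distributed_def)
  moreover have "(\<lambda>z. \<Sum>k\<in>I. w k * z k) = (\<lambda>z. \<Sum>k<d. w k * z k)"
    by (intro ext sum.mono_neutral_left) (auto simp: I_def)
  ultimately show ?thesis by (metis (no_types, lifting) distr_cong sets_lborel)
qed

section \<open>Population depth, contamination and empirical measures\<close>

interpretation gauss2: pair_prob_space std_gauss std_gauss ..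

lemma measure_std_gauss2_times:
  assumes "A \<in> sets borel" "B \<in> sets borel"
  shows "measure (std_gauss \<Otimes>\<^sub>M std_gauss) (A \<times> B) = measure std_gauss A * measure std_gauss B"
  using gauss.emeasure_pair_measure_Times[of A std_gauss B] assms
  by (simp add: measure_def enn2real_mult)

lemma std_gauss_interval_ge:
  assumes "- 2 \<le> a" "a \<le> b" "b \<le> 2"
  shows "(b - a) / 27 \<le> measure std_gauss {a<..<b}"
proof -
  \<comment> \<open>27 = 3 * 9, from sqrt (2 * pi) <= 3 and exp 2 <= 9.\<close>
  have d: "1 / 27 \<le> std_normal_density x" if "x \<in> {a<..<b}" for x
  proof -
    have "\<bar>x\<bar> \<le> 2" using that assms by auto
    then have "x\<^sup>2 \<le> 2\<^sup>2" by (metis abs_le_square_iff abs_numeral)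
    then have le: "exp (- 2) \<le> exp (- x\<^sup>2 / 2)" by simp
    have e2: "1 / 9 \<le> exp (- 2 :: real)"
    proof -
      have "exp (2::real) = exp 1 * exp 1" by (simp add: exp_add[symmetric])
      also have "\<dots> \<le> 3 * 3" using exp_le by (intro mult_mono) auto
      finally show ?thesis by (simp add: exp_minus field_simps)
    qed
    have "sqrt (2 * pi) \<le> 3"
      using pi_less_4 by (intro real_le_lsqrt) auto
    then have "1 / 3 \<le> 1 / sqrt (2 * pi)" using pi_gt3 by (intro divide_left_mono) auto
    then have "1 / 3 * (1 / 9) \<le> 1 / sqrt (2 * pi) * exp (- x\<^sup>2 / 2)"
      by (intro mult_mono order_trans[OF e2 le]) auto
    then show ?thesis by (simp add: std_normal_density_def)
  qed
  have "ennreal ((b - a) / 27) = ennreal (1 / 27) * ennreal (b - a)"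
    using assms by (subst ennreal_mult[symmetric]) auto
  also have "\<dots> = (\<integral>\<^sup>+x. ennreal (1 / 27) * indicator {a<..<b} x \<partial>lborel)"
    using assms by (subst nn_integral_cmult_indicator) auto
  also have "\<dots> \<le> (\<integral>\<^sup>+x. ennreal (std_normal_density x) * indicator {a<..<b} x \<partial>lborel)"
    using d by (intro nn_integral_mono) (auto simp: indicator_def intro!: ennreal_leI)
  also have "\<dots> = emeasure std_gauss {a<..<b}"
    by (rule emeasure_density[symmetric]) auto
  finally show ?thesis by (simp add: gauss.emeasure_eq_measure)
qed

text \<open>Over each x the slab is an interval of length 2 b, and the density is at most 1 / 2. The
  bound is therefore the same for all tilts.\<close>

lemma std_gauss2_slab_le:
  assumes "0 \<le> b"
  shows "measure (std_gauss \<Otimes>\<^sub>M std_gauss) {p \<in> space (std_gauss \<Otimes>\<^sub>M std_gauss). \<bar>snd p - t * fst p\<bar> \<le> b} \<le> b"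
proof -
  let ?A = "{p \<in> space (std_gauss \<Otimes>\<^sub>M std_gauss). \<bar>snd p - t * fst p\<bar> \<le> b}"
  have A: "?A \<in> sets (std_gauss \<Otimes>\<^sub>M std_gauss)" by measurable
  have "emeasure (std_gauss \<Otimes>\<^sub>M std_gauss) ?A = (\<integral>\<^sup>+x. emeasure std_gauss (Pair x -` ?A) \<partial>std_gauss)"
    by (rule gauss.emeasure_pair_measure_alt[OF A])
  also have "\<dots> \<le> (\<integral>\<^sup>+x. ennreal b \<partial>std_gauss)"
  proof (intro nn_integral_mono)
    fix x
    have "Pair x -` ?A = {t * x - b..(t * x - b) + 2 * b}"
      by (auto simp: space_pair_measure abs_le_iff)
    then show "emeasure std_gauss (Pair x -` ?A) \<le> ennreal b"
      using std_gauss_interval_le[of "2 * b" "t * x - b"] assms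
      by (simp add: gauss.emeasure_eq_measure ennreal_leI)
  qed
  also have "\<dots> = ennreal b" by (simp add: gauss.emeasure_space_1[simplified])
  finally show ?thesis using assms by (simp add: gauss2.emeasure_eq_measure)
qed

text \<open>The first coordinate is the covariate in a normalized direction, the second the
  standardized noise. The tilt t is the distance of the candidate from the truth in noise
  units.\<close>

abbreviation depth_region :: "real \<Rightarrow> (real \<times> real) set" where
  "depth_region t \<equiv> {p. 0 \<le> fst p * (snd p - t * fst p)}"

lemma depth_region_measurable [measurable]: "depth_region t \<in> sets (borel \<Otimes>\<^sub>M borel)"
proof -
  have "{p \<in> space (borel \<Otimes>\<^sub>M borel). 0 \<le> fst p * (snd p - t * fst p)} \<in> sets (borel \<Otimes>\<^sub>M borel)"
    by measurable
  then show ?thesis by (simp add: space_pair_measure)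
qed

text \<open>Reflecting the second coordinate preserves the law and swaps the region with the
  opposite pair of quadrants; the two overlap in the axes, a null set.\<close>

lemma std_gauss2_quadrants: "measure (std_gauss \<Otimes>\<^sub>M std_gauss) {p. 0 \<le> fst p * snd p} = 1 / 2"
proof -
  let ?G = "std_gauss \<Otimes>\<^sub>M std_gauss"
  have sets_G: "sets ?G = sets (borel \<Otimes>\<^sub>M borel)" by (intro sets_pair_measure_cong) auto
  have meas[measurable]: "{p :: real \<times> real. 0 \<le> fst p * snd p} \<in> sets ?G" "{p :: real \<times> real. fst p * snd p \<le> 0} \<in> sets ?G"
    "{p :: real \<times> real. fst p * snd p = 0} \<in> sets ?G"
  proof -
    have "{p \<in> space ?G. 0 \<le> fst p * snd p} \<in> sets ?G" "{p \<in> space ?G. fst p * snd p \<le> 0} \<in> sets ?G"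
      "{p \<in> space ?G. fst p * snd p = 0} \<in> sets ?G" by measurable
    then show "{p :: real \<times> real. 0 \<le> fst p * snd p} \<in> sets ?G" "{p :: real \<times> real. fst p * snd p \<le> 0} \<in> sets ?G"
    "{p :: real \<times> real. fst p * snd p = 0} \<in> sets ?G"
      by (simp_all add: space_pair_measure)
  qed
  have "distr std_gauss std_gauss uminus = std_gauss"
    using distr_std_gauss_uminus by (metis (no_types, lifting) distr_cong sets_density sets_lborel)
  then have dG: "distr ?G ?G (\<lambda>(x, y). (x, - y)) = ?G"
    using pair_measure_distr[of "\<lambda>x. x" std_gauss std_gauss uminus std_gauss std_gauss]
      prob_space_imp_sigma_finite[OF prob_space_std_gauss]
    by (simp add: distr_id2)
  have "measure ?G {p. 0 \<le> fst p * snd p} = measure (distr ?G ?G (\<lambda>(x, y). (x, - y))) {p. 0 \<le> fst p * snd p}"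
    by (simp add: dG)
  also have "\<dots> = measure ?G {p. fst p * snd p \<le> 0}"
    using depth_region_measurable[of 0]
    by (subst measure_distr) (auto simp: space_pair_measure intro!: arg_cong[where f="measure ?G"])
  finally have sym: "measure ?G {p. 0 \<le> fst p * snd p} = measure ?G {p. fst p * snd p \<le> 0}" .
  have null: "measure ?G {p. fst p * snd p = 0} = 0"
  proof -
    have "{p :: real \<times> real. fst p * snd p = 0} = ({0} \<times> UNIV) \<union> (UNIV \<times> {0})" by auto
    moreover have "measure ?G ({0} \<times> UNIV) = 0" "measure ?G (UNIV \<times> {0}) = 0"
      by (simp_all add: measure_std_gauss2_times std_gauss_singleton)
    ultimately have "measure ?G {p. fst p * snd p = 0} \<le> 0"
      using measure_Un_le[of "{0} \<times> UNIV" ?G "UNIV \<times> {0}"] by (simp add: pair_measureI)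
    then show ?thesis using measure_nonneg by (rule antisym)
  qed
  have "measure ?G {p. 0 \<le> fst p * snd p} + measure ?G {p. fst p * snd p \<le> 0} = 1 + measure ?G {p. fst p * snd p = 0}"
  proof -
    have "{p. 0 \<le> fst p * snd p} \<union> {p. fst p * snd p \<le> 0} = space ?G" by (auto simp: space_pair_measure)
    moreover have "{p. 0 \<le> fst p * snd p} \<inter> {p. fst p * snd p \<le> 0} = {p :: real \<times> real. fst p * snd p = 0}" by auto
    ultimately show ?thesis
      using meas[unfolded sets_G] measure_Un3[of "{p. 0 \<le> fst p * snd p}" ?G "{p. fst p * snd p \<le> 0}"]
      by (simp add: fmeasurable_def gauss2.emeasure_finite less_top[symmetric] gauss2.prob_space)
  qed
  then show ?thesis using sym null by simp
qed

lemma std_gauss2_depth_region_0: "measure (std_gauss \<Otimes>\<^sub>M std_gauss) (depth_region 0) = 1 / 2"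
  using std_gauss2_quadrants by simp

text \<open>A tilt by t removes the rectangle ]1,2[ x ]0,t[ from the depth region.\<close>

lemma std_gauss2_depth_region_le:
  assumes t: "0 \<le> t" "t \<le> 1"
  shows "measure (std_gauss \<Otimes>\<^sub>M std_gauss) (depth_region t) \<le> 1 / 2 - t / 729"
proof -
  let ?G = "std_gauss \<Otimes>\<^sub>M std_gauss"
  let ?R = "{1<..<2::real} \<times> {0<..<t}"
  have sub: "depth_region t \<union> ?R \<subseteq> depth_region 0"
  proof safe
    fix x y :: real assume a: "0 \<le> fst (x, y) * (snd (x, y) - t * fst (x, y))"
    have "0 \<le> t * x\<^sup>2" using t by simp
    then show "0 \<le> fst (x, y) * (snd (x, y) - 0 * fst (x, y))"
      using a by (simp add: algebra_simps power2_eq_square)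
  qed auto
  have disj: "depth_region t \<inter> ?R = {}"
  proof safe
    fix x y :: real assume a: "0 \<le> fst (x, y) * (snd (x, y) - t * fst (x, y))"
      and x: "x \<in> {1<..<2}" "y \<in> {0<..<t}"
    have "t * 1 \<le> t * x" using t x by (intro mult_left_mono) auto
    moreover have "y < t * 1" using x by simp
    ultimately have "y < t * x" by linarith
    then have "x * (y - t * x) < 0" using x by (intro mult_pos_neg) auto
    then show "(x, y) \<in> {}" using a by simp
  qed
  have "sets ?G = sets (borel \<Otimes>\<^sub>M borel)" by (intro sets_pair_measure_cong) auto
  then have [measurable]: "depth_region t \<in> sets ?G" for t
    using depth_region_measurable[of t] by (simp only:)
  have "measure ?G (depth_region t) + measure ?G ?R = measure ?G (depth_region t \<union> ?R)"
    using disj by (intro gauss2.finite_measure_Union[symmetric]) (auto intro: pair_measureI)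
  also have "\<dots> \<le> measure ?G (depth_region 0)"
    by (intro gauss2.finite_measure_mono sub) measurable
  also have "\<dots> = 1 / 2" by (rule std_gauss2_depth_region_0)
  finally have "measure ?G (depth_region t) \<le> 1 / 2 - measure ?G ?R" by simp
  \<comment> \<open>729 = 27 * 27: both sides of the rectangle lie in [-2, 2], where each density is
    at least 1 / 27.\<close>
  moreover have "1 / 27 * (t / 27) \<le> measure std_gauss {1<..<2} * measure std_gauss {0<..<t}"
    using std_gauss_interval_ge[of 1 2] std_gauss_interval_ge[of 0 t] t
    by (intro mult_mono) simp_all
  then have "1 / 27 * (t / 27) \<le> measure ?G ?R"
    by (subst measure_std_gauss2_times) simp_all
  ultimately show ?thesis by simp
qed

section \<open>Contamination as a coupling with labels, and empirical measures\<close>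

definition contamination :: "real \<Rightarrow> 'a measure \<Rightarrow> 'a measure \<Rightarrow> (bool \<times> 'a \<times> 'a) measure" where
  "contamination eps P Q = measure_pmf (bernoulli_pmf eps) \<Otimes>\<^sub>M (P \<Otimes>\<^sub>M Q)"

definition observed :: "bool \<times> 'a \<times> 'a \<Rightarrow> 'a" where
  "observed w = (if fst w then snd (snd w) else fst (snd w))"

lemma prob_space_contamination:
  assumes "prob_space P" "prob_space Q"
  shows "prob_space (contamination eps P Q)"
  unfolding contamination_def
  by (intro prob_space_pair assms measure_pmf.prob_space_axioms)

lemma measurable_observed:
  assumes "sets Q = sets P"
  shows "observed \<in> measurable (contamination eps P Q) P"
proof -
  have [measurable_cong]: "sets Q = sets P" by fact
  show ?thesis unfolding observed_def contamination_def by measurable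
qed

lemma emeasure_contamination_times:
  assumes P: "prob_space P" and Q: "prob_space Q" and eps: "0 \<le> eps" "eps \<le> 1"
    and A: "A \<in> sets P" and B: "B \<in> sets Q"
  shows "emeasure (contamination eps P Q) (L \<times> A \<times> B)
    = emeasure (measure_pmf (bernoulli_pmf eps)) L * (emeasure P A * emeasure Q B)"
proof -
  interpret P: prob_space P by fact
  interpret Q: prob_space Q by fact
  interpret PQ: pair_prob_space P Q ..
  show ?thesis unfolding contamination_def using A B
    by (simp add: PQ.emeasure_pair_measure_Times Q.emeasure_pair_measure_Times pair_measureI)
qed

text \<open>Draw a label, a clean point and an outlier independently; the label decides which one is
  observed. The coupling shows that \<open>mixture\<close> is a genuine probability measure, and it
  keeps the clean draws available after contamination, which the mixture alone forgets.\<close>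

lemma mixture_eq_distr:
  assumes P: "prob_space P" and Q: "prob_space Q" and sets: "sets Q = sets P"
    and eps: "0 \<le> eps" "eps \<le> 1"
  shows "mixture eps P Q = distr (contamination eps P Q) P observed"
proof -
  interpret P: prob_space P by fact
  interpret Q: prob_space Q by fact
  let ?K = "contamination eps P Q"
  let ?M = "distr ?K P observed"
  have space: "space Q = space P" using sets by (rule sets_eq_imp_space_eq)
  have eq: "ennreal (1 - eps) * emeasure P A + ennreal eps * emeasure Q A = emeasure ?M A"
    if A: "A \<in> sets P" for A
  proof -
    have "observed -` A \<inter> space ?K = ({False} \<times> A \<times> space Q) \<union> ({True} \<times> space P \<times> A)"
      using sets.sets_into_space[OF A] space
      by (auto simp: observed_def contamination_def space_pair_measure split: if_splits)
    then have "emeasure ?M A = emeasure ?K (({False} \<times> A \<times> space Q) \<union> ({True} \<times> space P \<times> A))"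
      using A by (simp add: emeasure_distr measurable_observed sets)
    also have "\<dots> = emeasure ?K ({False} \<times> A \<times> space Q) + emeasure ?K ({True} \<times> space P \<times> A)"
      using A by (intro plus_emeasure[symmetric]) (auto simp: contamination_def sets intro!: pair_measureI)
    also have "\<dots> = ennreal (1 - eps) * emeasure P A + ennreal eps * emeasure Q A"
      using A eps by (subst (1 2) emeasure_contamination_times)
        (auto simp: P Q sets space P.emeasure_space_1 Q.emeasure_space_1[unfolded space] emeasure_pmf_single)
    finally show ?thesis ..
  qed
  have "mixture eps P Q = measure_of (space P) (sets P) (emeasure ?M)"
    unfolding mixture_def
    by (rule measure_of_eq) (auto simp: sets.space_closed sets.sigma_sets_eq eq)
  also have "\<dots> = measure_of (space ?M) (sets ?M) (emeasure ?M)" by simp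
  also have "\<dots> = ?M" by (rule measure_of_of_measure)
  finally show ?thesis .
qed

lemma sets_mixture [simp]: "sets (mixture eps P Q) = sets P"
  by (simp add: mixture_def)

lemma space_mixture [simp]: "space (mixture eps P Q) = space P"
  by (simp add: mixture_def)

lemma prob_space_mixture:
  assumes "prob_space P" "prob_space Q" "sets Q = sets P" "0 \<le> eps" "eps \<le> 1"
  shows "prob_space (mixture eps P Q)"
  unfolding mixture_eq_distr[OF assms]
  by (intro prob_space.prob_space_distr prob_space_contamination measurable_observed assms)

lemma measure_mixture:
  assumes P: "prob_space P" and Q: "prob_space Q" and sets: "sets Q = sets P"
    and eps: "0 \<le> eps" "eps \<le> 1" and A: "A \<in> sets P"
  shows "measure (mixture eps P Q) A = (1 - eps) * measure P A + eps * measure Q A"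
proof -
  interpret P: prob_space P by fact
  interpret Q: prob_space Q by fact
  interpret M: prob_space "mixture eps P Q" by (rule prob_space_mixture) fact+
  have "emeasure (mixture eps P Q) A = ennreal (1 - eps) * emeasure P A + ennreal eps * emeasure Q A"
  proof -
    let ?\<mu> = "\<lambda>A. ennreal (1 - eps) * emeasure P A + ennreal eps * emeasure Q A"
    have ca: "countably_additive (sets P) ?\<mu>"
    proof (rule countably_additiveI)
      fix F :: "nat \<Rightarrow> 'a set" assume F: "range F \<subseteq> sets P" "disjoint_family F" "(\<Union>i. F i) \<in> sets P"
      then show "(\<Sum>i. ?\<mu> (F i)) = ?\<mu> (\<Union>i. F i)"
        using suminf_emeasure[OF F(1,2)] suminf_emeasure[of F Q] sets
        by (simp add: suminf_add[symmetric] ennreal_suminf_cmult)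
    qed
    show ?thesis
      by (rule emeasure_measure_of[OF mixture_def])
        (use A ca sets.space_closed in \<open>auto simp: positive_def\<close>)
  qed
  then show ?thesis using eps
    by (simp add: M.emeasure_eq_measure P.emeasure_eq_measure Q.emeasure_eq_measure
        ennreal_mult[symmetric] ennreal_plus[symmetric] del: ennreal_plus)
qed

lemma measure_mixture_bounds:
  assumes P: "prob_space P" and Q: "prob_space Q" and sets: "sets Q = sets P"
    and eps: "0 \<le> eps" "eps \<le> 1" and A: "A \<in> sets P"
  shows "\<bar>measure (mixture eps P Q) A - measure P A\<bar> \<le> eps"
proof -
  have "measure (mixture eps P Q) A - measure P A = eps * (measure Q A - measure P A)"
    by (simp add: measure_mixture[OF assms] algebra_simps)
  moreover have "\<bar>measure Q A - measure P A\<bar> \<le> 1"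
    using prob_space.prob_le_1[OF P, of A] prob_space.prob_le_1[OF Q, of A]
      measure_nonneg[of P A] measure_nonneg[of Q A] by linarith
  ultimately show ?thesis using eps
    by (simp add: abs_mult mult_left_le)
qed

lemma measure_empirical:
  assumes n: "1 \<le> n" and \<omega>: "\<And>i. i < n \<Longrightarrow> \<omega> i \<in> space M" and A: "A \<in> sets M"
  shows "measure (empirical M n \<omega>) A = real (card {i \<in> {..<n}. \<omega> i \<in> A}) / real n"
proof -
  define U where "U = measure_pmf (pmf_of_set {..<n})"
  \<comment> \<open>The default value \<omega> 0 makes the map total with values in the space of M,
    so the empirical measure becomes the image of the uniform law on {..<n}.\<close>
  define \<omega>' where "\<omega>' i = (if i < n then \<omega> i else \<omega> 0)" for i
  let ?D = "distr U M \<omega>'"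
  have meas: "\<omega>' \<in> measurable U M"
    using \<omega> n by (auto simp: U_def \<omega>'_def)
  have eq: "ennreal (real (card {i \<in> {..<n}. \<omega> i \<in> A}) / real n) = emeasure ?D A" if A: "A \<in> sets M" for A
  proof -
    have "emeasure ?D A = emeasure U (\<omega>' -` A)"
      using A meas by (simp add: emeasure_distr U_def)
    also have "\<dots> = ennreal (real (card ({..<n} \<inter> \<omega>' -` A)) / real n)"
      unfolding U_def using n by (subst emeasure_pmf_of_set) (auto simp: lessThan_empty_iff)
    also have "{..<n} \<inter> \<omega>' -` A = {i \<in> {..<n}. \<omega> i \<in> A}" by (auto simp: \<omega>'_def)
    finally show ?thesis ..
  qed
  have "empirical M n \<omega> = measure_of (space M) (sets M) (emeasure ?D)"
    unfolding empirical_def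
    by (rule measure_of_eq) (rule sets.space_closed, simp only: sets.sigma_sets_eq eq)
  also have "\<dots> = measure_of (space ?D) (sets ?D) (emeasure ?D)" by simp
  also have "\<dots> = ?D" by (rule measure_of_of_measure)
  finally have "measure (empirical M n \<omega>) A = measure ?D A" by simp
  also have "\<dots> = real (card {i \<in> {..<n}. \<omega> i \<in> A}) / real n"
    using eq[OF A, symmetric] by (simp add: measure_def)
  finally show ?thesis .
qed

section \<open>Chaining over a Gaussian class\<close>

text \<open>The set D0 carries the clean law. For singular S it is a proper subset of the data space,
  and outside of it g is not controlled by rho.\<close>

locale gaussian_class =
  fixes P Q :: "'x measure" and C :: "'u set" and g :: "'u \<Rightarrow> 'x \<Rightarrow> real" and \<xi> :: "'x \<Rightarrow> real"
    and \<rho> :: "'u \<Rightarrow> 'u \<Rightarrow> real" and D\<^sub>0 :: "'x set" and d :: real and N :: "nat \<Rightarrow> 'u set"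
  assumes P: "prob_space P" and Q: "prob_space Q" and sets_Q: "sets Q = sets P"
    and g_meas: "u \<in> C \<Longrightarrow> g u \<in> borel_measurable P"
    and \<xi>_meas [measurable]: "\<xi> \<in> borel_measurable P"
    and pair_law: "u \<in> C \<Longrightarrow>
      distr P (borel \<Otimes>\<^sub>M borel) (\<lambda>x. (g u x, \<xi> x)) = std_gauss \<Otimes>\<^sub>M std_gauss"
    and diff_law: "u \<in> C \<Longrightarrow> v \<in> C \<Longrightarrow>
      distr P borel (\<lambda>x. g u x - g v x) = distr std_gauss borel (\<lambda>z. \<rho> u v * z)"
    and \<rho>_nonneg: "0 \<le> \<rho> u v" and \<rho>_sym: "\<rho> u v = \<rho> v u"
    and \<rho>_triangle: "\<rho> u w \<le> \<rho> u v + \<rho> v w"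
    and d: "2 \<le> d"
    and N_sub: "N j \<subseteq> C" and N_finite: "finite (N j)"
    and N_card: "real (card (N j)) \<le> exp (25 * d * real (j + 1))"
    and N_dense: "u \<in> C \<Longrightarrow> \<exists>a\<in>N j. \<rho> u a \<le> (1 / 8) ^ j"
    and D0: "D\<^sub>0 \<in> sets P" "measure P D\<^sub>0 = 1"
    and D0_lipschitz: "x \<in> D\<^sub>0 \<Longrightarrow> \<exists>M. \<forall>u\<in>C. \<forall>v\<in>C. \<bar>g u x - g v x\<bar> \<le> M * \<rho> u v"
begin

sublocale P: prob_space P by (rule P)
sublocale Q: prob_space Q by (rule Q)

text \<open>In the application this is the depth event in direction u at the candidate B + sig t
  u.\<close>

definition reg :: "real \<Rightarrow> 'u \<Rightarrow> 'x set" where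
  "reg t u = {x \<in> space P. 0 \<le> g u x * (\<xi> x - t * g u x)}"

text \<open>The points where moving \<open>g\<close> by at most s may flip the sign of a factor of
  \<open>reg\<close>. Such a move shifts the second factor by at most t * s, hence the two
  thresholds.\<close>

definition near :: "real \<Rightarrow> real \<Rightarrow> 'u \<Rightarrow> 'x set" where
  "near t s u = {x \<in> space P. \<bar>g u x\<bar> \<le> s \<or> \<bar>\<xi> x - t * g u x\<bar> \<le> t * s}"

lemma reg_sets [measurable]: "u \<in> C \<Longrightarrow> reg t u \<in> sets P"
  unfolding reg_def using g_meas[of u] by measurable

lemma near_sets [measurable]: "u \<in> C \<Longrightarrow> near t s u \<in> sets P"
  unfolding near_def using g_meas[of u] by measurable

lemma measure_pair:
  assumes u: "u \<in> C" and B: "B \<in> sets (borel \<Otimes>\<^sub>M borel)"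
  shows "measure P {x \<in> space P. (g u x, \<xi> x) \<in> B} = measure (std_gauss \<Otimes>\<^sub>M std_gauss) B"
proof -
  note [measurable] = g_meas[OF u]
  show ?thesis
    unfolding pair_law[OF u, symmetric]
    by (subst measure_distr) (use B in \<open>auto intro!: arg_cong[where f="measure P"]\<close>)
qed

lemma measure_reg: "u \<in> C \<Longrightarrow> measure P (reg t u) = measure (std_gauss \<Otimes>\<^sub>M std_gauss) (depth_region t)"
  using measure_pair[of u "depth_region t"] by (simp add: reg_def)

lemma measure_near:
  assumes u: "u \<in> C" and t: "0 \<le> t" "t \<le> 1" and s: "0 \<le> s"
  shows "measure P (near t s u) \<le> 2 * s"
proof -
  note [measurable] = g_meas[OF u]
  let ?A = "{x \<in> space P. (g u x, \<xi> x) \<in> {- s..s} \<times> UNIV}"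
  let ?B = "{x \<in> space P. (g u x, \<xi> x) \<in> {p. \<bar>snd p - t * fst p\<bar> \<le> t * s}}"
  have slab: "{p. \<bar>snd p - t * fst p\<bar> \<le> t * s} \<in> sets (borel \<Otimes>\<^sub>M borel)"
  proof -
    have "{p \<in> space (borel \<Otimes>\<^sub>M borel). \<bar>snd p - t * fst p\<bar> \<le> t * s} \<in> sets (borel \<Otimes>\<^sub>M borel)" by measurable
    then show ?thesis by (simp add: space_pair_measure)
  qed
  have "measure P ?A = measure std_gauss {- s..- s + 2 * s}"
    using measure_pair[OF u, of "{- s..s} \<times> UNIV"] gauss.prob_space
    by (simp add: measure_std_gauss2_times)
  also have "\<dots> \<le> s" using std_gauss_interval_le[of "2 * s" "- s"] s by simp
  finally have A: "measure P ?A \<le> s" .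
  have "measure P ?B \<le> t * s"
    using measure_pair[OF u slab] std_gauss2_slab_le[of "t * s" t] t s by (simp add: space_pair_measure)
  also have "\<dots> \<le> s" using t s by (simp add: mult_left_le_one_le)
  finally have B: "measure P ?B \<le> s" .
  have "near t s u = ?A \<union> ?B" by (auto simp: near_def abs_le_iff)
  then have "measure P (near t s u) \<le> measure P ?A + measure P ?B"
    by (simp only:) (intro measure_Un_le, measurable)
  then show ?thesis using A B by linarith
qed

lemma measure_far:
  assumes u: "u \<in> C" and v: "v \<in> C" and \<delta>: "\<rho> u v \<le> \<delta>" and s: "0 < s"
  shows "measure P {x \<in> space P. s < \<bar>g u x - g v x\<bar>} \<le> \<delta>\<^sup>2 / s\<^sup>2"
proof -
  note [measurable] = g_meas[OF u] g_meas[OF v]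
  have "measure P {x \<in> space P. s < \<bar>g u x - g v x\<bar>} = measure (distr P borel (\<lambda>x. g u x - g v x)) {y. s < \<bar>y\<bar>}"
    by (subst measure_distr) (auto intro!: arg_cong[where f="measure P"])
  also have "\<dots> = measure std_gauss {z. s < \<bar>\<rho> u v * z\<bar>}"
    unfolding diff_law[OF u v]
    by (subst measure_distr) (auto intro!: arg_cong[where f="measure std_gauss"])
  also have "\<dots> \<le> \<delta>\<^sup>2 / s\<^sup>2"
  proof (cases "\<rho> u v = 0")
    case True
    then show ?thesis using s by simp
  next
    case False
    then have pos: "0 < \<rho> u v" using \<rho>_nonneg[of u v] by simp
    then have "{z. s < \<bar>\<rho> u v * z\<bar>} = {z. s / \<rho> u v < \<bar>z\<bar>}"
      by (auto simp: abs_mult field_simps)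
    moreover have "measure std_gauss {z. s / \<rho> u v < \<bar>z\<bar>} \<le> 1 / (s / \<rho> u v)\<^sup>2"
      using pos s by (intro std_gauss_tail_le) simp
    moreover have "1 / (s / \<rho> u v)\<^sup>2 = (\<rho> u v)\<^sup>2 / s\<^sup>2" by (simp add: power_divide)
    moreover have "(\<rho> u v)\<^sup>2 / s\<^sup>2 \<le> \<delta>\<^sup>2 / s\<^sup>2"
      using pos \<delta> by (intro divide_right_mono power_mono) auto
    ultimately show ?thesis by simp
  qed
  finally show ?thesis .
qed

lemma reg_change:
  assumes t: "0 \<le> t" and s: "0 \<le> s" and x: "x \<in> space P"
    and diff: "(x \<in> reg t u) \<noteq> (x \<in> reg t v)" and notnear: "x \<notin> near t s v"
  shows "s < \<bar>g u x - g v x\<bar>"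
proof (rule ccontr)
  assume "\<not> ?thesis"
  then have le: "\<bar>g u x - g v x\<bar> \<le> s" by simp
  define a b where "a = \<xi> x - t * g u x" and "b = \<xi> x - t * g v x"
  have gv: "s < \<bar>g v x\<bar>" and b: "t * s < \<bar>b\<bar>"
    using notnear x by (auto simp: near_def b_def)
  have "a - b = t * (g v x - g u x)" by (simp add: a_def b_def algebra_simps)
  then have "\<bar>a - b\<bar> = t * \<bar>g u x - g v x\<bar>" using t by (simp add: abs_mult abs_minus_commute)
  also have "\<dots> \<le> t * s" using le t by (intro mult_left_mono)
  finally have ab: "\<bar>a - b\<bar> \<le> t * s" .
  have sg: "(0 < g u x \<longleftrightarrow> 0 < g v x) \<and> g u x \<noteq> 0 \<and> g v x \<noteq> 0" using le gv s by (auto split: abs_split)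
  have "0 \<le> t * s" using t s by simp
  then have sb: "(0 < a \<longleftrightarrow> 0 < b) \<and> a \<noteq> 0 \<and> b \<noteq> 0" using ab b by (auto split: abs_split)
  have "(0 \<le> g u x * a) = (0 \<le> g v x * b)"
    using sg sb by (auto simp: zero_le_mult_iff)
  then show False using diff x by (auto simp: reg_def a_def b_def)
qed

text \<open>The best s is of order \<delta>^(2/3). This is why the nets have scale 8^(-j): then s =
  4^(-j), the change has probability of order 4^(-j), and its standard deviation is of order
  2^(-j).\<close>

lemma measure_reg_change:
  assumes u: "u \<in> C" and v: "v \<in> C" and \<delta>: "\<rho> u v \<le> \<delta>" and t: "0 \<le> t" "t \<le> 1" and s: "0 < s"
  shows "measure P {x \<in> space P. (x \<in> reg t u) \<noteq> (x \<in> reg t v)} \<le> 2 * s + \<delta>\<^sup>2 / s\<^sup>2"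
proof -
  note [measurable] = g_meas[OF u] g_meas[OF v] near_sets[OF v]
  let ?F = "{x \<in> space P. s < \<bar>g u x - g v x\<bar>}"
  have "{x \<in> space P. (x \<in> reg t u) \<noteq> (x \<in> reg t v)} \<subseteq> near t s v \<union> ?F"
    using reg_change[of t s _ u v] t s by auto
  then have "measure P {x \<in> space P. (x \<in> reg t u) \<noteq> (x \<in> reg t v)} \<le> measure P (near t s v \<union> ?F)"
    by (intro P.finite_measure_mono) measurable
  also have "\<dots> \<le> measure P (near t s v) + measure P ?F"
    by (intro measure_Un_le) measurable
  also have "\<dots> \<le> 2 * s + \<delta>\<^sup>2 / s\<^sup>2"
    using measure_near[OF v t] measure_far[OF u v \<delta> s] s by (intro add_mono) auto
  finally show ?thesis .
qed

definition links :: "nat \<Rightarrow> ('u \<times> 'u) set" where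
  "links j = {(a, b) \<in> N j \<times> N (Suc j). \<rho> a b \<le> 2 * (1 / 8) ^ j}"

lemma links_sub: "(a, b) \<in> links j \<Longrightarrow> a \<in> C \<and> b \<in> C \<and> \<rho> a b \<le> 2 * (1 / 8) ^ j"
  using N_sub by (auto simp: links_def)

lemma finite_links: "finite (links j)"
  by (rule finite_subset[of _ "N j \<times> N (Suc j)"]) (auto simp: links_def N_finite)

lemma card_links: "real (card (links j)) \<le> exp (75 * d * real (j + 1))"
proof -
  have "card (links j) \<le> card (N j \<times> N (Suc j))"
    by (rule card_mono) (auto simp: links_def N_finite)
  then have "real (card (links j)) \<le> real (card (N j)) * real (card (N (Suc j)))"
    by (simp add: card_cartesian_product flip: of_nat_mult)
  also have "\<dots> \<le> exp (25 * d * real (j + 1)) * exp (25 * d * real (Suc j + 1))"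
    by (intro mult_mono N_card) auto
  also have "\<dots> = exp (25 * d * real (2 * j + 3))"
    by (simp add: exp_add[symmetric] algebra_simps)
  also have "\<dots> \<le> exp (75 * d * real (j + 1))"
  proof -
    have "25 * d * real (2 * j + 3) \<le> 25 * d * real (3 * (j + 1))"
      using d by (intro mult_left_mono) auto
    then show ?thesis by (simp add: algebra_simps)
  qed
  finally show ?thesis .
qed

end

text \<open>J is the last level of the stochastic chain. The Bernstein parameter 2^j sqrt \<beta> is
  at most 1 exactly for j <= J, and 2^(-J) equals sqrt \<beta> up to a factor 2.\<close>

locale contaminated_sample = gaussian_class P Q C g \<xi> \<rho> D\<^sub>0 d N
  for P Q :: "'x measure" and C :: "'u set" and g :: "'u \<Rightarrow> 'x \<Rightarrow> real" and \<xi> :: "'x \<Rightarrow> real"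
    and \<rho> :: "'u \<Rightarrow> 'u \<Rightarrow> real" and D\<^sub>0 :: "'x set" and d :: real and N :: "nat \<Rightarrow> 'u set" +
  fixes eps \<beta> :: real and n J :: nat
  assumes eps: "0 \<le> eps" "eps \<le> 1" and n: "1 \<le> n" and \<beta>: "\<beta> = d / real n + eps\<^sup>2" and \<beta>1: "\<beta> \<le> 1"
    and J: "2 ^ J * sqrt \<beta> \<le> 1" "1 < 2 ^ Suc J * sqrt \<beta>"
begin

abbreviation "Mx \<equiv> mixture eps P Q"
abbreviation "PM \<equiv> PiM {..<n} (\<lambda>_. Mx)"

definition cnt :: "(nat \<Rightarrow> 'x) \<Rightarrow> 'x set \<Rightarrow> real" where
  "cnt \<omega> A = (\<Sum>i<n. indicator A (\<omega> i))"

lemma prob_space_Mx: "prob_space Mx"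
  by (rule prob_space_mixture) (rule P Q sets_Q eps)+

sublocale Mx: prob_space Mx by (rule prob_space_Mx)
sublocale PM: prob_space PM by (rule prob_space_PiM) (rule prob_space_Mx)

lemma \<beta>_pos: "0 < \<beta>" using \<beta> d n by (simp add: add_pos_nonneg)
lemma d_le: "d \<le> real n * \<beta>" using \<beta> n by (simp add: field_simps)
lemma eps_le: "eps \<le> sqrt \<beta>"
  using \<beta> d n eps by (intro real_le_rsqrt) simp
lemma sqrt_\<beta>: "0 < sqrt \<beta>" "sqrt \<beta> \<le> 1" "sqrt \<beta> * sqrt \<beta> = \<beta>" "\<beta> \<le> sqrt \<beta>"
proof -
  show p: "0 < sqrt \<beta>" "sqrt \<beta> \<le> 1" "sqrt \<beta> * sqrt \<beta> = \<beta>" using \<beta>_pos \<beta>1 by simp_all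
  show "\<beta> \<le> sqrt \<beta>" using mult_left_le[OF p(2), of "sqrt \<beta>"] p by simp
qed

lemma Mx_le: "A \<in> sets P \<Longrightarrow> measure Mx A \<le> measure P A + eps"
  using measure_mixture_bounds[OF P Q sets_Q eps, of A] by linarith

lemma meas_Mx: "f \<in> borel_measurable P \<Longrightarrow> f \<in> borel_measurable Mx"
  by (simp add: measurable_def)

lemma expectation_Mx: "A \<in> sets P \<Longrightarrow> (\<integral>x. indicator A x \<partial>Mx) = Mx.prob A"
  using sets.Int_space_eq2[of A P] by simp

text \<open>5 = 80 - 75 is what remains of the exponent 80 n \<beta> after paying for 75 d. At most
  eleven such terms are added in the end, and n \<beta> >= 2 lets one n \<beta> of the five
  survive.\<close>

definition fail_prob :: real where "fail_prob = exp (- (5 * real n * \<beta>))"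

lemma fail_prob_pos: "0 < fail_prob" by (simp add: fail_prob_def)

lemma fail_prob_le: "fail_prob \<le> 1 / 2" "12 * fail_prob \<le> exp (- (real n * \<beta>))"
proof -
  have nb: "2 \<le> real n * \<beta>" using d_le d by linarith
  have "12 * exp (- (8::real)) \<le> 1"
  proof -
    have "(2::real) ^ 8 \<le> exp 1 ^ 8" using exp_ge_add_one_self[of 1] by (intro power_mono) auto
    also have "\<dots> = exp 8" by (simp add: exp_of_nat_mult[symmetric])
    finally show ?thesis by (simp add: exp_minus field_simps)
  qed
  moreover have "exp (- (4 * real n * \<beta>)) \<le> exp (- 8)" using nb by (simp add: mult.commute)
  ultimately have *: "12 * exp (- (4 * real n * \<beta>)) \<le> 1" by linarith
  have yy: "fail_prob = exp (- (4 * real n * \<beta>)) * exp (- (real n * \<beta>))"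
    by (simp add: fail_prob_def exp_add[symmetric])
  have "12 * exp (- (4 * real n * \<beta>)) * exp (- (real n * \<beta>)) \<le> 1 * exp (- (real n * \<beta>))"
    by (intro mult_right_mono *) auto
  then show 1: "12 * fail_prob \<le> exp (- (real n * \<beta>))" by (simp add: yy)
  have "exp (- (real n * \<beta>)) \<le> 1" using nb by simp
  then show "fail_prob \<le> 1 / 2" using 1 by linarith
qed

text \<open>Since d <= n \<beta>, the surplus at level j is 5 (j + 1) n \<beta>, so the failure
  probabilities decay like powers of \<open>fail_prob\<close> and can be summed over all
  levels.\<close>

lemma exp_le_fail_prob:
  assumes "L \<le> 75 * d * real (j + 1)"
  shows "exp (L - real n * (80 * real (j + 1) * \<beta>)) \<le> fail_prob * (1 / 2) ^ j"
proof -
  have "75 * real (j + 1) * d \<le> 75 * real (j + 1) * (real n * \<beta>)"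
    by (intro mult_left_mono d_le) auto
  then have "L - real n * (80 * real (j + 1) * \<beta>) \<le> real (j + 1) * (- (5 * real n * \<beta>))"
    using assms by (simp add: algebra_simps)
  then have "exp (L - real n * (80 * real (j + 1) * \<beta>)) \<le> fail_prob ^ (j + 1)"
    unfolding fail_prob_def exp_of_nat_mult[symmetric] by simp
  also have "\<dots> = fail_prob * fail_prob ^ j" by simp
  also have "\<dots> \<le> fail_prob * (1 / 2) ^ j"
    using fail_prob_pos fail_prob_le by (intro mult_left_mono power_mono) auto
  finally show ?thesis .
qed

lemma sum_geometric_half: "(\<Sum>j<K. fail_prob * (1 / 2) ^ j) \<le> 2 * fail_prob"
proof -
  have "(\<Sum>j<K. (1 / 2 :: real) ^ j) = 2 * (1 - (1 / 2) ^ K)"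
    by (simp add: sum_gp_strict)
  also have "\<dots> \<le> 2" by simp
  finally show ?thesis using fail_prob_pos by (simp add: sum_distrib_left[symmetric])
qed

text \<open>The sign c = 1 or c = -1 selects upper or lower deviations, so one family of events
  covers both.\<close>

definition jump :: "real \<Rightarrow> real \<Rightarrow> 'u \<times> 'u \<Rightarrow> 'x \<Rightarrow> real" where
  "jump c t ab x = c * (indicator (reg t (snd ab)) x - indicator (reg t (fst ab)) x)"

text \<open>The Bernstein parameter of level j. With variance of order 4^(-j) and x of order (j + 1)
  \<beta>, both h * v and x / h become sqrt \<beta> / 2^j, up to the factor j + 1 and the
  contribution of eps.\<close>

definition step :: "nat \<Rightarrow> real" where
  "step j = 2 ^ j * sqrt \<beta>"

text \<open>The factors \<open>1\<close> and \<open>real (0 + 1)\<close> keep the event in the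
  literal form of \<open>bernstein_union\<close>, with h = sqrt \<beta> and v = 1.\<close>

definition bad_base :: "real \<Rightarrow> real \<Rightarrow> (nat \<Rightarrow> 'x) set" where
  "bad_base c t = {\<omega> \<in> space PM. \<exists>a\<in>N 0. real n * ((\<integral>x. c * indicator (reg t a) x \<partial>Mx)
      + sqrt \<beta> * 1 + 80 * real (0 + 1) * \<beta> / sqrt \<beta>) \<le> (\<Sum>i<n. c * indicator (reg t a) (\<omega> i))}"

definition bad_link :: "real \<Rightarrow> real \<Rightarrow> nat \<Rightarrow> (nat \<Rightarrow> 'x) set" where
  "bad_link c t j = {\<omega> \<in> space PM. \<exists>ab\<in>links j. real n * ((\<integral>x. jump c t ab x \<partial>Mx)
      + step j * (6 / 4 ^ j + eps) + 80 * real (j + 1) * \<beta> / step j) \<le> (\<Sum>i<n. jump c t ab (\<omega> i))}"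

text \<open>Here h = 1 is affordable: at level J the variance bound 2 / 2^J + eps is itself of order
  sqrt \<beta>.\<close>

definition bad_near :: "real \<Rightarrow> (nat \<Rightarrow> 'x) set" where
  "bad_near t = {\<omega> \<in> space PM. \<exists>a\<in>N J. real n * ((\<integral>x. indicator (near t (1 / 2 ^ J) a) x \<partial>Mx)
      + 1 * (2 / 2 ^ J + eps) + 80 * real (J + 1) * \<beta> / 1) \<le> (\<Sum>i<n. indicator (near t (1 / 2 ^ J) a) (\<omega> i))}"

definition bad :: "real \<Rightarrow> real \<Rightarrow> (nat \<Rightarrow> 'x) set" where
  "bad c t = bad_base c t \<union> (\<Union>j<J. bad_link c t j) \<union> bad_near t"

section \<open>Probabilities of the bad events of the stochastic chain\<close>

lemma step_pos: "0 < step j" using sqrt_\<beta> by (simp add: step_def)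

lemma step_le: "j \<le> J \<Longrightarrow> step j \<le> 1"
proof -
  assume "j \<le> J"
  then have "(2::real) ^ j \<le> 2 ^ J" by (intro power_increasing) auto
  then have "step j \<le> 2 ^ J * sqrt \<beta>" unfolding step_def using sqrt_\<beta> by (intro mult_right_mono) auto
  then show ?thesis using J by linarith
qed

lemma measurable_jump: "ab \<in> links j \<Longrightarrow> jump c t ab \<in> borel_measurable P"
  using reg_sets[of "fst ab" t] reg_sets[of "snd ab" t] links_sub[of "fst ab" "snd ab" j]
  unfolding jump_def by (intro borel_measurable_times borel_measurable_diff borel_measurable_indicator) auto

lemma jump_square: "x \<in> space P \<Longrightarrow> \<bar>c\<bar> = 1 \<Longrightarrow>
    (jump c t ab x)\<^sup>2 = indicator {x \<in> space P. (x \<in> reg t (fst ab)) \<noteq> (x \<in> reg t (snd ab))} x"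
proof -
  assume x: "x \<in> space P" and "\<bar>c\<bar> = 1"
  then have "c\<^sup>2 = 1" by (metis power2_abs power_one)
  then show ?thesis using x by (auto simp: jump_def power_mult_distrib indicator_def)
qed

lemma bad_base_bound:
  assumes c: "\<bar>c\<bar> = 1"
  shows "bad_base c t \<in> sets PM" "measure PM (bad_base c t) \<le> fail_prob"
proof -
  have meas[measurable]: "(\<lambda>x. c * indicator (reg t a) x) \<in> borel_measurable Mx" if "a \<in> N 0" for a
    by (intro meas_Mx borel_measurable_times borel_measurable_const borel_measurable_indicator
        reg_sets subsetD[OF N_sub that])
  show "bad_base c t \<in> sets PM"
    unfolding bad_base_def using N_finite by measurable
  have c2: "c\<^sup>2 = 1" using c by (metis power2_abs power_one)
  have "measure PM (bad_base c t) \<le> exp (25 * d * real (0 + 1) - real n * (80 * real (0 + 1) * \<beta>))"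
    unfolding bad_base_def
  proof (rule bernstein_union)
    fix a assume a: "a \<in> N 0"
    have "(\<integral>x. (c * indicator (reg t a) x)\<^sup>2 \<partial>Mx) = (\<integral>x. indicator (reg t a) x \<partial>Mx)"
      by (intro Bochner_Integration.integral_cong) (auto simp: indicator_def power_mult_distrib c2)
    also have "\<dots> = Mx.prob (reg t a)"
      using subsetD[OF N_sub a] by (intro expectation_Mx) auto
    finally show "(\<integral>x. (c * indicator (reg t a) x)\<^sup>2 \<partial>Mx) \<le> 1" by simp
  qed (use N_finite N_card[of 0] sqrt_\<beta> c prob_space_Mx meas in \<open>auto split: split_indicator\<close>)
  also have "\<dots> \<le> fail_prob * (1 / 2) ^ 0" using d by (intro exp_le_fail_prob) simp
  finally show "measure PM (bad_base c t) \<le> fail_prob" by simp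
qed

lemma bad_link_bound:
  assumes c: "\<bar>c\<bar> = 1" and t: "0 \<le> t" "t \<le> 1" and j: "j < J"
  shows "bad_link c t j \<in> sets PM" "measure PM (bad_link c t j) \<le> fail_prob * (1 / 2) ^ j"
proof -
  have [measurable]: "jump c t ab \<in> borel_measurable Mx" if "ab \<in> links j" for ab
    using measurable_jump[OF that] by (rule meas_Mx)
  show "bad_link c t j \<in> sets PM"
    unfolding bad_link_def using finite_links by measurable
  have "measure PM (bad_link c t j) \<le> exp (75 * d * real (j + 1) - real n * (80 * real (j + 1) * \<beta>))"
    unfolding bad_link_def
  proof (rule bernstein_union)
    fix ab assume ab: "ab \<in> links j"
    obtain a b where ab': "ab = (a, b)" by (cases ab)
    have C: "a \<in> C" "b \<in> C" "\<rho> a b \<le> 2 * (1 / 8) ^ j" using links_sub ab ab' by auto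
    let ?D = "{x \<in> space P. (x \<in> reg t a) \<noteq> (x \<in> reg t b)}"
    have D: "?D \<in> sets P" using reg_sets[OF C(1), of t] reg_sets[OF C(2), of t] by measurable
    have "(\<integral>x. (jump c t ab x)\<^sup>2 \<partial>Mx) = (\<integral>x. indicator ?D x \<partial>Mx)"
      by (intro Bochner_Integration.integral_cong) (auto simp: jump_square c ab')
    also have "\<dots> = Mx.prob ?D" by (rule expectation_Mx[OF D])
    also have "\<dots> \<le> P.prob ?D + eps" by (rule Mx_le[OF D])
    \<comment> \<open>The threshold is s = 4^(-j), and a link has length at most 2 * 8^(-j); the two
      parts are 2 / 4^j and 4 / 4^j.\<close>
    also have "P.prob ?D \<le> 2 * (1 / 4 ^ j) + (2 * (1 / 8) ^ j)\<^sup>2 / (1 / 4 ^ j)\<^sup>2"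
      by (rule measure_reg_change[OF C t]) simp
    also have "(2 * (1 / 8) ^ j)\<^sup>2 / (1 / 4 ^ j)\<^sup>2 = (4 / 4 ^ j :: real)"
    proof -
      have "(8::real) ^ j = 2 ^ j * 4 ^ j" "(4::real) ^ j = 2 ^ j * 2 ^ j"
        by (simp_all add: power_mult_distrib[symmetric])
      then show ?thesis by (simp add: power_one_over power2_eq_square field_simps)
    qed
    finally show "(\<integral>x. (jump c t ab x)\<^sup>2 \<partial>Mx) \<le> 6 / 4 ^ j + eps" by simp
  next
    fix ab x show "\<bar>jump c t ab x\<bar> \<le> 1"
      using c by (auto simp: jump_def indicator_def)
  qed (use finite_links card_links step_pos step_le[of j] j prob_space_Mx in auto)
  also have "\<dots> \<le> fail_prob * (1 / 2) ^ j" by (intro exp_le_fail_prob) simp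
  finally show "measure PM (bad_link c t j) \<le> fail_prob * (1 / 2) ^ j" .
qed

lemma bad_near_bound:
  assumes t: "0 \<le> t" "t \<le> 1"
  shows "bad_near t \<in> sets PM" "measure PM (bad_near t) \<le> fail_prob"
proof -
  have meas[measurable]: "(indicator (near t (1 / 2 ^ J) a) :: _ \<Rightarrow> real) \<in> borel_measurable Mx" if "a \<in> N J" for a
    by (intro meas_Mx borel_measurable_indicator near_sets subsetD[OF N_sub that])
  show "bad_near t \<in> sets PM"
    unfolding bad_near_def using N_finite by measurable
  have "measure PM (bad_near t) \<le> exp (25 * d * real (J + 1) - real n * (80 * real (J + 1) * \<beta>))"
    unfolding bad_near_def
  proof (rule bernstein_union)
    fix a assume a: "a \<in> N J"
    then have aC: "a \<in> C" using N_sub by auto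
    have "(\<integral>x. (indicator (near t (1 / 2 ^ J) a) x :: real)\<^sup>2 \<partial>Mx) = (\<integral>x. indicator (near t (1 / 2 ^ J) a) x \<partial>Mx)"
      by (intro Bochner_Integration.integral_cong) (auto simp: indicator_def)
    also have "\<dots> = Mx.prob (near t (1 / 2 ^ J) a)"
      using aC by (intro expectation_Mx) auto
    also have "\<dots> \<le> P.prob (near t (1 / 2 ^ J) a) + eps" using aC by (intro Mx_le) auto
    also have "P.prob (near t (1 / 2 ^ J) a) \<le> 2 * (1 / 2 ^ J)" by (rule measure_near[OF aC t]) simp
    finally show "(\<integral>x. (indicator (near t (1 / 2 ^ J) a) x :: real)\<^sup>2 \<partial>Mx) \<le> 2 / 2 ^ J + eps" by simp
  qed (use N_finite N_card prob_space_Mx meas in \<open>auto split: split_indicator\<close>)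
  also have "\<dots> \<le> fail_prob * (1 / 2) ^ J" using d by (intro exp_le_fail_prob) simp
  also have "\<dots> \<le> fail_prob" using fail_prob_pos by (simp add: mult_left_le power_le_one)
  finally show "measure PM (bad_near t) \<le> fail_prob" .
qed

lemma bad_bound:
  assumes c: "\<bar>c\<bar> = 1" and t: "0 \<le> t" "t \<le> 1"
  shows "bad c t \<in> sets PM" "measure PM (bad c t) \<le> 4 * fail_prob"
proof -
  let ?L = "\<Union>j<J. bad_link c t j"
  have L: "?L \<in> sets PM" using bad_link_bound[OF c t] by auto
  show "bad c t \<in> sets PM"
    unfolding bad_def using bad_base_bound[OF c] bad_near_bound[OF t] L by auto
  have "measure PM ?L \<le> (\<Sum>j<J. measure PM (bad_link c t j))"
    using bad_link_bound[OF c t] by (intro PM.finite_measure_subadditive_finite) auto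
  also have "\<dots> \<le> (\<Sum>j<J. fail_prob * (1 / 2) ^ j)" by (intro sum_mono bad_link_bound[OF c t]) simp
  also have "\<dots> \<le> 2 * fail_prob" by (rule sum_geometric_half)
  finally have l: "measure PM ?L \<le> 2 * fail_prob" .
  have "measure PM (bad c t) \<le> measure PM (bad_base c t \<union> ?L) + measure PM (bad_near t)"
    unfolding bad_def by (intro measure_Un_le sets.Un bad_base_bound[OF c] bad_near_bound[OF t] L)
  also have "measure PM (bad_base c t \<union> ?L) \<le> measure PM (bad_base c t) + measure PM ?L"
    by (intro measure_Un_le bad_base_bound[OF c] L)
  finally show "measure PM (bad c t) \<le> 4 * fail_prob"
    using l bad_base_bound[OF c, of t] bad_near_bound[OF t] by linarith
qed

section \<open>The labelled sample behind the observed one\<close>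

abbreviation "K \<equiv> contamination eps P Q"
abbreviation "PK \<equiv> PiM {..<n} (\<lambda>_. K)"

definition clean :: "bool \<times> 'x \<times> 'x \<Rightarrow> 'x" where "clean w = fst (snd w)"

lemma prob_space_K: "prob_space K"
  by (rule prob_space_contamination) (rule P Q)+

sublocale K: prob_space K by (rule prob_space_K)
sublocale PK: prob_space PK by (rule prob_space_PiM) (rule prob_space_K)

lemma space_Q: "space Q = space P" using sets_Q by (rule sets_eq_imp_space_eq)

lemma space_K: "space K = UNIV \<times> space P \<times> space P"
  by (simp add: contamination_def space_pair_measure space_Q)

lemma measurable_clean [measurable]: "clean \<in> measurable K P"
  unfolding clean_def contamination_def by measurable

lemma measurable_observed_K [measurable]: "observed \<in> measurable K P"
  by (rule measurable_observed[OF sets_Q])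

lemma distr_clean: "distr K P clean = P"
proof (rule measure_eqI)
  fix A assume "A \<in> sets (distr K P clean)"
  then have A: "A \<in> sets P" by simp
  then have "clean -` A \<inter> space K = UNIV \<times> A \<times> space Q"
    using sets.sets_into_space[OF A] by (auto simp: space_K clean_def space_Q)
  then have "emeasure (distr K P clean) A = emeasure K (UNIV \<times> A \<times> space Q)"
    using A by (simp add: emeasure_distr)
  also have "\<dots> = emeasure P A"
    using A by (subst emeasure_contamination_times[OF P Q eps]) (auto simp: Q.emeasure_space_1)
  finally show "emeasure (distr K P clean) A = emeasure P A" .
qed simp

lemma prob_label: "K.prob {w \<in> space K. fst w} = eps"
proof -
  have "{w \<in> space K. fst w} = {True} \<times> space P \<times> space Q"
    by (auto simp: space_K space_Q)
  moreover have "emeasure K ({True} \<times> space P \<times> space Q) = ennreal eps"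
    using eps by (subst emeasure_contamination_times[OF P Q eps])
      (auto simp: P.emeasure_space_1 Q.emeasure_space_1 emeasure_pmf_single)
  ultimately show ?thesis using eps by (simp add: measure_def)
qed

text \<open>\<open>compose\<close> restricts to {..<n}, so the result is extensional as the product
  space demands.\<close>

definition sample :: "(nat \<Rightarrow> bool \<times> 'x \<times> 'x) \<Rightarrow> nat \<Rightarrow> 'x" where
  "sample = compose {..<n} observed"

lemma measurable_sample [measurable]: "sample \<in> measurable PK PM"
proof -
  have "sets PM = sets (PiM {..<n} (\<lambda>_. P))" by (intro sets_PiM_cong) auto
  moreover have "sample \<in> measurable PK (PiM {..<n} (\<lambda>_. P))"
    unfolding sample_def compose_def by measurable
  ultimately show ?thesis by (simp cong: measurable_cong_sets)
qed

lemma distr_sample: "distr PK PM sample = PM"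
proof -
  have "distr PK PM sample = distr PK (PiM {..<n} (\<lambda>_. P)) (compose {..<n} observed)"
    by (intro distr_cong) (auto simp: sample_def intro!: sets_PiM_cong)
  also have "\<dots> = PiM {..<n} (\<lambda>_. distr K P observed)"
    by (rule distr_PiM_finite_prob_space') (auto intro: prob_space_K P)
  also have "\<dots> = PM"
    using mixture_eq_distr[OF P Q sets_Q eps] by simp
  finally show ?thesis .
qed

text \<open>The 4 undoes the scaling in E exp (Z^2 / 4) <= exp 1, the 1 is the logarithm of that
  bound, and the last term pays for the union over the links.\<close>

definition chi_level :: "nat \<Rightarrow> real" where "chi_level j = 4 * (1 + 80 * real (j + 1) * \<beta>)"

text \<open>All levels j occur, also those beyond J, because the chain from the last stochastic
  level down to u is infinite. Membership in \<open>D\<^sub>0\<close> makes that chain converge at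
  each sample point outside I.\<close>

definition quiet :: "nat set \<Rightarrow> (nat \<Rightarrow> 'x) set" where
  "quiet I = {\<omega> \<in> space PM. (\<forall>i\<in>{..<n} - I. \<omega> i \<in> D\<^sub>0) \<and>
    (\<forall>j. \<forall>ab\<in>links j. (\<Sum>i\<in>{..<n} - I. (g (fst ab) (\<omega> i) - g (snd ab) (\<omega> i))\<^sup>2)
      \<le> real n * chi_level j * (2 * (1 / 8) ^ j)\<^sup>2)}"

text \<open>The set I absorbs the contaminated points, whose covariates are arbitrary.\<close>

definition good :: "(nat \<Rightarrow> 'x) set" where
  "good = (\<Union>I\<in>{I. I \<subseteq> {..<n} \<and> real (card I) \<le> real n * (2 * eps + 80 * \<beta>)}. quiet I)"

lemma quiet_sets: "quiet I \<in> sets PM"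
proof -
  let ?h = "\<lambda>ab \<omega>. \<Sum>i\<in>{..<n} - I. (g (fst ab) (\<omega> i) - g (snd ab) (\<omega> i))\<^sup>2"
  have comp: "(\<lambda>\<omega>. \<omega> i) \<in> measurable PM Mx" if "i \<in> {..<n} - I" for i
    using that by (intro measurable_component_singleton) auto
  have 1: "{\<omega> \<in> space PM. \<omega> i \<in> D\<^sub>0} \<in> sets PM" if "i \<in> {..<n} - I" for i
    using measurable_sets[OF comp[OF that], of D\<^sub>0] D0(1)
    by (simp add: vimage_def Int_def conj_commute)
  have h: "?h ab \<in> borel_measurable PM" if ab: "ab \<in> links j" for j ab
  proof (intro borel_measurable_sum borel_measurable_power borel_measurable_diff)
    fix i assume i: "i \<in> {..<n} - I"
    have "fst ab \<in> C" "snd ab \<in> C" using links_sub[of "fst ab" "snd ab" j] ab by auto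
    then show "(\<lambda>\<omega>. g (fst ab) (\<omega> i)) \<in> borel_measurable PM" "(\<lambda>\<omega>. g (snd ab) (\<omega> i)) \<in> borel_measurable PM"
      by (auto intro!: measurable_compose[OF comp[OF i]] meas_Mx g_meas)
  qed
  have 2: "{\<omega> \<in> space PM. ?h ab \<omega> \<le> c} \<in> sets PM" if "ab \<in> links j" for j ab c
    using h[OF that] by (rule borel_measurable_le) simp
  show ?thesis unfolding quiet_def
    by (intro sets.sets_Collect_conj sets.sets_Collect_countable_All sets.sets_Collect_finite_All 1 2 finite_links) auto
qed

lemma good_sets: "good \<in> sets PM"
proof -
  have "finite {I. I \<subseteq> {..<n} \<and> real (card I) \<le> real n * (2 * eps + 80 * \<beta>)}"
    by (rule finite_subset[of _ "Pow {..<n}"]) auto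
  then show ?thesis unfolding good_def by (rule sets.finite_UN) (rule quiet_sets)
qed

definition bad_label :: "(nat \<Rightarrow> bool \<times> 'x \<times> 'x) set" where
  "bad_label = {w \<in> space PK. real n * ((\<integral>x. indicator {w \<in> space K. fst w} x \<partial>K) + 1 * eps + 80 * real (0 + 1) * \<beta> / 1)
    \<le> (\<Sum>i<n. indicator {w \<in> space K. fst w} (w i))}"

definition bad_chi :: "nat \<Rightarrow> 'u \<times> 'u \<Rightarrow> (nat \<Rightarrow> bool \<times> 'x \<times> 'x) set" where
  "bad_chi j ab = {w \<in> space PK. real n * (1 + 80 * real (j + 1) * \<beta>) \<le>
    (\<Sum>i<n. (g (fst ab) (clean (w i)) - g (snd ab) (clean (w i)))\<^sup>2 / (4 * (2 * (1 / 8) ^ j)\<^sup>2))}"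

definition bad_support :: "(nat \<Rightarrow> bool \<times> 'x \<times> 'x) set" where
  "bad_support = {w \<in> space PK. \<not> (\<forall>i<n. clean (w i) \<in> D\<^sub>0)}"

lemma labels_sets [measurable]: "{w \<in> space K. fst w} \<in> sets K"
  unfolding contamination_def by measurable

lemma bad_label_bound: "bad_label \<in> sets PK" "measure PK bad_label \<le> fail_prob"
proof -
  show "bad_label \<in> sets PK" unfolding bad_label_def by measurable
  have "measure PK bad_label \<le> exp (- (real n * (80 * real (0 + 1) * \<beta>)))"
    unfolding bad_label_def
  proof (rule bernstein_PiM[OF prob_space_K])
    have "(\<integral>x. (indicator {w \<in> space K. fst w} x :: real)\<^sup>2 \<partial>K) = (\<integral>x. indicator {w \<in> space K. fst w} x \<partial>K)"
      by (intro Bochner_Integration.integral_cong) (auto simp: indicator_def)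
    also have "\<dots> = eps" using prob_label by (simp add: Int_absorb2)
    finally show "(\<integral>x. (indicator {w \<in> space K. fst w} x :: real)\<^sup>2 \<partial>K) \<le> eps" by simp
  qed (auto simp: indicator_def)
  also have "\<dots> \<le> fail_prob * (1 / 2) ^ 0" using exp_le_fail_prob[of 0 0] d by simp
  finally show "measure PK bad_label \<le> fail_prob" by simp
qed

lemma bad_chi_bound:
  assumes ab: "ab \<in> links j"
  shows "bad_chi j ab \<in> sets PK" "measure PK (bad_chi j ab) \<le> exp (- (real n * (80 * real (j + 1) * \<beta>)))"
proof -
  define \<delta> :: real where "\<delta> = 2 * (1 / 8) ^ j"
  have C: "fst ab \<in> C" "snd ab \<in> C" "\<rho> (fst ab) (snd ab) \<le> \<delta>"
    using links_sub[of "fst ab" "snd ab" j] ab by (auto simp: \<delta>_def)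
  have \<delta>: "0 < \<delta>" by (simp add: \<delta>_def)
  note [measurable] = g_meas[OF C(1)] g_meas[OF C(2)]
  show "bad_chi j ab \<in> sets PK" unfolding bad_chi_def by measurable
  have "(\<integral>\<^sup>+w. exp ((g (fst ab) (clean w) - g (snd ab) (clean w))\<^sup>2 / (4 * \<delta>\<^sup>2)) \<partial>K)
      = (\<integral>\<^sup>+x. exp ((g (fst ab) x - g (snd ab) x)\<^sup>2 / (4 * \<delta>\<^sup>2)) \<partial>distr K P clean)"
    by (subst nn_integral_distr) auto
  also have "\<dots> = (\<integral>\<^sup>+h. exp (h\<^sup>2 / (4 * \<delta>\<^sup>2)) \<partial>distr P borel (\<lambda>x. g (fst ab) x - g (snd ab) x))"
    unfolding distr_clean by (subst nn_integral_distr) auto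
  also have "\<dots> = (\<integral>\<^sup>+z. exp ((\<rho> (fst ab) (snd ab) * z)\<^sup>2 / (4 * \<delta>\<^sup>2)) \<partial>std_gauss)"
    unfolding diff_law[OF C(1,2)] by (subst nn_integral_distr) auto
  also have "\<dots> \<le> (\<integral>\<^sup>+z. exp (z\<^sup>2 / 4) \<partial>std_gauss)"
  proof (intro nn_integral_mono ennreal_leI)
    fix z
    have "(\<rho> (fst ab) (snd ab))\<^sup>2 \<le> \<delta>\<^sup>2" using C \<rho>_nonneg by (intro power_mono) auto
    then have "(\<rho> (fst ab) (snd ab))\<^sup>2 * z\<^sup>2 \<le> \<delta>\<^sup>2 * z\<^sup>2" by (intro mult_right_mono) auto
    then show "exp ((\<rho> (fst ab) (snd ab) * z)\<^sup>2 / (4 * \<delta>\<^sup>2)) \<le> exp (z\<^sup>2 / 4)"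
      using \<delta> by (simp add: power_mult_distrib field_simps)
  qed
  also have "\<dots> \<le> ennreal (exp 1)" by (rule std_gauss_chi_square_mgf)
  finally have mgf: "(\<integral>\<^sup>+w. exp ((g (fst ab) (clean w) - g (snd ab) (clean w))\<^sup>2 / (4 * \<delta>\<^sup>2)) \<partial>K) \<le> ennreal (exp 1)" .
  have "measure PK (bad_chi j ab) \<le> exp (real n * 1 - real n * (1 + 80 * real (j + 1) * \<beta>))"
    unfolding bad_chi_def \<delta>_def[symmetric]
    by (rule chernoff_PiM[OF prob_space_K _ mgf]) measurable
  also have "\<dots> = exp (- (real n * (80 * real (j + 1) * \<beta>)))" by (simp add: algebra_simps)
  finally show "measure PK (bad_chi j ab) \<le> exp (- (real n * (80 * real (j + 1) * \<beta>)))" .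
qed

lemma bad_chi_links_bound:
  shows "(\<Union>ab\<in>links j. bad_chi j ab) \<in> sets PK" "measure PK (\<Union>ab\<in>links j. bad_chi j ab) \<le> fail_prob * (1 / 2) ^ j"
proof -
  show "(\<Union>ab\<in>links j. bad_chi j ab) \<in> sets PK"
    using finite_links bad_chi_bound by (intro sets.finite_UN) auto
  have "measure PK (\<Union>ab\<in>links j. bad_chi j ab) \<le> (\<Sum>ab\<in>links j. measure PK (bad_chi j ab))"
    using bad_chi_bound by (intro PK.finite_measure_subadditive_finite finite_links) auto
  also have "\<dots> \<le> (\<Sum>ab\<in>links j. exp (- (real n * (80 * real (j + 1) * \<beta>))))"
    by (intro sum_mono bad_chi_bound)
  also have "\<dots> = real (card (links j)) * exp (- (real n * (80 * real (j + 1) * \<beta>)))" by simp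
  also have "\<dots> \<le> exp (75 * d * real (j + 1)) * exp (- (real n * (80 * real (j + 1) * \<beta>)))"
    by (intro mult_right_mono card_links) auto
  also have "\<dots> = exp (75 * d * real (j + 1) - real n * (80 * real (j + 1) * \<beta>))"
    by (simp add: exp_add[symmetric])
  also have "\<dots> \<le> fail_prob * (1 / 2) ^ j" by (rule exp_le_fail_prob) simp
  finally show "measure PK (\<Union>ab\<in>links j. bad_chi j ab) \<le> fail_prob * (1 / 2) ^ j" .
qed

lemma bad_support_null: "bad_support \<in> sets PK" "measure PK bad_support = 0"
proof -
  note [measurable] = D0(1)
  show "bad_support \<in> sets PK" unfolding bad_support_def by measurable
  have "AE x in P. x \<in> D\<^sub>0" using D0 P.AE_in_set_eq_1 by simp
  then have "AE x in distr K P clean. x \<in> D\<^sub>0" by (simp only: distr_clean)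
  then have "AE w in K. clean w \<in> D\<^sub>0" by (subst (asm) AE_distr_iff) auto
  then have "AE w in PK. clean (w i) \<in> D\<^sub>0" if "i < n" for i
    using that by (intro AE_PiM_component[where P="\<lambda>w. clean w \<in> D\<^sub>0"] prob_space_K) auto
  then have "AE w in PK. \<forall>i\<in>{..<n}. clean (w i) \<in> D\<^sub>0"
    by (intro AE_finite_allI) auto
  then have "AE w in PK. w \<notin> bad_support"
    by eventually_elim (auto simp: bad_support_def)
  then show "measure PK bad_support = 0"
    using \<open>bad_support \<in> sets PK\<close> by (simp add: PK.prob_eq_0)
qed

text \<open>Take for I the indices with label true. Outside I the observed points are the clean
  draws, which are what the chi-square and support events speak about.\<close>

lemma sample_good:
  assumes w: "w \<in> space PK" and l: "w \<notin> bad_label" and s: "w \<notin> bad_support"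
    and chi: "\<And>j ab. ab \<in> links j \<Longrightarrow> w \<notin> bad_chi j ab"
  shows "sample w \<in> good"
proof -
  define I where "I = {i. i < n \<and> fst (w i)}"
  have wK: "w i \<in> space K" if "i < n" for i using w that by (auto simp: space_PiM)
  have "(\<Sum>i<n. indicator {w \<in> space K. fst w} (w i)) = (\<Sum>i<n. if fst (w i) then 1 else 0 :: real)"
    by (intro sum.cong refl) (use wK in \<open>auto simp: indicator_def\<close>)
  also have "\<dots> = real (card I)" by (simp add: sum.If_cases I_def lessThan_def Int_def)
  finally have sum_I: "(\<Sum>i<n. indicator {w \<in> space K. fst w} (w i)) = real (card I)" .
  have "(\<integral>x. indicator {w \<in> space K. fst w} x \<partial>K) = eps"
    using prob_label by (simp add: Int_absorb2)
  then have card: "real (card I) \<le> real n * (2 * eps + 80 * \<beta>)"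
    using l w by (simp add: bad_label_def sum_I)
  have eq: "sample w i = clean (w i)" if "i \<in> {..<n} - I" for i
    using that by (auto simp: sample_def compose_def I_def observed_def clean_def)
  have "sample w \<in> quiet I"
    unfolding quiet_def
  proof (intro CollectI conjI allI ballI)
    show "sample w \<in> space PM" using w measurable_space[OF measurable_sample] by blast
    fix i assume "i \<in> {..<n} - I"
    then show "sample w i \<in> D\<^sub>0" using s w by (simp add: eq bad_support_def)
  next
    fix j ab assume ab: "ab \<in> links j"
    define \<delta> :: real where "\<delta> = 2 * (1 / 8) ^ j"
    have \<delta>: "0 < \<delta>" by (simp add: \<delta>_def)
    define h where "h i = (g (fst ab) (clean (w i)) - g (snd ab) (clean (w i)))\<^sup>2" for i
    have "(\<Sum>i<n. h i / (4 * \<delta>\<^sup>2)) \<le> real n * (1 + 80 * real (j + 1) * \<beta>)"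
      using chi[OF ab] w by (simp add: bad_chi_def h_def \<delta>_def)
    then have "(\<Sum>i<n. h i) \<le> real n * chi_level j * \<delta>\<^sup>2"
      using \<delta> by (simp add: sum_divide_distrib[symmetric] chi_level_def field_simps)
    moreover have "(\<Sum>i\<in>{..<n} - I. h i) \<le> (\<Sum>i<n. h i)"
      by (intro sum_mono2) (auto simp: h_def)
    ultimately show "(\<Sum>i\<in>{..<n} - I. (g (fst ab) (sample w i) - g (snd ab) (sample w i))\<^sup>2)
        \<le> real n * chi_level j * (2 * (1 / 8) ^ j)\<^sup>2"
      by (simp add: eq h_def \<delta>_def)
  qed
  moreover have "I \<subseteq> {..<n}" by (auto simp: I_def)
  ultimately show ?thesis using card unfolding good_def by blast
qed

text \<open>Labels are not observable, so \<open>good\<close> only asserts that some I exists and is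
  an event of the observed sample. Its probability is computed on the labelled sample, whose image
  is the observed law: one \<open>fail_prob\<close> for the labels, two for all chi-square levels
  together.\<close>

lemma good_bound: "measure PM (space PM - good) \<le> 3 * fail_prob"
proof -
  define X where "X j = (\<Union>ab\<in>links j. bad_chi j ab)" for j
  have X: "range X \<subseteq> sets PK" using bad_chi_links_bound by (auto simp: X_def)
  have Xle: "measure PK (X j) \<le> fail_prob * (1 / 2) ^ j" for j unfolding X_def by (rule bad_chi_links_bound)
  have sm: "summable (\<lambda>j. fail_prob * (1 / 2) ^ j)" by (intro summable_mult summable_geometric) simp
  then have smX: "summable (\<lambda>j. measure PK (X j))"
    by (rule summable_comparison_test[rotated]) (auto simp: Xle)
  have "measure PK (\<Union>j. X j) \<le> (\<Sum>j. measure PK (X j))"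
    by (rule PK.finite_measure_subadditive_countably[OF X smX])
  also have "\<dots> \<le> (\<Sum>j. fail_prob * (1 / 2) ^ j)" by (rule suminf_le[OF Xle smX sm])
  also have "\<dots> = 2 * fail_prob" by (subst suminf_mult) (auto simp: suminf_geometric summable_geometric)
  finally have U: "measure PK (\<Union>j. X j) \<le> 2 * fail_prob" .
  have XU: "(\<Union>j. X j) \<in> sets PK" using X by auto
  have "measure PM (space PM - good) = measure (distr PK PM sample) (space PM - good)"
    by (simp add: distr_sample)
  also have "\<dots> = measure PK (sample -` (space PM - good) \<inter> space PK)"
    using good_sets by (intro measure_distr) auto
  also have "\<dots> \<le> measure PK (bad_label \<union> bad_support \<union> (\<Union>j. X j))"
  proof (rule PK.finite_measure_mono)
    show "sample -` (space PM - good) \<inter> space PK \<subseteq> bad_label \<union> bad_support \<union> (\<Union>j. X j)"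
      using sample_good by (auto simp: X_def)
  qed (use bad_label_bound bad_support_null XU in auto)
  also have "\<dots> \<le> measure PK (bad_label \<union> bad_support) + measure PK (\<Union>j. X j)"
    by (intro measure_Un_le sets.Un bad_label_bound bad_support_null XU)
  also have "measure PK (bad_label \<union> bad_support) \<le> measure PK bad_label + measure PK bad_support"
    by (intro measure_Un_le bad_label_bound bad_support_null)
  finally show ?thesis using U bad_label_bound bad_support_null by linarith
qed

section \<open>Deterministic chaining on the good event\<close>

lemma half_power_J: "1 / 2 ^ J \<le> 2 * sqrt \<beta>" "1 / 4 ^ J \<le> 4 * \<beta>"
proof -
  show 1: "1 / 2 ^ J \<le> 2 * sqrt \<beta>" using J(2) by (simp add: field_simps)
  have "(1 / 2 ^ J)\<^sup>2 \<le> (2 * sqrt \<beta>)\<^sup>2" by (intro power_mono 1) simp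
  moreover have "(2::real) ^ J * 2 ^ J = 4 ^ J" by (simp add: power_mult_distrib[symmetric])
  ultimately show "1 / 4 ^ J \<le> 4 * \<beta>"
    using \<beta>_pos by (simp add: power_mult_distrib power_divide power2_eq_square)
qed

text \<open>The contamination contributes eps * 2^j * sqrt \<beta>, a growing geometric series;
  stopping at J keeps its sum below eps. The other parts converge: 333 = 6 * 2 + 80 * 4 + 1.\<close>

lemma sum_increments:
  "(\<Sum>j<J. step j * (6 / 4 ^ j + eps) + 80 * real (j + 1) * \<beta> / step j) \<le> 333 * sqrt \<beta>"
proof -
  have eq: "step j * (6 / 4 ^ j + eps) + 80 * real (j + 1) * \<beta> / step j
      = sqrt \<beta> * (6 * (1 / 2 ^ j) + eps * 2 ^ j + 80 * (real (j + 1) / 2 ^ j))" for j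
  proof -
    have "\<beta> / step j = sqrt \<beta> / 2 ^ j"
      using sqrt_\<beta> by (simp add: step_def field_simps)
    moreover have "step j * (6 / 4 ^ j) = sqrt \<beta> * (6 * (1 / 2 ^ j))"
    proof -
      have "(4::real) ^ j = 2 ^ j * 2 ^ j" by (simp add: power_mult_distrib[symmetric])
      then show ?thesis by (simp add: step_def)
    qed
    moreover have "80 * real (j + 1) * \<beta> / step j = 80 * real (j + 1) * (\<beta> / step j)" by simp
    ultimately show ?thesis by (simp only: distrib_left) (simp add: step_def mult_ac)
  qed
  have s1: "(\<Sum>j<k. 1 / 2 ^ j :: real) = 2 - 2 / 2 ^ k" for k
    by (induction k) (auto simp: field_simps)
  have s2: "(\<Sum>j<k. 2 ^ j :: real) = 2 ^ k - 1" for k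
    by (induction k) auto
  have s3: "(\<Sum>j<k. real (j + 1) / 2 ^ j) = 4 - (2 * real k + 4) / 2 ^ k" for k
  proof (induction k)
    case (Suc k)
    have "(\<Sum>j<Suc k. real (j + 1) / 2 ^ j) = 4 - (2 * real k + 4) / 2 ^ k + real (k + 1) / 2 ^ k"
      using Suc by simp
    also have "\<dots> = 4 - (2 * real (Suc k) + 4) / 2 ^ Suc k" by (simp add: field_simps)
    finally show ?case .
  qed simp
  have "(\<Sum>j<J. step j * (6 / 4 ^ j + eps) + 80 * real (j + 1) * \<beta> / step j)
      = sqrt \<beta> * (6 * (\<Sum>j<J. 1 / 2 ^ j) + eps * (\<Sum>j<J. 2 ^ j) + 80 * (\<Sum>j<J. real (j + 1) / 2 ^ j))"
    unfolding eq by (simp add: sum_distrib_left sum.distrib distrib_left)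
  also have "\<dots> \<le> sqrt \<beta> * (6 * 2 + eps * 2 ^ J + 80 * 4)"
    unfolding s1 s2 s3 using eps sqrt_\<beta> by (intro mult_left_mono add_mono) auto
  also have "\<dots> = 332 * sqrt \<beta> + eps * (2 ^ J * sqrt \<beta>)" by (simp add: algebra_simps)
  also have "\<dots> \<le> 332 * sqrt \<beta> + sqrt \<beta>"
    using mult_left_le[OF J(1) eps(1)] eps_le by linarith
  finally show ?thesis by simp
qed

lemma expectation_scaled: "A \<in> sets P \<Longrightarrow> (\<integral>x. c * indicator A x \<partial>Mx) = c * Mx.prob A"
  using expectation_Mx[of A] by simp

text \<open>Telescoping from level 0 to level J, with 414 = 81 + 333. Centring is at the
  contaminated law, so Q may be arbitrary.\<close>

lemma chain_deviation:
  assumes c: "\<bar>c\<bar> = 1" and \<omega>: "\<omega> \<in> space PM" "\<omega> \<notin> bad c t"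
    and a: "\<And>j. a j \<in> N j" and link: "\<And>j. (a j, a (Suc j)) \<in> links j"
  shows "c * (cnt \<omega> (reg t (a J)) / n - Mx.prob (reg t (a J))) \<le> 414 * sqrt \<beta>"
proof -
  define D where "D j = c * (cnt \<omega> (reg t (a j)) / n - Mx.prob (reg t (a j)))" for j
  define e where "e j = step j * (6 / 4 ^ j + eps) + 80 * real (j + 1) * \<beta> / step j" for j
  have aC: "a j \<in> C" for j using a N_sub by auto
  have n0: "0 < real n" using n by simp
  have b: "\<omega> \<notin> bad_base c t" and l: "\<And>j. j < J \<Longrightarrow> \<omega> \<notin> bad_link c t j"
    using \<omega> by (auto simp: bad_def)
  have "c * cnt \<omega> (reg t (a 0)) < real n * (c * Mx.prob (reg t (a 0)) + sqrt \<beta> + 80 * (\<beta> / sqrt \<beta>))"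
    using b \<omega>(1) a[of 0] aC[of 0]
    by (auto simp: bad_base_def expectation_scaled cnt_def sum_distrib_left not_le)
  moreover have "\<beta> / sqrt \<beta> = sqrt \<beta>" using sqrt_\<beta> by (simp add: field_simps)
  ultimately have "c * cnt \<omega> (reg t (a 0)) < real n * (c * Mx.prob (reg t (a 0)) + 81 * sqrt \<beta>)"
    by (simp add: algebra_simps)
  then have "D 0 \<le> 81 * sqrt \<beta>"
    using n0 by (simp add: D_def field_simps)
  have *: "D (Suc j) \<le> D j + e j" if j: "j < J" for j
  proof -
    let ?F = "jump c t (a j, a (Suc j))"
    have "(\<integral>x. ?F x \<partial>Mx) = c * Mx.prob (reg t (a (Suc j))) - c * Mx.prob (reg t (a j))"
    proof -
      have int: "integrable Mx (\<lambda>x. indicator (reg t (a k)) x :: real)" for k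
        by (rule Mx.integrable_const_bound[of _ 1])
          (auto split: split_indicator intro!: meas_Mx borel_measurable_indicator reg_sets aC)
      have "(\<integral>x. ?F x \<partial>Mx) = c * ((\<integral>x. indicator (reg t (a (Suc j))) x \<partial>Mx) - (\<integral>x. indicator (reg t (a j)) x \<partial>Mx))"
        unfolding jump_def fst_conv snd_conv
        by (subst Bochner_Integration.integral_mult_right)
          (use int in \<open>auto intro!: Bochner_Integration.integrable_diff
            simp del: Bochner_Integration.integral_indicator simp: Bochner_Integration.integral_diff\<close>)
      then show ?thesis using aC by (simp only: expectation_Mx reg_sets right_diff_distrib)
    qed
    moreover have "(\<Sum>i<n. ?F (\<omega> i)) = c * cnt \<omega> (reg t (a (Suc j))) - c * cnt \<omega> (reg t (a j))"
      by (simp add: jump_def cnt_def sum_distrib_left sum_subtractf right_diff_distrib)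
    moreover have "(\<Sum>i<n. ?F (\<omega> i)) < real n * ((\<integral>x. ?F x \<partial>Mx) + e j)"
      using l[OF j] \<omega>(1) link[of j] by (auto simp: bad_link_def e_def add.assoc not_le)
    ultimately have "c * cnt \<omega> (reg t (a (Suc j))) - c * cnt \<omega> (reg t (a j))
        < real n * (c * Mx.prob (reg t (a (Suc j))) - c * Mx.prob (reg t (a j)) + e j)"
      by (simp only:)
    then have "(c * cnt \<omega> (reg t (a (Suc j))) - c * cnt \<omega> (reg t (a j))) / n
        < c * Mx.prob (reg t (a (Suc j))) - c * Mx.prob (reg t (a j)) + e j"
      using n0 by (simp only: pos_divide_less_eq mult.commute)
    then show ?thesis
      by (simp add: D_def right_diff_distrib diff_divide_distrib)
  qed
  have "D k \<le> D 0 + (\<Sum>j<k. e j)" if "k \<le> J" for k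
    using that
  proof (induction k)
    case (Suc k)
    have "D (Suc k) \<le> D k + e k" using Suc.prems by (intro *) simp
    moreover have "D k \<le> D 0 + (\<Sum>j<k. e j)" using Suc by simp
    ultimately show ?case by simp
  qed simp
  from this[of J] \<open>D 0 \<le> 81 * sqrt \<beta>\<close> sum_increments show ?thesis
    by (simp add: D_def e_def)
qed

text \<open>90 = 8 + 2 + 80. Mean and variance terms give 4 / 2^J + 2 eps, and (J + 1) \<beta> <=
  sqrt \<beta> because J + 1 <= 2^J <= 1 / sqrt \<beta>.\<close>

lemma near_count:
  assumes t: "0 \<le> t" "t \<le> 1" and \<omega>: "\<omega> \<in> space PM" "\<omega> \<notin> bad c t" and a: "a \<in> N J"
  shows "cnt \<omega> (near t (1 / 2 ^ J) a) \<le> real n * (90 * sqrt \<beta>)"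
proof -
  have aC: "a \<in> C" using a N_sub by auto
  have "cnt \<omega> (near t (1 / 2 ^ J) a) \<le> real n * (Mx.prob (near t (1 / 2 ^ J) a) + (2 / 2 ^ J + eps) + 80 * real (J + 1) * \<beta>)"
  proof -
    have "\<omega> \<notin> bad_near t" using \<omega> by (simp add: bad_def)
    then have "\<not> real n * ((\<integral>x. indicator (near t (1 / 2 ^ J) a) x \<partial>Mx) + 1 * (2 / 2 ^ J + eps)
        + 80 * real (J + 1) * \<beta> / 1) \<le> (\<Sum>i<n. indicator (near t (1 / 2 ^ J) a) (\<omega> i))"
      using \<omega>(1) a unfolding bad_near_def by blast
    then show ?thesis
      by (simp only: expectation_Mx[OF near_sets[OF aC]] cnt_def not_le mult_1 div_by_1 less_imp_le)
  qed
  also have "\<dots> \<le> real n * (90 * sqrt \<beta>)"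
  proof (intro mult_left_mono)
    have "Mx.prob (near t (1 / 2 ^ J) a) \<le> 2 * (1 / 2 ^ J) + eps"
      using Mx_le[OF near_sets[OF aC], of t "1 / 2 ^ J"] measure_near[OF aC t, of "1 / 2 ^ J"] by simp
    moreover have "80 * real (J + 1) * \<beta> \<le> 80 * sqrt \<beta>"
    proof -
      have "real (J + 1) \<le> 2 ^ J"
        using less_exp[of J] by (metis Suc_eq_plus1 Suc_leI of_nat_le_iff of_nat_numeral of_nat_power)
      then have "real (J + 1) * sqrt \<beta> \<le> 2 ^ J * sqrt \<beta>" using sqrt_\<beta> by (intro mult_right_mono) auto
      then have "real (J + 1) * sqrt \<beta> \<le> 1" using J(1) by linarith
      then have "real (J + 1) * sqrt \<beta> * sqrt \<beta> \<le> 1 * sqrt \<beta>" using sqrt_\<beta> by (intro mult_right_mono) auto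
      moreover have "80 * real (J + 1) * \<beta> = 80 * (real (J + 1) * sqrt \<beta> * sqrt \<beta>)"
        by (simp only: mult.assoc sqrt_\<beta>(3))
      ultimately show ?thesis by linarith
    qed
    ultimately show "Mx.prob (near t (1 / 2 ^ J) a) + (2 / 2 ^ J + eps) + 80 * real (J + 1) * \<beta> \<le> 90 * sqrt \<beta>"
      using half_power_J(1) eps_le by simp
  qed simp
  finally show ?thesis .
qed

text \<open>The growth of \<open>chi_level\<close>, at most 324 * 4^j, is beaten by the squared link
  length 4 / 64^j. A link thus has empirical norm at most 36 sqrt n / 4^j, and the geometric series
  from J on sums to 48 sqrt n / 4^J.\<close>

lemma residual_L2:
  assumes \<omega>: "\<omega> \<in> quiet I" and u: "u \<in> C" and a: "\<And>j. a j \<in> N j" "\<And>j. \<rho> u (a j) \<le> (1 / 8) ^ j"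
    and link: "\<And>j. (a j, a (Suc j)) \<in> links j"
  shows "L2_set (\<lambda>i. g u (\<omega> i) - g (a J) (\<omega> i)) ({..<n} - I) \<le> 48 * sqrt (real n) * (1 / 4) ^ J"
proof -
  let ?A = "{..<n} - I"
  have aC: "a j \<in> C" for j using a N_sub by auto
  have "\<forall>i\<in>?A. \<exists>M. \<forall>u\<in>C. \<forall>v\<in>C. \<bar>g u (\<omega> i) - g v (\<omega> i)\<bar> \<le> M * \<rho> u v"
    using \<omega> D0_lipschitz by (auto simp: quiet_def)
  from bchoice[OF this] obtain M where
    M: "\<forall>i\<in>?A. \<forall>u\<in>C. \<forall>v\<in>C. \<bar>g u (\<omega> i) - g v (\<omega> i)\<bar> \<le> M i * \<rho> u v" by blast
  have last: "L2_set (\<lambda>i. g u (\<omega> i) - g (a k) (\<omega> i)) ?A \<le> (\<Sum>i\<in>?A. \<bar>M i\<bar>) * (1 / 8) ^ k" for k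
  proof -
    have "L2_set (\<lambda>i. g u (\<omega> i) - g (a k) (\<omega> i)) ?A \<le> (\<Sum>i\<in>?A. \<bar>g u (\<omega> i) - g (a k) (\<omega> i)\<bar>)"
      by (rule L2_set_le_sum_abs)
    also have "\<dots> \<le> (\<Sum>i\<in>?A. \<bar>M i\<bar> * (1 / 8) ^ k)"
    proof (intro sum_mono)
      fix i assume i: "i \<in> ?A"
      have "\<bar>g u (\<omega> i) - g (a k) (\<omega> i)\<bar> \<le> M i * \<rho> u (a k)" using M i u aC by auto
      also have "\<dots> \<le> \<bar>M i\<bar> * \<rho> u (a k)" by (intro mult_right_mono \<rho>_nonneg) simp
      also have "\<dots> \<le> \<bar>M i\<bar> * (1 / 8) ^ k" by (intro mult_left_mono a) simp
      finally show "\<bar>g u (\<omega> i) - g (a k) (\<omega> i)\<bar> \<le> \<bar>M i\<bar> * (1 / 8) ^ k" .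
    qed
    finally show ?thesis by (simp add: sum_distrib_right)
  qed
  have one: "L2_set (\<lambda>i. g (a (Suc j)) (\<omega> i) - g (a j) (\<omega> i)) ?A \<le> 36 * sqrt (real n) * (1 / 4) ^ j" for j
    unfolding L2_set_def
  proof (rule real_le_lsqrt)
    have "(\<Sum>i\<in>?A. (g (a (Suc j)) (\<omega> i) - g (a j) (\<omega> i))\<^sup>2) \<le> real n * chi_level j * (2 * (1 / 8) ^ j)\<^sup>2"
    proof -
      have "\<forall>ab\<in>links j. (\<Sum>i\<in>?A. (g (fst ab) (\<omega> i) - g (snd ab) (\<omega> i))\<^sup>2) \<le> real n * chi_level j * (2 * (1 / 8) ^ j)\<^sup>2"
        using \<omega> by (simp add: quiet_def)
      from bspec[OF this link[of j]] show ?thesis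
        by (simp only: fst_conv snd_conv power2_commute[of "g (a (Suc j)) _"])
    qed
    also have "\<dots> \<le> real n * (324 * 4 ^ j) * (2 * (1 / 8) ^ j)\<^sup>2"
    proof (intro mult_right_mono mult_left_mono)
      have "real (j + 1) \<le> 2 ^ j"
        using less_exp[of j] by (metis Suc_eq_plus1 Suc_leI of_nat_le_iff of_nat_numeral of_nat_power)
      also have "\<dots> \<le> 4 ^ j" by (intro power_mono) auto
      finally have j4: "real (j + 1) \<le> 4 ^ j" .
      have "chi_level j \<le> 4 * (real (j + 1) + 80 * real (j + 1))"
        unfolding chi_level_def using \<beta>1 by (intro mult_left_mono add_mono mult_left_le) auto
      then show "chi_level j \<le> 324 * 4 ^ j" using j4 by simp
    qed auto
    also have "\<dots> = (36 * sqrt (real n) * (1 / 4) ^ j)\<^sup>2"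
    proof -
      have "(8::real) ^ j = 2 ^ j * 4 ^ j" "(4::real) ^ j = 2 ^ j * 2 ^ j"
        by (simp_all add: power_mult_distrib[symmetric])
      then show ?thesis by (simp add: power_mult_distrib power_one_over power2_eq_square field_simps)
    qed
    finally show "(\<Sum>i\<in>?A. (g (a (Suc j)) (\<omega> i) - g (a j) (\<omega> i))\<^sup>2) \<le> (36 * sqrt (real n) * (1 / 4) ^ j)\<^sup>2" .
  qed (auto intro: sum_nonneg)
  have chain: "L2_set (\<lambda>i. g (a (J + k)) (\<omega> i) - g (a J) (\<omega> i)) ?A \<le> 48 * sqrt (real n) * ((1 / 4) ^ J - (1 / 4) ^ (J + k))" for k
  proof (induction k)
    case 0
    then show ?case by (simp add: L2_set_def)
  next
    case (Suc k)
    have "L2_set (\<lambda>i. g (a (J + Suc k)) (\<omega> i) - g (a J) (\<omega> i)) ?A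
        = L2_set (\<lambda>i. (g (a (Suc (J + k))) (\<omega> i) - g (a (J + k)) (\<omega> i)) + (g (a (J + k)) (\<omega> i) - g (a J) (\<omega> i))) ?A"
      by simp
    also have "\<dots> \<le> L2_set (\<lambda>i. g (a (Suc (J + k))) (\<omega> i) - g (a (J + k)) (\<omega> i)) ?A
        + L2_set (\<lambda>i. g (a (J + k)) (\<omega> i) - g (a J) (\<omega> i)) ?A"
      by (rule L2_set_triangle_ineq)
    also have "\<dots> \<le> 36 * sqrt (real n) * (1 / 4) ^ (J + k) + 48 * sqrt (real n) * ((1 / 4) ^ J - (1 / 4) ^ (J + k))"
      by (intro add_mono one Suc.IH)
    also have "\<dots> = 48 * sqrt (real n) * ((1 / 4) ^ J - (1 / 4) ^ (J + Suc k))"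
      by (simp add: algebra_simps)
    finally show ?case .
  qed
  let ?S = "\<Sum>i\<in>?A. \<bar>M i\<bar>"
  have bound: "L2_set (\<lambda>i. g u (\<omega> i) - g (a J) (\<omega> i)) ?A \<le> 48 * sqrt (real n) * (1 / 4) ^ J + ?S * (1 / 8) ^ (J + k)" for k
  proof -
    have "L2_set (\<lambda>i. g u (\<omega> i) - g (a J) (\<omega> i)) ?A
        = L2_set (\<lambda>i. (g u (\<omega> i) - g (a (J + k)) (\<omega> i)) + (g (a (J + k)) (\<omega> i) - g (a J) (\<omega> i))) ?A"
      by simp
    also have "\<dots> \<le> L2_set (\<lambda>i. g u (\<omega> i) - g (a (J + k)) (\<omega> i)) ?A
        + L2_set (\<lambda>i. g (a (J + k)) (\<omega> i) - g (a J) (\<omega> i)) ?A"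
      by (rule L2_set_triangle_ineq)
    also have "\<dots> \<le> ?S * (1 / 8) ^ (J + k) + 48 * sqrt (real n) * ((1 / 4) ^ J - (1 / 4) ^ (J + k))"
      by (intro add_mono last chain)
    also have "\<dots> \<le> ?S * (1 / 8) ^ (J + k) + 48 * sqrt (real n) * (1 / 4) ^ J"
      by (intro add_left_mono mult_left_mono) auto
    finally show ?thesis by simp
  qed
  \<comment> \<open>The Lipschitz constants \<open>M\<close> depend on the sample without any bound.
    This is harmless: they only show that the chain reaches u in the limit.\<close>
  have "(\<lambda>k. 48 * sqrt (real n) * (1 / 4) ^ J + ?S * ((1 / 8) ^ J * (1 / 8) ^ k))
      \<longlonglongrightarrow> 48 * sqrt (real n) * (1 / 4) ^ J + ?S * ((1 / 8) ^ J * 0)"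
    by (intro tendsto_intros LIMSEQ_power_zero) auto
  then have lim: "(\<lambda>k. 48 * sqrt (real n) * (1 / 4) ^ J + ?S * ((1 / 8) ^ J * (1 / 8) ^ k))
      \<longlonglongrightarrow> 48 * sqrt (real n) * (1 / 4) ^ J" by simp
  show ?thesis
  proof (rule LIMSEQ_le_const[OF lim], intro exI allI impI)
    fix k show "L2_set (\<lambda>i. g u (\<omega> i) - g (a J) (\<omega> i)) ?A
      \<le> 48 * sqrt (real n) * (1 / 4) ^ J + ?S * ((1 / 8) ^ J * (1 / 8) ^ k)"
      using bound[of k] by (simp only: power_add)
  qed
qed

text \<open>Markov's inequality for the residual: squared norm 2304 n / 16^J against threshold 1 /
  4^J leaves 2304 n / 4^J points, and 4^(-J) <= 4 \<beta> <= 4 sqrt \<beta>.\<close>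

lemma far_count:
  assumes \<omega>: "\<omega> \<in> quiet I" and u: "u \<in> C" and a: "\<And>j. a j \<in> N j" "\<And>j. \<rho> u (a j) \<le> (1 / 8) ^ j"
    and link: "\<And>j. (a j, a (Suc j)) \<in> links j"
  shows "real (card {i \<in> {..<n} - I. 1 / 2 ^ J < \<bar>g u (\<omega> i) - g (a J) (\<omega> i)\<bar>}) \<le> real n * (9216 * sqrt \<beta>)"
proof -
  define h where "h i = g u (\<omega> i) - g (a J) (\<omega> i)" for i
  let ?B = "{i \<in> {..<n} - I. 1 / 2 ^ J < \<bar>h i\<bar>}"
  have "real (card ?B) * (1 / 2 ^ J)\<^sup>2 = (\<Sum>i\<in>?B. (1 / 2 ^ J)\<^sup>2)" by simp
  also have "\<dots> \<le> (\<Sum>i\<in>?B. (h i)\<^sup>2)"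
  proof (intro sum_mono)
    fix i assume "i \<in> ?B"
    then have "(1 / 2 ^ J)\<^sup>2 \<le> \<bar>h i\<bar>\<^sup>2" by (intro power_mono) auto
    then show "(1 / 2 ^ J)\<^sup>2 \<le> (h i)\<^sup>2" by simp
  qed
  also have "\<dots> \<le> (\<Sum>i\<in>{..<n} - I. (h i)\<^sup>2)" by (intro sum_mono2) auto
  also have "\<dots> = (L2_set h ({..<n} - I))\<^sup>2" by (simp add: L2_set_def sum_nonneg)
  also have "\<dots> \<le> (48 * sqrt (real n) * (1 / 4) ^ J)\<^sup>2"
    unfolding h_def by (intro power_mono residual_L2[OF \<omega> u a link]) (auto simp: L2_set_nonneg)
  also have "\<dots> = 2304 * real n * (1 / 4 ^ J) * (1 / 2 ^ J)\<^sup>2"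
  proof -
    have "(4::real) ^ J = 2 ^ J * 2 ^ J" by (simp add: power_mult_distrib[symmetric])
    then show ?thesis by (simp add: power_mult_distrib power_one_over power2_eq_square field_simps)
  qed
  finally have "real (card ?B) \<le> 2304 * real n * (1 / 4 ^ J)"
    by (rule mult_right_le_imp_le) simp
  also have "\<dots> \<le> 2304 * real n * (4 * sqrt \<beta>)"
    using half_power_J(2) sqrt_\<beta>(4) by (intro mult_left_mono) auto
  finally show ?thesis by (simp add: h_def mult_ac)
qed

text \<open>The indicators of u and of its net point at level J differ only at points that are near
  the boundary, in I, or far: 9388 = 90 + 82 + 9216. Adding 414 for the chain and 1 for passing from
  the mixture to P stays below 10000.\<close>

lemma uniform_deviation:
  assumes c: "\<bar>c\<bar> = 1" and t: "0 \<le> t" "t \<le> 1" and \<omega>: "\<omega> \<in> good" "\<omega> \<notin> bad c t" and u: "u \<in> C"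
  shows "c * (cnt \<omega> (reg t u) / n - P.prob (reg t u)) \<le> 10000 * sqrt \<beta>"
proof -
  have n0: "0 < real n" using n by simp
  obtain I where I: "I \<subseteq> {..<n}" "real (card I) \<le> real n * (2 * eps + 80 * \<beta>)" and q: "\<omega> \<in> quiet I"
    using \<omega> by (auto simp: good_def)
  have \<omega>s: "\<omega> \<in> space PM" using q by (simp add: quiet_def)
  then have \<omega>i: "\<omega> i \<in> space P" if "i < n" for i using that by (auto simp: space_PiM)
  have "\<forall>j. \<exists>a. a \<in> N j \<and> \<rho> u a \<le> (1 / 8) ^ j" using N_dense[OF u] by blast
  from choice[OF this] obtain a where a: "\<And>j. a j \<in> N j" "\<And>j. \<rho> u (a j) \<le> (1 / 8) ^ j" by blast
  have aC: "a j \<in> C" for j using a N_sub by auto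
  have link: "(a j, a (Suc j)) \<in> links j" for j
  proof -
    have "\<rho> (a j) (a (Suc j)) \<le> \<rho> u (a j) + \<rho> u (a (Suc j))"
      using \<rho>_triangle[of "a j" "a (Suc j)" u] \<rho>_sym[of "a j" u] by simp
    also have "\<dots> \<le> (1 / 8) ^ j + (1 / 8) ^ Suc j" by (intro add_mono a)
    also have "\<dots> \<le> 2 * (1 / 8) ^ j" by simp
    finally show ?thesis using a by (simp add: links_def)
  qed
  let ?r = "reg t u" and ?r' = "reg t (a J)" and ?s = "1 / 2 ^ J :: real"
  let ?B = "{i \<in> {..<n} - I. ?s < \<bar>g u (\<omega> i) - g (a J) (\<omega> i)\<bar>}"
  have "\<bar>cnt \<omega> ?r - cnt \<omega> ?r'\<bar> \<le> (\<Sum>i<n. \<bar>indicator ?r (\<omega> i) - indicator ?r' (\<omega> i)\<bar>)"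
    unfolding cnt_def sum_subtractf[symmetric] by (rule sum_abs)
  also have "\<dots> \<le> (\<Sum>i<n. indicator (near t ?s (a J)) (\<omega> i) + indicator I i + indicator ?B i)"
  proof (intro sum_mono)
    fix i assume i: "i \<in> {..<n}"
    show "\<bar>indicator ?r (\<omega> i) - indicator ?r' (\<omega> i)\<bar> \<le> (indicator (near t ?s (a J)) (\<omega> i) + indicator I i + indicator ?B i :: real)"
      using reg_change[of t ?s "\<omega> i" u "a J"] t \<omega>i[of i] i
      by (auto simp: indicator_def split: if_splits)
  qed
  also have "\<dots> = cnt \<omega> (near t ?s (a J)) + real (card I) + real (card ?B)"
  proof -
    have "(\<Sum>i<n. indicator I i :: real) = real (card I)"
      using I(1) by (simp add: indicator_def sum.If_cases Int_absorb1)
    moreover have "(\<Sum>i<n. indicator ?B i :: real) = real (card ?B)"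
      by (simp add: indicator_def sum.If_cases) (rule arg_cong[where f=card], auto)
    ultimately show ?thesis by (simp add: sum.distrib cnt_def)
  qed
  also have "\<dots> \<le> real n * (90 * sqrt \<beta>) + real n * (82 * sqrt \<beta>) + real n * (9216 * sqrt \<beta>)"
  proof (intro add_mono near_count[OF t \<omega>s \<omega>(2) a(1)] far_count[OF q u a link])
    have "2 * eps + 80 * \<beta> \<le> 82 * sqrt \<beta>" using eps_le sqrt_\<beta>(4) by linarith
    then show "real (card I) \<le> real n * (82 * sqrt \<beta>)"
      using I(2) by (meson mult_left_mono of_nat_0_le_iff order_trans)
  qed
  finally have cc: "\<bar>cnt \<omega> ?r - cnt \<omega> ?r'\<bar> \<le> real n * (9388 * sqrt \<beta>)" by simp
  have "\<bar>cnt \<omega> ?r / n - cnt \<omega> ?r' / n\<bar> = \<bar>cnt \<omega> ?r - cnt \<omega> ?r'\<bar> / n"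
    using n0 by (simp add: diff_divide_distrib[symmetric])
  also have "\<dots> \<le> 9388 * sqrt \<beta>"
    using cc n0 by (simp add: field_simps)
  finally have 1: "\<bar>cnt \<omega> ?r / n - cnt \<omega> ?r' / n\<bar> \<le> 9388 * sqrt \<beta>" .
  \<comment> \<open>Replacing u by its net point costs nothing in the population: by normalization
    the clean probability of the region depends on t only.\<close>
  have 2: "\<bar>P.prob ?r' - P.prob ?r\<bar> \<le> 0"
    using measure_reg[OF u, of t] measure_reg[OF aC, of t] by simp
  have 3: "\<bar>Mx.prob ?r' - P.prob ?r'\<bar> \<le> eps"
    by (rule measure_mixture_bounds[OF P Q sets_Q eps reg_sets[OF aC]])
  have 4: "c * (cnt \<omega> ?r' / n - Mx.prob ?r') \<le> 414 * sqrt \<beta>"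
    by (rule chain_deviation[OF c \<omega>s \<omega>(2) a(1) link])
  have "c = 1 \<or> c = - 1" using c by (auto simp: abs_if split: if_splits)
  then show ?thesis using 1 2 3 4 eps_le by (elim disjE) (simp_all add: abs_le_iff)
qed

text \<open>The truth needs a lower bound at tilt 0, the competitor an upper bound at one positive
  tilt; hence two signed bad events, which with \<open>good\<close> cost 11
  \<open>fail_prob\<close>. The clause on I is passed on for the directions that cannot be
  normalized.\<close>

theorem uniform_depth_event:
  assumes t: "0 \<le> t" "t \<le> 1"
  shows "\<exists>E\<in>sets PM. 1 - exp (- (real n * \<beta>)) \<le> measure PM E \<and> (\<forall>\<omega>\<in>E.
    (\<exists>I\<subseteq>{..<n}. real (card I) \<le> real n * (82 * sqrt \<beta>) \<and> (\<forall>i\<in>{..<n} - I. \<omega> i \<in> D\<^sub>0)) \<and>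
    (\<forall>u\<in>C. 1 / 2 - 10000 * sqrt \<beta> \<le> cnt \<omega> (reg 0 u) / n \<and>
      cnt \<omega> (reg t u) / n \<le> 1 / 2 - t / 729 + 10000 * sqrt \<beta>))"
proof (intro bexI conjI ballI)
  let ?B = "bad (- 1) 0 \<union> bad 1 t"
  let ?E = "good - ?B"
  have B: "?B \<in> sets PM" using bad_bound[of "- 1" 0] bad_bound[of 1 t] t by auto
  then show E: "?E \<in> sets PM" using good_sets by auto
  have "measure PM ?B \<le> measure PM (bad (- 1) 0) + measure PM (bad 1 t)"
    using bad_bound[of "- 1" 0] bad_bound[of 1 t] t by (intro measure_Un_le) auto
  then have B8: "measure PM ?B \<le> 8 * fail_prob" using bad_bound[of "- 1" 0] bad_bound[of 1 t] t by simp
  have "measure PM (space PM - ?E) \<le> measure PM ((space PM - good) \<union> ?B)"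
    using B good_sets by (intro PM.finite_measure_mono) auto
  also have "\<dots> \<le> measure PM (space PM - good) + measure PM ?B"
    using B good_sets by (intro measure_Un_le) auto
  also have "\<dots> \<le> 11 * fail_prob" using good_bound B8 by simp
  also have "\<dots> \<le> exp (- (real n * \<beta>))" using fail_prob_le(2) fail_prob_pos by simp
  finally show "1 - exp (- (real n * \<beta>)) \<le> measure PM ?E"
    using PM.prob_compl[OF E] by simp
  fix \<omega> assume \<omega>: "\<omega> \<in> ?E"
  have "2 * eps + 80 * \<beta> \<le> 82 * sqrt \<beta>" using eps_le sqrt_\<beta>(4) by linarith
  then have le: "real n * (2 * eps + 80 * \<beta>) \<le> real n * (82 * sqrt \<beta>)" by (intro mult_left_mono) auto
  show "\<exists>I\<subseteq>{..<n}. real (card I) \<le> real n * (82 * sqrt \<beta>) \<and> (\<forall>i\<in>{..<n} - I. \<omega> i \<in> D\<^sub>0)"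
  proof -
    obtain I where "I \<subseteq> {..<n}" "real (card I) \<le> real n * (2 * eps + 80 * \<beta>)" "\<omega> \<in> quiet I"
      using \<omega> by (auto simp: good_def)
    then show ?thesis using le by (intro exI[of _ I]) (auto simp: quiet_def)
  qed
  fix u assume u: "u \<in> C"
  show "1 / 2 - 10000 * sqrt \<beta> \<le> cnt \<omega> (reg 0 u) / n"
    using uniform_deviation[of "- 1" 0 \<omega> u] \<omega> u measure_reg[OF u, of 0] std_gauss2_depth_region_0 by simp
  show "cnt \<omega> (reg t u) / n \<le> 1 / 2 - t / 729 + 10000 * sqrt \<beta>"
    using uniform_deviation[of 1 t \<omega> u] \<omega> u t measure_reg[OF u, of t] std_gauss2_depth_region_le[OF t] by simp
qed

end

section \<open>The matrix regression model\<close>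

text \<open>Scale zero must be included, since different matrices may agree after whitening when S
  is singular. The law is then a point mass, which the normal density does not cover.\<close>

lemma distr_linear_form_std_gauss_vec_scaled:
  "distr (std_gauss_vec d) borel (\<lambda>z. \<Sum>k<d. w k * z k) = distr std_gauss borel (\<lambda>x. L2_set w {..<d} * x)"
proof -
  let ?P = "std_gauss_vec d"
  interpret PP: prob_space ?P unfolding std_gauss_vec_def by (rule prob_space_PiM) (rule prob_space_std_gauss)
  have comp: "(\<lambda>z. z k) \<in> borel_measurable ?P" if "k < d" for k
  proof -
    have "(\<lambda>z. z k) \<in> measurable ?P std_gauss"
      unfolding std_gauss_vec_def using that by (intro measurable_component_singleton) auto
    then show ?thesis by simp
  qed
  define s where "s = L2_set w {..<d}"
  show ?thesis unfolding s_def[symmetric]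
  proof (cases "s = 0")
    case True
    then have w0: "w k = 0" if "k < d" for k
      using that L2_set_eq_0_iff[of "{..<d}" w] by (simp add: s_def)
    have "distr ?P borel (\<lambda>z. \<Sum>k<d. w k * z k) = distr ?P borel (\<lambda>_. 0)" using w0 by (intro distr_cong) auto
    also have "\<dots> = distr std_gauss borel (\<lambda>_. 0)"
    proof (rule measure_eqI)
      fix A assume "A \<in> sets (distr ?P borel (\<lambda>_. 0 :: real))"
      then have A: "A \<in> sets borel" by simp
      show "emeasure (distr ?P borel (\<lambda>_. 0)) A = emeasure (distr std_gauss borel (\<lambda>_. 0)) A"
        using A PP.emeasure_space_1 gauss.emeasure_space_1
        by (cases "0 \<in> A") (simp_all add: emeasure_distr vimage_def)
    qed simp
    finally show "distr ?P borel (\<lambda>z. \<Sum>k<d. w k * z k) = distr std_gauss borel (\<lambda>x. s * x)"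
      using True by simp
  next
    case False
    have s2: "(\<Sum>k<d. (w k)\<^sup>2) = s\<^sup>2" by (simp add: s_def L2_set_def sum_nonneg)
    have "(\<Sum>k<d. (w k / s)\<^sup>2) = 1"
      using False s2 by (simp add: power_divide sum_divide_distrib[symmetric])
    from distr_linear_form_std_gauss_vec[OF this]
    have "distr std_gauss borel (\<lambda>x. s * x) = distr (distr ?P borel (\<lambda>z. \<Sum>k<d. w k / s * z k)) borel (\<lambda>x. s * x)"
      by (simp only:)
    also have "\<dots> = distr ?P borel (\<lambda>z. s * (\<Sum>k<d. w k / s * z k))"
      by (subst distr_distr) (use comp in \<open>auto simp: comp_def\<close>)
    also have "\<dots> = distr ?P borel (\<lambda>z. \<Sum>k<d. w k * z k)"
      using False by (intro distr_cong) (auto simp: sum_distrib_left)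
    finally show "distr ?P borel (\<lambda>z. \<Sum>k<d. w k * z k) = distr std_gauss borel (\<lambda>x. s * x)" by simp
  qed
qed

lemma sum_column_major:
  fixes f :: "nat \<Rightarrow> nat \<Rightarrow> real"
  shows "(\<Sum>k<p1 * p2. f (k mod p1) (k div p1)) = (\<Sum>i<p1. \<Sum>j<p2. f i j)"
proof (cases "p1 = 0")
  case False
  have "(\<Sum>k<p1 * p2. f (k mod p1) (k div p1)) = (\<Sum>(i, j)\<in>{..<p1} \<times> {..<p2}. f i j)"
  proof (rule sum.reindex_bij_witness[of _ "\<lambda>(i, j). i + j * p1" "\<lambda>k. (k mod p1, k div p1)"])
    fix k assume "k \<in> {..<p1 * p2}"
    then show "(k mod p1, k div p1) \<in> {..<p1} \<times> {..<p2}"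
      using False by (auto simp: less_mult_imp_div_less mult.commute)
  next
    fix ij assume "ij \<in> {..<p1} \<times> {..<p2}"
    then obtain i j where ij: "ij = (i, j)" "i < p1" "j < p2" by auto
    have "i + j * p1 < p1 + j * p1" using ij by simp
    also have "\<dots> = Suc j * p1" by simp
    also have "\<dots> \<le> p2 * p1" using ij by (intro mult_right_mono) auto
    finally show "(case ij of (i, j) \<Rightarrow> i + j * p1) \<in> {..<p1 * p2}" using ij by (simp add: mult.commute)
  qed auto
  then show ?thesis by (simp add: sum.cartesian_product)
qed simp

lemma mult_mat_vec_index:
  fixes A :: "real mat"
  shows "A \<in> carrier_mat n n \<Longrightarrow> k < n \<Longrightarrow> (A *\<^sub>v vec n x) $ k = (\<Sum>l<n. A $$ (k, l) * x l)"
  by (simp add: scalar_prod_def atLeast0LessThan)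

locale matrix_regression =
  fixes p1 p2 r :: nat and sig :: real and S B :: "real mat"
  assumes p: "1 \<le> p1" "1 \<le> p2" "1 \<le> r" and sig: "0 < sig"
    and S: "covariance_matrix (p1 * p2) S" and B: "B \<in> carrier_mat p1 p2"
begin

abbreviation "R \<equiv> psd_sqrt S"
abbreviation "dd \<equiv> p1 * p2"
abbreviation "P \<equiv> model p1 p2 S sig B"

definition whiten :: "real mat \<Rightarrow> nat \<Rightarrow> real" where
  "whiten U k = (R *\<^sub>v vec_of_mat p1 p2 U) $ k"

definition pairing :: "real mat \<Rightarrow> (nat \<times> nat \<Rightarrow> real) \<Rightarrow> real" where
  "pairing U X = (\<Sum>i<p1. \<Sum>j<p2. U $$ (i, j) * X (i, j))"

definition vec_data :: "(nat \<times> nat \<Rightarrow> real) \<Rightarrow> real vec" where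
  "vec_data X = vec dd (\<lambda>k. X (k mod p1, k div p1))"

definition g :: "real mat \<Rightarrow> (nat \<times> nat \<Rightarrow> real) \<times> real \<Rightarrow> real" where
  "g U w = pairing U (fst w)"

definition \<xi> :: "(nat \<times> nat \<Rightarrow> real) \<times> real \<Rightarrow> real" where
  "\<xi> w = (snd w - pairing B (fst w)) / sig"

definition \<rho> :: "real mat \<Rightarrow> real mat \<Rightarrow> real" where
  "\<rho> U V = L2_set (\<lambda>k. whiten U k - whiten V k) {..<dd}"

text \<open>Directions of whitened length 0 have no multiple in this set;
  \<open>estimation_event\<close> treats them apart.\<close>

definition C :: "real mat set" where
  "C = {U \<in> low_rank_set p1 p2 (2 * r). (\<Sum>k<dd. (whiten U k)\<^sup>2) = 1}"

lemma C_carrier: "U \<in> C \<Longrightarrow> U \<in> carrier_mat p1 p2"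
  by (simp add: C_def low_rank_set_def)

lemma R: "R \<in> carrier_mat dd dd" "R\<^sup>T = R"
  using psd_sqrt_symmetric[OF S] by auto

lemma vec_of_mat_carrier [simp]: "vec_of_mat p1 p2 U \<in> carrier_vec dd"
  by (simp add: vec_of_mat_def)

lemma vec_data_carrier [simp]: "vec_data X \<in> carrier_vec dd"
  by (simp add: vec_data_def)

lemma whiten_norm: "(R *\<^sub>v vec_of_mat p1 p2 U) \<bullet> (R *\<^sub>v vec_of_mat p1 p2 U) = (\<Sum>k<dd. (whiten U k)\<^sup>2)"
  using R by (simp add: whiten_def scalar_prod_def atLeast0LessThan power2_eq_square)

lemma mat_inner_to_mat: "U \<in> carrier_mat p1 p2 \<Longrightarrow> mat_inner U (to_mat p1 p2 X) = pairing U X"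
  by (simp add: mat_inner_def mtrace_def to_mat_def pairing_def scalar_prod_def atLeast0LessThan)

lemma mtrace_to_mat: "mtrace ((to_mat p1 p2 X)\<^sup>T * B) = pairing B X"
  using B unfolding pairing_def
  by (subst sum.swap) (simp add: mtrace_def to_mat_def scalar_prod_def atLeast0LessThan mult.commute)

lemma pairing_vec: "pairing U X = vec_of_mat p1 p2 U \<bullet> vec_data X"
  using sum_column_major[of "\<lambda>i j. U $$ (i, j) * X (i, j)" p1 p2]
  by (simp add: pairing_def vec_of_mat_def vec_data_def scalar_prod_def atLeast0LessThan)

lemma vec_data_unvec:
  assumes x: "x \<in> carrier_vec dd"
  shows "vec_data (unvec p1 p2 x) = x"
proof (rule eq_vecI)
  fix k assume "k < dim_vec x"
  then have k: "k < dd" using x by simp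
  then have "k mod p1 < p1" "k div p1 < p2"
    using p by (auto simp: less_mult_imp_div_less mult.commute)
  moreover have "k mod p1 + k div p1 * p1 = k" by simp
  ultimately show "vec_data (unvec p1 p2 x) $ k = x $ k"
    using k by (simp add: vec_data_def unvec_def)
qed (use x in \<open>simp add: vec_data_def\<close>)

lemma symmetric_move:
  assumes "x \<in> carrier_vec dd" "y \<in> carrier_vec dd"
  shows "x \<bullet> (R *\<^sub>v y) = (R *\<^sub>v x) \<bullet> y"
  using transpose_vec_mult_scalar[OF R(1) assms(2,1)] R(2) by simp

text \<open>Symmetry of R moves the root from the covariate to the direction. A clean covariate
  therefore sees only the whitened direction, which makes \<rho> the right metric.\<close>

lemma pairing_clean:
  "pairing U (unvec p1 p2 (R *\<^sub>v vec dd z)) = (\<Sum>k<dd. whiten U k * z k)"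
proof -
  have Rz: "R *\<^sub>v vec dd z \<in> carrier_vec dd" using R(1) by (intro mult_mat_vec_carrier[of _ dd dd]) auto
  have "pairing U (unvec p1 p2 (R *\<^sub>v vec dd z)) = vec_of_mat p1 p2 U \<bullet> (R *\<^sub>v vec dd z)"
    by (simp add: pairing_vec vec_data_unvec[OF Rz])
  also have "\<dots> = (R *\<^sub>v vec_of_mat p1 p2 U) \<bullet> vec dd z"
    by (rule symmetric_move) auto
  also have "\<dots> = (\<Sum>k<dd. whiten U k * z k)"
    by (simp add: scalar_prod_def whiten_def atLeast0LessThan)
  finally show ?thesis .
qed

section \<open>The model as an image of Gaussian noise\<close>

abbreviation "noise \<equiv> std_gauss_vec dd \<Otimes>\<^sub>M std_gauss"

definition generate :: "(nat \<Rightarrow> real) \<times> real \<Rightarrow> (nat \<times> nat \<Rightarrow> real) \<times> real" where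
  "generate = (\<lambda>(z, e). (unvec p1 p2 (R *\<^sub>v vec dd z), pairing B (unvec p1 p2 (R *\<^sub>v vec dd z)) + sig * e))"

lemma model_eq: "P = distr noise (data_space p1 p2) generate"
  unfolding model_def generate_def by (simp add: mtrace_to_mat Let_def)

lemma prob_space_std_gauss_vec: "prob_space (std_gauss_vec dd)"
  unfolding std_gauss_vec_def by (rule prob_space_PiM) (rule prob_space_std_gauss)

lemma prob_space_noise: "prob_space noise"
  by (intro prob_space_pair prob_space_std_gauss_vec prob_space_std_gauss)

lemma component_measurable:
  assumes "k < dd"
  shows "(\<lambda>w. fst w k) \<in> borel_measurable noise"
proof -
  have "(\<lambda>z. z k) \<in> measurable (std_gauss_vec dd) std_gauss"
    unfolding std_gauss_vec_def using assms by (intro measurable_component_singleton) auto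
  then have "(\<lambda>z. z k) \<in> borel_measurable (std_gauss_vec dd)" by simp
  then show ?thesis by (rule measurable_compose[OF measurable_fst])
qed

lemma linear_form_measurable: "(\<lambda>w. \<Sum>k<dd. c k * fst w k) \<in> borel_measurable noise"
  by (intro borel_measurable_sum borel_measurable_times borel_measurable_const component_measurable) auto

lemma generate_measurable: "generate \<in> measurable noise (data_space p1 p2)"
proof -
  have 1: "(\<lambda>w. unvec p1 p2 (R *\<^sub>v vec dd (fst w))) \<in> measurable noise (PiM ({..<p1} \<times> {..<p2}) (\<lambda>_. borel))"
    unfolding unvec_def
  proof (rule measurable_restrict)
    fix ij assume "ij \<in> {..<p1} \<times> {..<p2}"
    then obtain i j where ij: "ij = (i, j)" "i < p1" "j < p2" by auto
    have "i + j * p1 < p1 + j * p1" using ij by simp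
    also have "\<dots> = Suc j * p1" by simp
    also have "\<dots> \<le> p2 * p1" using ij by (intro mult_right_mono) auto
    finally have k: "i + j * p1 < dd" by (simp add: mult.commute)
    have eq: "(\<lambda>w. (R *\<^sub>v vec dd (fst w)) $ (i + j * p1)) = (\<lambda>w. \<Sum>k<dd. R $$ (i + j * p1, k) * fst w k)"
      using k R(1) by (auto simp: scalar_prod_def atLeast0LessThan)
    show "(\<lambda>w. case ij of (i, j) \<Rightarrow> (R *\<^sub>v vec dd (fst w)) $ (i + j * p1)) \<in> borel_measurable noise"
      unfolding ij prod.case eq by (rule linear_form_measurable)
  qed
  have 2: "(\<lambda>w. pairing B (unvec p1 p2 (R *\<^sub>v vec dd (fst w))) + sig * snd w) \<in> borel_measurable noise"
    unfolding pairing_clean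
    by (intro borel_measurable_add linear_form_measurable borel_measurable_times borel_measurable_const)
      (simp add: measurable_snd[of "std_gauss_vec dd" std_gauss, simplified])
  show ?thesis
    unfolding generate_def data_space_def case_prod_beta by (rule measurable_Pair[OF 1 2])
qed

lemma sets_model: "sets P = sets (data_space p1 p2)" "space P = space (data_space p1 p2)"
  by (simp_all add: model_eq)

lemma prob_space_model: "prob_space P"
  unfolding model_eq by (rule prob_space.prob_space_distr[OF prob_space_noise generate_measurable])

lemma pairing_measurable: "(\<lambda>w. pairing U (fst w)) \<in> borel_measurable (data_space p1 p2)"
proof -
  have "(\<lambda>X. X (i, j)) \<in> borel_measurable (PiM ({..<p1} \<times> {..<p2}) (\<lambda>_. borel :: real measure))"
    if "i < p1" "j < p2" for i j using that by (intro measurable_component_singleton) auto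
  then have "(\<lambda>X. pairing U X) \<in> borel_measurable (PiM ({..<p1} \<times> {..<p2}) (\<lambda>_. borel))"
    unfolding pairing_def by (intro borel_measurable_sum borel_measurable_times borel_measurable_const) auto
  then show ?thesis unfolding data_space_def by (rule measurable_compose[OF measurable_fst])
qed

lemma snd_measurable: "snd \<in> borel_measurable (data_space p1 p2)"
  unfolding data_space_def by simp

lemma g_measurable: "g U \<in> borel_measurable P"
  unfolding g_def measurable_cong_sets[OF sets_model(1) refl] by (rule pairing_measurable)

lemma \<xi>_measurable: "\<xi> \<in> borel_measurable P"
  unfolding \<xi>_def[abs_def] measurable_cong_sets[OF sets_model(1) refl]
  by (intro borel_measurable_divide borel_measurable_diff snd_measurable pairing_measurable borel_measurable_const)

lemma g_generate: "g U (generate w) = (\<Sum>k<dd. whiten U k * fst w k)"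
  by (simp add: g_def generate_def case_prod_beta pairing_clean)

lemma \<xi>_generate: "\<xi> (generate w) = snd w"
  using sig by (simp add: \<xi>_def generate_def case_prod_beta)

lemma model_pair_law:
  assumes U: "U \<in> C"
  shows "distr P (borel \<Otimes>\<^sub>M borel) (\<lambda>w. (g U w, \<xi> w)) = std_gauss \<Otimes>\<^sub>M std_gauss"
proof -
  have m: "(\<lambda>w. (g U w, \<xi> w)) \<in> measurable P (borel \<Otimes>\<^sub>M borel)"
    by (intro measurable_Pair g_measurable \<xi>_measurable)
  have "distr P (borel \<Otimes>\<^sub>M borel) (\<lambda>w. (g U w, \<xi> w))
      = distr noise (borel \<Otimes>\<^sub>M borel) (\<lambda>w. (\<Sum>k<dd. whiten U k * fst w k, snd w))"
    using m unfolding model_eq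
    by (subst distr_distr) (auto simp: comp_def g_generate \<xi>_generate generate_measurable)
  also have "\<dots> = distr (std_gauss_vec dd) borel (\<lambda>z. \<Sum>k<dd. whiten U k * z k) \<Otimes>\<^sub>M distr std_gauss borel (\<lambda>x. x)"
  proof (subst pair_measure_distr)
    show "(\<lambda>z. \<Sum>k<dd. whiten U k * z k) \<in> borel_measurable (std_gauss_vec dd)"
    proof (intro borel_measurable_sum borel_measurable_times borel_measurable_const)
      fix k assume "k \<in> {..<dd}"
      then have "(\<lambda>z. z k) \<in> measurable (std_gauss_vec dd) std_gauss"
        unfolding std_gauss_vec_def by (intro measurable_component_singleton) auto
      then show "(\<lambda>z. z k) \<in> borel_measurable (std_gauss_vec dd)" by simp
    qed
    show "sigma_finite_measure (distr std_gauss borel (\<lambda>x. x))"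
      by (intro prob_space_imp_sigma_finite gauss.prob_space_distr) simp
  qed (auto simp: case_prod_beta')
  also have "distr (std_gauss_vec dd) borel (\<lambda>z. \<Sum>k<dd. whiten U k * z k) = std_gauss"
    using U by (intro distr_linear_form_std_gauss_vec) (simp add: C_def)
  also have "distr std_gauss borel (\<lambda>x. x) = std_gauss" by (rule distr_id2) simp
  finally show ?thesis .
qed

lemma model_diff_law:
  "distr P borel (\<lambda>w. g U w - g V w) = distr std_gauss borel (\<lambda>x. \<rho> U V * x)"
proof -
  have m: "(\<lambda>w. g U w - g V w) \<in> borel_measurable P"
    by (intro borel_measurable_diff g_measurable)
  have "distr P borel (\<lambda>w. g U w - g V w) = distr noise borel (\<lambda>w. \<Sum>k<dd. (whiten U k - whiten V k) * fst w k)"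
    using m unfolding model_eq
    by (subst distr_distr) (auto simp: comp_def g_generate generate_measurable left_diff_distrib sum_subtractf)
  also have "\<dots> = distr (distr noise (std_gauss_vec dd) fst) borel (\<lambda>z. \<Sum>k<dd. (whiten U k - whiten V k) * z k)"
  proof (subst distr_distr)
    show "(\<lambda>z. \<Sum>k<dd. (whiten U k - whiten V k) * z k) \<in> borel_measurable (std_gauss_vec dd)"
    proof (intro borel_measurable_sum borel_measurable_times borel_measurable_const)
      fix k assume "k \<in> {..<dd}"
      then have "(\<lambda>z. z k) \<in> measurable (std_gauss_vec dd) std_gauss"
        unfolding std_gauss_vec_def by (intro measurable_component_singleton) auto
      then show "(\<lambda>z. z k) \<in> borel_measurable (std_gauss_vec dd)" by simp
    qed
  qed (auto simp: comp_def)
  also have "distr noise (std_gauss_vec dd) fst = std_gauss_vec dd"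
    by (rule prob_space.distr_pair_fst[OF prob_space_std_gauss])
  also have "distr (std_gauss_vec dd) borel (\<lambda>z. \<Sum>k<dd. (whiten U k - whiten V k) * z k) = distr std_gauss borel (\<lambda>x. \<rho> U V * x)"
    unfolding \<rho>_def by (rule distr_linear_form_std_gauss_vec_scaled)
  finally show ?thesis .
qed

text \<open>The parameter vector t consists of 2 r blocks of length p1 + p2, each a left factor
  followed by a right factor. The value is whitened coordinate e of the sum of their outer products,
  with column-major indexing.\<close>

definition quad :: "nat \<Rightarrow> (nat \<Rightarrow> real) \<Rightarrow> real" where
  "quad e t = (\<Sum>k<dd. R $$ (e, k) * (\<Sum>l<2 * r. t (l * (p1 + p2) + k mod p1) * t (l * (p1 + p2) + (p1 + k div p1))))"

lemma index_bounds: "k < dd \<Longrightarrow> k mod p1 < p1" "k < dd \<Longrightarrow> k div p1 < p2"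
  using p by (auto simp: less_mult_imp_div_less mult.commute)

lemma homogeneous_quad: "homogeneous (2 * r * (p1 + p2)) 2 (quad e)"
proof -
  let ?m = "2 * r * (p1 + p2)"
  have idx: "l * (p1 + p2) + i < ?m" if "l < 2 * r" "i < p1 + p2" for l i
  proof -
    have "l * (p1 + p2) + i < Suc l * (p1 + p2)" using that by simp
    also have "\<dots> \<le> ?m" using that by (intro mult_right_mono) auto
    finally show ?thesis .
  qed
  have "homogeneous ?m (1 + 1) (\<lambda>t. t (l * (p1 + p2) + k mod p1) * t (l * (p1 + p2) + (p1 + k div p1)))"
    if "l < 2 * r" "k < dd" for l k
    using index_bounds[OF that(2)] that by (intro homogeneous_mult homogeneous_coordinate idx) auto
  then have "homogeneous ?m 2 (\<lambda>t. t (l * (p1 + p2) + k mod p1) * t (l * (p1 + p2) + (p1 + k div p1)))"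
    if "l < 2 * r" "k < dd" for l k using that by (simp only: one_add_one)
  then show ?thesis
    unfolding quad_def[abs_def] by (intro homogeneous_sum homogeneous_scale) auto
qed

lemma whiten_sum:
  assumes "e < dd"
  shows "whiten U e = (\<Sum>k<dd. R $$ (e, k) * U $$ (k mod p1, k div p1))"
  using assms R(1) by (simp add: whiten_def vec_of_mat_def scalar_prod_def atLeast0LessThan)

lemma whiten_smult:
  assumes U: "U \<in> carrier_mat p1 p2" and e: "e < dd"
  shows "whiten (c \<cdot>\<^sub>m U) e = c * whiten U e"
  using U index_bounds by (simp add: whiten_sum[OF e] sum_distrib_left mult_ac)

lemma C_param:
  assumes U: "U \<in> C"
  shows "\<exists>t. \<forall>e\<in>{..<dd}. whiten U e = quad e t"
proof -
  have "mat_rank U \<le> 2 * r" using U by (simp add: C_def low_rank_set_def)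
  then obtain a b where ab: "\<And>i j. i < p1 \<Longrightarrow> j < p2 \<Longrightarrow> U $$ (i, j) = (\<Sum>l<2 * r. a l i * b l j)"
    using low_rank_factorization[OF C_carrier[OF U]] by blast
  let ?q = "p1 + p2"
  define t :: "nat \<Rightarrow> real" where
    "t x = (if x mod ?q < p1 then a (x div ?q) (x mod ?q) else b (x div ?q) (x mod ?q - p1))" for x
  have t1: "t (l * ?q + i) = a l i" if "i < p1" for l i
    using that by (simp add: t_def)
  have t2: "t (l * ?q + (p1 + j)) = b l j" if "j < p2" for l j
  proof -
    have "(l * ?q + (p1 + j)) mod ?q = p1 + j" "(l * ?q + (p1 + j)) div ?q = l"
      using that p by (simp_all del: add.assoc)
    then show ?thesis by (simp add: t_def)
  qed
  have "whiten U e = quad e t" if "e < dd" for e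
    unfolding whiten_sum[OF that] quad_def
    by (intro sum.cong refl) (use index_bounds in \<open>simp add: ab t1 t2\<close>)
  then show ?thesis by (intro exI[of _ t]) simp
qed

lemma C_scale:
  assumes U: "U \<in> low_rank_set p1 p2 (2 * r)" and c: "c \<noteq> 0" "c\<^sup>2 * (\<Sum>k<dd. (whiten U k)\<^sup>2) = 1"
  shows "c \<cdot>\<^sub>m U \<in> C"
proof -
  have Uc: "U \<in> carrier_mat p1 p2" "U \<noteq> 0\<^sub>m p1 p2" "mat_rank U \<le> 2 * r"
    using U by (auto simp: low_rank_set_def)
  have "c \<cdot>\<^sub>m U \<noteq> 0\<^sub>m p1 p2"
  proof
    assume z: "c \<cdot>\<^sub>m U = 0\<^sub>m p1 p2"
    have "U $$ (i, j) = 0" if "i < p1" "j < p2" for i j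
      using arg_cong[OF z, of "\<lambda>M. M $$ (i, j)"] that Uc c by simp
    then have "U = 0\<^sub>m p1 p2" using Uc by (intro eq_matI) auto
    then show False using Uc by simp
  qed
  moreover have "mat_rank (c \<cdot>\<^sub>m U) \<le> 2 * r" using mat_rank_smult_le[OF Uc(1), of c] Uc by linarith
  moreover have "(\<Sum>k<dd. (whiten (c \<cdot>\<^sub>m U) k)\<^sup>2) = c\<^sup>2 * (\<Sum>k<dd. (whiten U k)\<^sup>2)"
    using Uc by (simp add: whiten_smult power_mult_distrib sum_distrib_left)
  ultimately show ?thesis using Uc c by (simp add: C_def low_rank_set_def)
qed

lemma net:
  "\<exists>N\<subseteq>C. finite N \<and> real (card N) \<le> exp (25 * real (r * (p1 + p2)) * real (j + 1))
    \<and> (\<forall>u\<in>C. \<exists>a\<in>N. \<rho> u a \<le> (1 / 8) ^ j)"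
proof -
  let ?m = "2 * r * (p1 + p2)"
  have "\<exists>N\<subseteq>C. finite N \<and> card N \<le> 2 * 4096 ^ (?m * (j + 1))
    \<and> (\<forall>u\<in>C. \<exists>a\<in>N. (\<Sum>e\<in>{..<dd}. (whiten u e - whiten a e)\<^sup>2) \<le> (1 / 64) ^ j)"
  proof (rule net_exists[where \<phi>=quad])
    show "1 \<le> ?m" using p by (cases r) auto
    fix u assume u: "u \<in> C"
    show "\<exists>u'\<in>C. \<forall>e\<in>{..<dd}. whiten u' e = - whiten u e"
      using C_scale[of u "- 1"] u C_carrier[OF u]
      by (intro bexI[of _ "(- 1) \<cdot>\<^sub>m u"]) (auto simp: whiten_smult C_def)
  qed (auto simp: C_param homogeneous_quad, simp add: C_def)
  then obtain N where N: "N \<subseteq> C" "finite N" "card N \<le> 2 * 4096 ^ (?m * (j + 1))"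
    "\<And>u. u \<in> C \<Longrightarrow> \<exists>a\<in>N. (\<Sum>e<dd. (whiten u e - whiten a e)\<^sup>2) \<le> (1 / 64) ^ j" by blast
  have "real (card N) \<le> 2 * 4096 ^ (?m * (j + 1))"
    using of_nat_mono[OF N(3), where 'a=real] by simp
  \<comment> \<open>25 = 1 + 12 * 2: the leading 2 is absorbed by one unit, 4096 <= exp 12, and the
    number of parameters is twice r (p1 + p2).\<close>
  also have "\<dots> \<le> exp 1 ^ (r * (p1 + p2) * (j + 1)) * (exp 1 ^ 12) ^ (?m * (j + 1))"
  proof (intro mult_mono power_mono)
    have e2: "2 \<le> exp (1::real)" using exp_ge_add_one_self[of 1] by simp
    have "0 < r * (p1 + p2) * (j + 1)" using p by simp
    then have "1 \<le> r * (p1 + p2) * (j + 1)" unfolding One_nat_def by (rule Suc_leI)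
    then have "(2::real) ^ 1 \<le> 2 ^ (r * (p1 + p2) * (j + 1))" by (intro power_increasing) auto
    also have "\<dots> \<le> exp 1 ^ (r * (p1 + p2) * (j + 1))" using e2 by (intro power_mono) auto
    finally show "2 \<le> exp (1::real) ^ (r * (p1 + p2) * (j + 1))" by simp
    have "(2::real) ^ 12 \<le> exp 1 ^ 12" using e2 by (intro power_mono) auto
    then show "4096 \<le> exp (1::real) ^ 12" by simp
  qed auto
  also have "\<dots> = exp 1 ^ (25 * (r * (p1 + p2)) * (j + 1))"
    by (simp add: power_mult[symmetric] power_add[symmetric] algebra_simps)
  also have "\<dots> = exp (25 * real (r * (p1 + p2)) * real (j + 1))"
    unfolding exp_of_nat_mult[symmetric] by (simp only: of_nat_mult of_nat_numeral mult_1_right)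
  finally have card: "real (card N) \<le> exp (25 * real (r * (p1 + p2)) * real (j + 1))" .
  have "\<exists>a\<in>N. \<rho> u a \<le> (1 / 8) ^ j" if u: "u \<in> C" for u
  proof -
    obtain a where a: "a \<in> N" "(\<Sum>e<dd. (whiten u e - whiten a e)\<^sup>2) \<le> (1 / 64) ^ j"
      using N(4)[OF u] by blast
    have "(1 / 64 :: real) ^ j = ((1 / 8) ^ j)\<^sup>2" by (simp add: power2_eq_square power_mult_distrib[symmetric])
    then have "\<rho> u a \<le> (1 / 8) ^ j"
      unfolding \<rho>_def L2_set_def using a by (intro real_le_lsqrt) (auto intro: sum_nonneg)
    then show ?thesis using a by blast
  qed
  then show ?thesis using N card by blast
qed

text \<open>Clean covariates lie in the range of R, described by (R G) x = x. On this set x = R c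
  with c = G x, so all pairings are linear in the whitened direction. This gives the Lipschitz
  property, and it makes pairings vanish when the whitened direction does.\<close>

lemma support:
  "\<exists>D\<^sub>0\<in>sets P. measure P D\<^sub>0 = 1 \<and> (\<forall>w\<in>D\<^sub>0. \<exists>c. \<forall>U. g U w = (\<Sum>k<dd. whiten U k * c k))"
proof -
  obtain G where G: "G \<in> carrier_mat dd dd" "R * G * R = R" using generalized_inverse[OF R] by blast
  have RG: "R * G \<in> carrier_mat dd dd" using R(1) G(1) by (rule mult_carrier_mat)
  define f where "f k w = (\<Sum>l<dd. (R * G) $$ (k, l) * fst w (l mod p1, l div p1))" for k and w :: "(nat \<times> nat \<Rightarrow> real) \<times> real"
  define D where "D = {w \<in> space P. \<forall>k\<in>{..<dd}. f k w = fst w (k mod p1, k div p1)}"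
  have comp: "(\<lambda>w. fst w (k mod p1, k div p1)) \<in> borel_measurable P" if "k < dd" for k
  proof -
    have "(\<lambda>X. X (k mod p1, k div p1)) \<in> borel_measurable (PiM ({..<p1} \<times> {..<p2}) (\<lambda>_. borel :: real measure))"
      using index_bounds[OF that] by (intro measurable_component_singleton) auto
    then have "(\<lambda>w. fst w (k mod p1, k div p1)) \<in> borel_measurable (data_space p1 p2)"
      unfolding data_space_def by (rule measurable_compose[OF measurable_fst])
    then show ?thesis by (simp add: measurable_cong_sets[OF sets_model(1) refl])
  qed
  have f: "f k \<in> borel_measurable P" for k
    unfolding f_def[abs_def] by (intro borel_measurable_sum borel_measurable_times borel_measurable_const comp) auto
  have D: "D \<in> sets P"
    unfolding D_def by (intro sets.sets_Collect_finite_All borel_measurable_eq f comp) auto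
  have fvec: "f k w = ((R * G) *\<^sub>v vec_data (fst w)) $ k" if "k < dd" for k w
    unfolding f_def vec_data_def by (rule mult_mat_vec_index[OF RG that, symmetric])
  have gen: "generate w \<in> D" if w: "w \<in> space noise" for w
  proof -
    let ?x = "R *\<^sub>v vec dd (fst w)"
    have x: "?x \<in> carrier_vec dd" using R(1) by (intro mult_mat_vec_carrier[of _ dd dd]) auto
    have fst: "fst (generate w) = unvec p1 p2 ?x" by (simp add: generate_def case_prod_beta)
    have "(R * G) *\<^sub>v ?x = (R * G * R) *\<^sub>v vec dd (fst w)"
      by (rule assoc_mult_mat_vec[symmetric, OF RG R(1)]) simp
    then have eq: "(R * G) *\<^sub>v ?x = ?x" by (simp only: G(2))
    have "f k (generate w) = fst (generate w) (k mod p1, k div p1)" if k: "k < dd" for k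
    proof -
      have "f k (generate w) = ?x $ k" by (simp add: fvec[OF k] fst vec_data_unvec[OF x] eq)
      also have "\<dots> = vec_data (unvec p1 p2 ?x) $ k" by (simp only: vec_data_unvec[OF x])
      also have "\<dots> = fst (generate w) (k mod p1, k div p1)" using k by (simp add: fst vec_data_def)
      finally show ?thesis .
    qed
    then show ?thesis
      using measurable_space[OF generate_measurable w] by (simp add: D_def sets_model)
  qed
  interpret noise: prob_space noise by (rule prob_space_noise)
  have "measure P D = noise.prob (generate -` D \<inter> space noise)"
    using D unfolding model_eq by (subst measure_distr[OF generate_measurable]) auto
  also have "generate -` D \<inter> space noise = space noise" using gen by blast
  finally have "measure P D = 1" by (simp only: noise.prob_space)
  moreover have "\<exists>c. \<forall>U. g U w = (\<Sum>k<dd. whiten U k * c k)" if w: "w \<in> D" for w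
  proof -
    let ?v = "vec_data (fst w)"
    let ?c = "G *\<^sub>v ?v"
    have c: "?c \<in> carrier_vec dd" using G(1) by (intro mult_mat_vec_carrier[of _ dd dd]) auto
    have "?v = (R * G) *\<^sub>v ?v"
    proof (rule eq_vecI)
      fix k assume "k < dim_vec ((R * G) *\<^sub>v ?v)"
      then have k: "k < dd" using R(1) by simp
      then show "?v $ k = ((R * G) *\<^sub>v ?v) $ k"
        using w by (simp add: fvec[OF k, symmetric] D_def) (simp add: vec_data_def)
    qed (use R(1) in \<open>simp add: vec_data_def\<close>)
    also have "\<dots> = R *\<^sub>v ?c" by (rule assoc_mult_mat_vec[OF R(1) G(1)]) simp
    finally have v: "?v = R *\<^sub>v ?c" .
    have "g U w = (\<Sum>k<dd. whiten U k * ?c $ k)" for U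
    proof -
      have "g U w = vec_of_mat p1 p2 U \<bullet> (R *\<^sub>v ?c)" unfolding g_def pairing_vec v[symmetric] ..
      also have "\<dots> = (R *\<^sub>v vec_of_mat p1 p2 U) \<bullet> ?c" using c by (intro symmetric_move) auto
      finally show ?thesis using c G(1) by (simp add: scalar_prod_def whiten_def atLeast0LessThan)
    qed
    then show ?thesis by (intro exI[of _ "\<lambda>k. ?c $ k"]) blast
  qed
  ultimately show ?thesis using D by blast
qed

lemma gaussian_class_exists:
  assumes Q: "prob_space Q" "sets Q = sets (data_space p1 p2)"
  shows "\<exists>D\<^sub>0 N. gaussian_class P Q C g \<xi> \<rho> D\<^sub>0 (real (r * (p1 + p2))) N
    \<and> (\<forall>w\<in>D\<^sub>0. \<exists>c. \<forall>U. g U w = (\<Sum>k<dd. whiten U k * c k))"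
proof -
  obtain D\<^sub>0 where D: "D\<^sub>0 \<in> sets P" "measure P D\<^sub>0 = 1"
    and rep: "\<And>w. w \<in> D\<^sub>0 \<Longrightarrow> \<exists>c. \<forall>U. g U w = (\<Sum>k<dd. whiten U k * c k)"
    using support by blast
  have "\<forall>j. \<exists>N. N \<subseteq> C \<and> finite N \<and> real (card N) \<le> exp (25 * real (r * (p1 + p2)) * real (j + 1))
    \<and> (\<forall>u\<in>C. \<exists>a\<in>N. \<rho> u a \<le> (1 / 8) ^ j)" using net by blast
  from choice[OF this] obtain N where N: "\<forall>j. N j \<subseteq> C \<and> finite (N j)
    \<and> real (card (N j)) \<le> exp (25 * real (r * (p1 + p2)) * real (j + 1))
    \<and> (\<forall>u\<in>C. \<exists>a\<in>N j. \<rho> u a \<le> (1 / 8) ^ j)" by blast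
  have lip: "\<exists>M. \<forall>u\<in>C. \<forall>v\<in>C. \<bar>g u w - g v w\<bar> \<le> M * \<rho> u v" if w: "w \<in> D\<^sub>0" for w
  proof -
    obtain c where c: "\<And>U. g U w = (\<Sum>k<dd. whiten U k * c k)" using rep[OF w] by blast
    \<comment> \<open>Cauchy-Schwarz in the representation by \<open>c\<close>; the constant depends
      on w.\<close>
    have "\<bar>g u w - g v w\<bar> \<le> L2_set c {..<dd} * \<rho> u v" for u v
    proof -
      have "\<bar>g u w - g v w\<bar> = \<bar>\<Sum>k<dd. (whiten u k - whiten v k) * c k\<bar>"
        by (simp add: c left_diff_distrib sum_subtractf)
      also have "\<dots> \<le> (\<Sum>k<dd. \<bar>(whiten u k - whiten v k) * c k\<bar>)" by (rule sum_abs)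
      also have "\<dots> = (\<Sum>k<dd. \<bar>whiten u k - whiten v k\<bar> * \<bar>c k\<bar>)" by (simp add: abs_mult)
      also have "\<dots> \<le> \<rho> u v * L2_set c {..<dd}" unfolding \<rho>_def by (rule L2_set_mult_ineq)
      finally show ?thesis by (simp add: mult.commute)
    qed
    then show ?thesis by blast
  qed
  have "gaussian_class P Q C g \<xi> \<rho> D\<^sub>0 (real (r * (p1 + p2))) N"
  proof (rule gaussian_class.intro)
    show "prob_space P" by (rule prob_space_model)
    show "prob_space Q" by (rule Q)
    show "sets Q = sets P" by (simp only: Q sets_model)
    show "g u \<in> borel_measurable P" for u by (rule g_measurable)
    show "\<xi> \<in> borel_measurable P" by (rule \<xi>_measurable)
    show "distr P (borel \<Otimes>\<^sub>M borel) (\<lambda>x. (g u x, \<xi> x)) = std_gauss \<Otimes>\<^sub>M std_gauss" if "u \<in> C" for u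
      using that by (rule model_pair_law)
    show "distr P borel (\<lambda>x. g u x - g v x) = distr std_gauss borel (\<lambda>z. \<rho> u v * z)" for u v
      by (rule model_diff_law)
    show "N j \<subseteq> C" "finite (N j)" "real (card (N j)) \<le> exp (25 * real (r * (p1 + p2)) * real (j + 1))" for j
      using N by blast+
    show "\<exists>a\<in>N j. \<rho> u a \<le> (1 / 8) ^ j" if "u \<in> C" for u j using N that by blast
    show "D\<^sub>0 \<in> sets P" "measure P D\<^sub>0 = 1" by (rule D)+
    show "\<exists>M. \<forall>u\<in>C. \<forall>v\<in>C. \<bar>g u x - g v x\<bar> \<le> M * \<rho> u v" if "x \<in> D\<^sub>0" for x
      using that by (rule lip)
    show "\<rho> u v = \<rho> v u" for u v
      by (simp add: \<rho>_def L2_set_def power2_commute)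
    show "\<rho> u w \<le> \<rho> u v + \<rho> v w" for u v w
      using L2_set_triangle_ineq[of "\<lambda>k. whiten u k - whiten v k" "\<lambda>k. whiten v k - whiten w k" "{..<dd}"]
      by (simp add: \<rho>_def)
    show "0 \<le> \<rho> u v" for u v by (simp add: \<rho>_def L2_set_nonneg)
    have "1 * 2 \<le> r * (p1 + p2)" using p by (intro mult_mono) auto
    then show "2 \<le> real (r * (p1 + p2))" by linarith
  qed
  then show ?thesis using rep by blast
qed

end

section \<open>The estimation error\<close>

lemma dyadic_scale_exists:
  assumes "0 < x" "x \<le> (1::real)"
  shows "\<exists>J. 2 ^ J * x \<le> 1 \<and> 1 < 2 ^ Suc J * x"
proof -
  obtain k where k: "1 / x < 2 ^ k" using real_arch_pow[of 2 "1 / x"] by auto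
  define K where "K = (LEAST k. 1 < 2 ^ k * x)"
  have "1 < 2 ^ k * x" using k assms by (simp add: field_simps)
  then have K: "1 < 2 ^ K * x" unfolding K_def by (rule LeastI)
  have "K \<noteq> 0" using K assms by (intro notI) simp
  then obtain J where J: "K = Suc J" using not0_implies_Suc by blast
  have "\<not> 1 < 2 ^ J * x" using not_less_Least[of J "\<lambda>k. 1 < 2 ^ k * x"] J by (simp add: K_def)
  then show ?thesis using K J by (intro exI[of _ J]) (simp only: not_less)
qed

text \<open>729 is the slope of the population depth in the tilt, and the deviation bound
  10000 sqrt beta enters twice.\<close>

definition rate_const :: real where "rate_const = 729 * 20001"

context matrix_regression
begin

section \<open>From half space counts to the estimation error\<close>

definition halfspace :: "real mat \<Rightarrow> real mat \<Rightarrow> ((nat \<times> nat \<Rightarrow> real) \<times> real) set" where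
  "halfspace U B' = {w \<in> space (data_space p1 p2). 0 \<le> g U w * (snd w - pairing B' (fst w))}"

lemma halfspace_sets: "halfspace U B' \<in> sets (data_space p1 p2)"
proof -
  have "(\<lambda>w. g U w * (snd w - pairing B' (fst w))) \<in> borel_measurable (data_space p1 p2)"
    unfolding g_def
    by (intro borel_measurable_times borel_measurable_diff pairing_measurable snd_measurable)
  then show ?thesis unfolding halfspace_def by (intro borel_measurable_le) auto
qed

lemma pairing_smult: "U \<in> carrier_mat p1 p2 \<Longrightarrow> pairing (c \<cdot>\<^sub>m U) X = c * pairing U X"
  by (simp add: pairing_def sum_distrib_left mult.assoc)

lemma pairing_diff:
  "U \<in> carrier_mat p1 p2 \<Longrightarrow> V \<in> carrier_mat p1 p2 \<Longrightarrow> pairing (U - V) X = pairing U X - pairing V X"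
  by (simp add: pairing_def sum_subtractf[symmetric] left_diff_distrib)

lemma depth_empirical:
  assumes n: "1 \<le> n" and \<omega>: "\<And>i. i < n \<Longrightarrow> \<omega> i \<in> space (data_space p1 p2)"
    and B': "B' \<in> carrier_mat p1 p2"
  shows "depth p1 p2 (low_rank_set p1 p2 k) B' (empirical (data_space p1 p2) n \<omega>)
    = (INF U\<in>low_rank_set p1 p2 k. (\<Sum>i<n. indicator (halfspace U B') (\<omega> i)) / real n)"
  unfolding depth_def
proof (rule INF_cong[OF refl])
  fix U assume "U \<in> low_rank_set p1 p2 k"
  then have U: "U \<in> carrier_mat p1 p2" by (simp add: low_rank_set_def)
  let ?M = "empirical (data_space p1 p2) n \<omega>"
  have "{(X, y) \<in> space ?M. 0 \<le> mat_inner U (to_mat p1 p2 X) * (y - mat_inner B' (to_mat p1 p2 X))} = halfspace U B'"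
    using U B' by (auto simp: halfspace_def mat_inner_to_mat g_def empirical_def)
  then have "measure ?M {(X, y) \<in> space ?M. 0 \<le> mat_inner U (to_mat p1 p2 X) * (y - mat_inner B' (to_mat p1 p2 X))}
      = real (card {i \<in> {..<n}. \<omega> i \<in> halfspace U B'}) / real n"
    using measure_empirical[OF n \<omega> halfspace_sets] by simp
  also have "real (card {i \<in> {..<n}. \<omega> i \<in> halfspace U B'}) = (\<Sum>i<n. indicator (halfspace U B') (\<omega> i))"
    by (simp add: indicator_def sum.If_cases Int_def)
  finally show "measure ?M {(X, y) \<in> space ?M. 0 \<le> mat_inner U (to_mat p1 p2 X) * (y - mat_inner B' (to_mat p1 p2 X))}
      = (\<Sum>i<n. indicator (halfspace U B') (\<omega> i)) / real n" .
qed

text \<open>If \<open>Bh\<close> were too far away, the direction Bh - B, of rank at most 2 r, would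
  show a depth below the one guaranteed at B. A single tilt suffices because a larger distance only
  shrinks the half space, which always lies inside \<open>reg t\<close>.\<close>

lemma estimation_event:
  assumes B_rank: "B \<in> low_rank_set p1 p2 r" and n: "1 \<le> n" and eps: "0 \<le> eps" "eps \<le> 1"
    and Q: "prob_space Q" "sets Q = sets (data_space p1 p2)"
    and \<beta>: "\<beta> = real (r * (p1 + p2)) / real n + eps\<^sup>2" and \<beta>_le: "\<beta> \<le> 1 / rate_const\<^sup>2"
  shows "\<exists>E\<in>sets (PiM {..<n} (\<lambda>_. mixture eps P Q)).
    1 - exp (- (real n * \<beta>)) \<le> measure (PiM {..<n} (\<lambda>_. mixture eps P Q)) E \<and>
    (\<forall>\<omega>\<in>E. \<forall>Bh. is_depth_maximizer p1 p2 r n \<omega> Bh \<longrightarrow>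
      (\<Sum>k<dd. (whiten (Bh - B) k)\<^sup>2) \<le> (sig * (rate_const * sqrt \<beta>))\<^sup>2)"
proof -
  obtain D\<^sub>0 N where gc: "gaussian_class P Q C g \<xi> \<rho> D\<^sub>0 (real (r * (p1 + p2))) N"
    and rep: "\<And>w. w \<in> D\<^sub>0 \<Longrightarrow> \<exists>c. \<forall>U. g U w = (\<Sum>k<dd. whiten U k * c k)"
    using gaussian_class_exists[OF Q] by blast
  have d0: "0 < real (r * (p1 + p2))" using p by simp
  have \<beta>0: "0 < \<beta>" unfolding \<beta> using n d0 by (intro add_pos_nonneg divide_pos_pos) auto
  define s where "s = sqrt \<beta>"
  have s0: "0 < s" using \<beta>0 by (simp add: s_def)
  define t where "t = rate_const * s"
  \<comment> \<open>This is where smallness of \<beta> enters: the depth gap is linear in the tilt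
    only for t <= 1.\<close>
  have "t\<^sup>2 \<le> 1" using \<beta>_le \<beta>0 by (simp add: t_def s_def power_mult_distrib rate_const_def field_simps)
  moreover have t0: "0 < t" using s0 by (simp add: t_def rate_const_def)
  ultimately have t1: "t \<le> 1" by (simp add: power2_le_imp_le)
  have "s \<le> t" using s0 by (simp add: t_def rate_const_def)
  then have s1: "s \<le> 1" using t1 by simp
  obtain J where J: "2 ^ J * s \<le> 1" "1 < 2 ^ Suc J * s"
    using dyadic_scale_exists[OF s0 s1] by blast
  interpret gc: gaussian_class P Q C g \<xi> \<rho> D\<^sub>0 "real (r * (p1 + p2))" N by (rule gc)
  interpret cs: contaminated_sample P Q C g \<xi> \<rho> D\<^sub>0 "real (r * (p1 + p2))" N eps \<beta> n J
    by unfold_locales (use eps n \<beta> J s1 \<beta>0 in \<open>auto simp: s_def\<close>)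
  let ?PM = "PiM {..<n} (\<lambda>_. mixture eps P Q)"
  obtain E where E: "E \<in> sets ?PM" "1 - exp (- (real n * \<beta>)) \<le> measure ?PM E"
    and good: "\<And>\<omega>. \<omega> \<in> E \<Longrightarrow>
      (\<exists>I\<subseteq>{..<n}. real (card I) \<le> real n * (82 * s) \<and> (\<forall>i\<in>{..<n} - I. \<omega> i \<in> D\<^sub>0)) \<and>
      (\<forall>u\<in>C. 1 / 2 - 10000 * s \<le> cs.cnt \<omega> (gc.reg 0 u) / n \<and>
        cs.cnt \<omega> (gc.reg t u) / n \<le> 1 / 2 - t / 729 + 10000 * s)"
    using cs.uniform_depth_event[OF less_imp_le[OF t0] t1] unfolding s_def by blast
  have n0: "0 < real n" using n by simp
  have "(\<Sum>k<dd. (whiten (Bh - B) k)\<^sup>2) \<le> (sig * t)\<^sup>2"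
    if \<omega>: "\<omega> \<in> E" and max: "is_depth_maximizer p1 p2 r n \<omega> Bh" for \<omega> Bh
  proof (rule ccontr)
    let ?A = "low_rank_set p1 p2 (2 * r)" and ?M = "empirical (data_space p1 p2) n \<omega>"
    define v where "v U = (\<Sum>k<dd. (whiten U k)\<^sup>2)" for U
    define cnt where "cnt A = (\<Sum>i<n. indicator A (\<omega> i) :: real)" for A
    have v_nonneg: "0 \<le> v U" for U by (simp add: v_def sum_nonneg)
    assume "\<not> (\<Sum>k<dd. (whiten (Bh - B) k)\<^sup>2) \<le> (sig * t)\<^sup>2"
    then have big: "(sig * t)\<^sup>2 < v (Bh - B)" by (simp add: v_def)
    have \<omega>s: "\<omega> i \<in> space (data_space p1 p2)" if "i < n" for i
      using sets.sets_into_space[OF E(1)] \<omega> that by (auto simp: space_PiM sets_model)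
    have cs_cnt: "cs.cnt \<omega> X = cnt X" for X by (simp add: cs.cnt_def cnt_def)
    have Bh: "Bh \<in> carrier_mat p1 p2" "mat_rank Bh \<le> r"
      using max by (auto simp: is_depth_maximizer_def low_rank_set_def)
    have scaled: "(1 / sqrt (v U)) \<cdot>\<^sub>m U \<in> C" if "U \<in> ?A" "v U \<noteq> 0" for U
      using that v_nonneg[of U] by (intro C_scale) (auto simp: power_divide v_def[symmetric])
    have g_scaled: "g ((1 / sqrt (v U)) \<cdot>\<^sub>m U) w = g U w / sqrt (v U)" if "U \<in> ?A" for U w
      using that by (simp add: g_def pairing_smult low_rank_set_def)
    have lower: "1 / 2 - 10000 * s \<le> cnt (halfspace U B) / n" if U: "U \<in> ?A" for U
    proof (cases "v U = 0")
      \<comment> \<open>A direction of whitened length 0: \<open>g U\<close> vanishes at every point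
        of \<open>D\<^sub>0\<close>, so all points outside I count and the frequency is at least 1 -
        82 s.\<close>
      case True
      obtain I where I: "I \<subseteq> {..<n}" "real (card I) \<le> real n * (82 * s)" "\<forall>i\<in>{..<n} - I. \<omega> i \<in> D\<^sub>0"
        using good[OF \<omega>] by blast
      have zero: "whiten U k = 0" if "k < dd" for k
        using True that by (simp add: v_def sum_nonneg_eq_0_iff)
      have mem: "\<omega> i \<in> halfspace U B" if i: "i \<in> {..<n} - I" for i
      proof -
        obtain c where "\<And>U. g U (\<omega> i) = (\<Sum>k<dd. whiten U k * c k)" using rep I i by blast
        then have "g U (\<omega> i) = 0" by (simp add: zero)
        then show ?thesis using \<omega>s i by (simp add: halfspace_def)
      qed
      have "real n - real (card I) = real (card ({..<n} - I))"
        using I(1) by (simp add: card_Diff_subset finite_subset[OF I(1)] of_nat_diff card_mono[of "{..<n}" I, simplified])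
      also have "\<dots> = (\<Sum>i\<in>{..<n} - I. indicator (halfspace U B) (\<omega> i))"
        using mem by simp
      also have "\<dots> \<le> cnt (halfspace U B)"
        unfolding cnt_def by (intro sum_mono2) auto
      finally have "real n * (1 - 82 * s) \<le> cnt (halfspace U B)"
        using I(2) by (simp add: algebra_simps)
      then have "1 - 82 * s \<le> cnt (halfspace U B) / n"
        using n0 by (simp add: field_simps)
      then show ?thesis using s0 by linarith
    next
      case False
      let ?u = "(1 / sqrt (v U)) \<cdot>\<^sub>m U"
      have "0 < sqrt (v U)" using False v_nonneg[of U] by simp
      then have prod: "0 < sqrt (v U) * sig" using sig by (rule mult_pos_pos)
      have "0 \<le> a / sqrt (v U) * (b / sig) \<longleftrightarrow> 0 \<le> a * b" for a b
        by (simp only: times_divide_times_eq pos_le_divide_eq[OF prod] mult_zero_left)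
      then have "gc.reg 0 ?u = halfspace U B"
        by (simp only: gc.reg_def halfspace_def sets_model g_scaled[OF U] \<xi>_def mult_zero_left diff_zero)
      then show ?thesis using good[OF \<omega>] scaled[OF U False] by (auto simp: cs_cnt)
    qed
    let ?U = "Bh - B"
    have U: "?U \<in> ?A"
    proof -
      have "mat_rank ?U \<le> 2 * r"
        using mat_rank_diff_le[OF Bh(1) B] Bh(2) B_rank by (simp add: low_rank_set_def)
      moreover have "?U \<noteq> 0\<^sub>m p1 p2"
      proof
        assume "?U = 0\<^sub>m p1 p2"
        then have "v ?U = 0" by (simp add: v_def whiten_sum index_bounds)
        then show False using big by (simp add: not_less[symmetric])
      qed
      ultimately show ?thesis using minus_carrier_mat[OF B, of Bh] by (simp add: low_rank_set_def)
    qed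
    have vU: "sig * t < sqrt (v ?U)" using big by (simp add: real_less_rsqrt)
    then have pos: "0 < sqrt (v ?U)" using mult_pos_pos[OF sig t0] by linarith
    then have vU0: "v ?U \<noteq> 0" by auto
    let ?u = "(1 / sqrt (v ?U)) \<cdot>\<^sub>m ?U"
    \<comment> \<open>Dividing by the whitened length turns the half space into a tilted region with
      tilt sqrt (v ?U) / sig > t; since a^2 >= 0, decreasing the tilt to t only enlarges it.\<close>
    have sub: "halfspace ?U Bh \<subseteq> gc.reg t ?u"
    proof
      fix w assume w: "w \<in> halfspace ?U Bh"
      define a where "a = g ?u w"
      have gU: "g ?U w = sqrt (v ?U) * a" using pos by (simp add: a_def g_scaled[OF U])
      have "pairing Bh (fst w) = pairing B (fst w) + g ?U w"
        using Bh B by (simp add: g_def pairing_diff)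
      moreover have "snd w - pairing B (fst w) = sig * \<xi> w" using sig by (simp add: \<xi>_def)
      ultimately have "snd w - pairing Bh (fst w) = sig * \<xi> w - sqrt (v ?U) * a"
        using gU by simp
      then have "0 \<le> sqrt (v ?U) * (a * (sig * \<xi> w - sqrt (v ?U) * a))"
        using w gU by (simp add: halfspace_def mult.assoc)
      then have "0 \<le> a * (sig * \<xi> w - sqrt (v ?U) * a)" using pos by (simp add: zero_le_mult_iff)
      then have "sqrt (v ?U) * a\<^sup>2 \<le> sig * (a * \<xi> w)" by (simp add: algebra_simps power2_eq_square)
      moreover have "sig * t * a\<^sup>2 \<le> sqrt (v ?U) * a\<^sup>2" using vU by (intro mult_right_mono) auto
      ultimately have "sig * (t * a\<^sup>2) \<le> sig * (a * \<xi> w)" by (simp add: mult.assoc)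
      then have "t * a\<^sup>2 \<le> a * \<xi> w" using sig by simp
      then show "w \<in> gc.reg t ?u"
        using w by (simp add: gc.reg_def a_def[symmetric] halfspace_def sets_model algebra_simps power2_eq_square)
    qed
    have "cnt (halfspace ?U Bh) \<le> cnt (gc.reg t ?u)"
      unfolding cnt_def using sub by (intro sum_mono) (auto simp: indicator_def)
    then have "cnt (halfspace ?U Bh) / n \<le> cnt (gc.reg t ?u) / n" by (intro divide_right_mono) auto
    also have "\<dots> \<le> 1 / 2 - t / 729 + 10000 * s"
      using good[OF \<omega>] scaled[OF U vU0] by (simp add: cs_cnt)
    \<comment> \<open>t / 729 = 20001 s: one deviation of 10000 s is spent here, another at the
      truth, and the remaining s makes the contradiction strict.\<close>
    also have "\<dots> = 1 / 2 - 10001 * s" by (simp add: t_def rate_const_def)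
    finally have upper: "cnt (halfspace ?U Bh) / n \<le> 1 / 2 - 10001 * s" .
    have depth_eq: "depth p1 p2 ?A B' ?M = (INF U\<in>?A. cnt (halfspace U B') / n)"
      if "B' \<in> carrier_mat p1 p2" for B'
      unfolding cnt_def by (rule depth_empirical) (use n \<omega>s that in auto)
    have BA: "B \<in> ?A" using B_rank by (simp add: low_rank_set_def)
    have "1 / 2 - 10000 * s \<le> (INF U\<in>?A. cnt (halfspace U B) / n)"
      using BA lower by (intro cINF_greatest) auto
    also have "\<dots> = depth p1 p2 ?A B ?M" by (rule depth_eq[OF B, symmetric])
    also have "\<dots> \<le> depth p1 p2 ?A Bh ?M" using max B_rank by (simp add: is_depth_maximizer_def)
    also have "\<dots> = (INF U\<in>?A. cnt (halfspace U Bh) / n)" by (rule depth_eq[OF Bh(1)])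
    also have "\<dots> \<le> cnt (halfspace ?U Bh) / n"
    proof (rule cINF_lower[OF _ U])
      show "bdd_below ((\<lambda>U. cnt (halfspace U Bh) / n) ` ?A)"
        by (intro bdd_belowI2[of _ 0]) (simp add: cnt_def sum_nonneg)
    qed
    finally show False using upper s0 by linarith
  qed
  then show ?thesis using E unfolding t_def s_def by blast
qed

text \<open>Keeping kappa on the left as a factor covers kappa = 0 as well.\<close>

lemma kappa_bound:
  assumes U: "U \<in> low_rank_set p1 p2 (2 * r)"
  shows "0 \<le> kappa p1 p2 r S" "(kappa p1 p2 r S)\<^sup>2 * (frob_norm U)\<^sup>2 \<le> (\<Sum>k<dd. (whiten U k)\<^sup>2)"
proof -
  let ?q = "\<lambda>A. sqrt ((R *\<^sub>v vec_of_mat p1 p2 A) \<bullet> (R *\<^sub>v vec_of_mat p1 p2 A)) / frob_norm A"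
  have q0: "0 \<le> ?q A" for A
    unfolding whiten_norm by (intro divide_nonneg_nonneg real_sqrt_ge_zero sum_nonneg) (auto simp: frob_norm_def sum_nonneg)
  show k0: "0 \<le> kappa p1 p2 r S"
    unfolding kappa_def using U q0 by (intro cINF_greatest) auto
  have le: "kappa p1 p2 r S \<le> ?q U"
    unfolding kappa_def using q0 by (intro cINF_lower[OF _ U] bdd_belowI2[of _ 0]) auto
  have Uc: "U \<in> carrier_mat p1 p2" "U \<noteq> 0\<^sub>m p1 p2" using U by (auto simp: low_rank_set_def)
  have f0: "0 \<le> frob_norm U" by (simp add: frob_norm_def sum_nonneg)
  have "(kappa p1 p2 r S)\<^sup>2 * (frob_norm U)\<^sup>2 \<le> (?q U)\<^sup>2 * (frob_norm U)\<^sup>2"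
    by (intro mult_right_mono power_mono le k0) auto
  also have "\<dots> \<le> (\<Sum>k<dd. (whiten U k)\<^sup>2)"
    unfolding whiten_norm by (cases "frob_norm U = 0") (auto simp: power_divide sum_nonneg)
  finally show "(kappa p1 p2 r S)\<^sup>2 * (frob_norm U)\<^sup>2 \<le> (\<Sum>k<dd. (whiten U k)\<^sup>2)" .
qed

lemma error_bounds:
  assumes B_rank: "B \<in> low_rank_set p1 p2 r" and Bh: "Bh \<in> low_rank_set p1 p2 r"
    and bound: "(\<Sum>k<dd. (whiten (Bh - B) k)\<^sup>2) \<le> c" and c: "0 \<le> c"
  shows "(kappa p1 p2 r S)\<^sup>2 * (frob_norm (Bh - B))\<^sup>2 \<le> c"
    and "(kappa p1 p2 r S)\<^sup>2 * (nuclear_norm (Bh - B))\<^sup>2 \<le> 2 * real r * c"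
proof -
  let ?U = "Bh - B" and ?\<kappa> = "kappa p1 p2 r S"
  have carr: "Bh \<in> carrier_mat p1 p2" "B \<in> carrier_mat p1 p2" and rk: "mat_rank Bh \<le> r" "mat_rank B \<le> r"
    using B_rank Bh by (auto simp: low_rank_set_def)
  have U: "?U \<in> carrier_mat p1 p2" using carr(2) by (rule minus_carrier_mat)
  have rank: "mat_rank ?U \<le> 2 * r" using mat_rank_diff_le[OF carr] rk by linarith
  show fro: "?\<kappa>\<^sup>2 * (frob_norm ?U)\<^sup>2 \<le> c"
  \<comment> \<open>The case Bh = B is separate because the zero matrix is excluded from
    \<open>low_rank_set\<close>, over which kappa is defined.\<close>
  proof (cases "?U = 0\<^sub>m p1 p2")
    case True
    then show ?thesis using c by (simp add: frob_norm_def)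
  next
    case False
    then have "?U \<in> low_rank_set p1 p2 (2 * r)" using U rank by (simp add: low_rank_set_def)
    from kappa_bound(2)[OF this] bound show ?thesis by linarith
  qed
  have "?\<kappa>\<^sup>2 * (nuclear_norm ?U)\<^sup>2 \<le> ?\<kappa>\<^sup>2 * (real (2 * r) * (frob_norm ?U)\<^sup>2)"
    by (intro mult_left_mono nuclear_norm_le_frobenius[OF U rank]) simp
  also have "\<dots> = real (2 * r) * (?\<kappa>\<^sup>2 * (frob_norm ?U)\<^sup>2)" by simp
  also have "\<dots> \<le> real (2 * r) * c" by (intro mult_left_mono fro) simp
  finally show "?\<kappa>\<^sup>2 * (nuclear_norm ?U)\<^sup>2 \<le> 2 * real r * c" by simp
qed

end

theorem theorem6:
  "\<exists>c0>0. \<exists>C>0. \<exists>C'>0.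
   \<forall>(p1::nat) (p2::nat) (r::nat) (n::nat) (sig::real) (S::real mat) (eps::real)
     (Q :: ((nat \<times> nat \<Rightarrow> real) \<times> real) measure) (B::real mat).
     p1 \<ge> 1 \<longrightarrow> p2 \<ge> 1 \<longrightarrow> r \<ge> 1 \<longrightarrow> n \<ge> 1 \<longrightarrow> sig > 0 \<longrightarrow>
     covariance_matrix (p1 * p2) S \<longrightarrow>
     0 \<le> eps \<longrightarrow> eps < 1 \<longrightarrow>
     prob_space Q \<longrightarrow> sets Q = sets (data_space p1 p2) \<longrightarrow>
     B \<in> low_rank_set p1 p2 r \<longrightarrow>
     eps\<^sup>2 + real (r * (p1 + p2)) / real n \<le> c0 \<longrightarrow>
     (\<exists>E \<in> sets (PiM {..<n} (\<lambda>_. mixture eps (model p1 p2 S sig B) Q)).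
        measure (PiM {..<n} (\<lambda>_. mixture eps (model p1 p2 S sig B) Q)) E
          \<ge> 1 - exp (- C' * (real (r * (p1 + p2)) + real n * eps\<^sup>2)) \<and>
        (\<forall>\<omega> \<in> E. \<forall>Bh. is_depth_maximizer p1 p2 r n \<omega> Bh \<longrightarrow>
           (let D = vec_of_mat p1 p2 (Bh - B);
                \<kappa> = kappa p1 p2 r S
            in (psd_sqrt S *\<^sub>v D) \<bullet> (psd_sqrt S *\<^sub>v D)
                 \<le> C * sig\<^sup>2 * max (real (r * (p1 + p2)) / real n) (eps\<^sup>2)
             \<and> \<kappa>\<^sup>2 * (frob_norm (Bh - B))\<^sup>2
                 \<le> C * sig\<^sup>2 * max (real (r * (p1 + p2)) / real n) (eps\<^sup>2)
             \<and> \<kappa>\<^sup>2 * (nuclear_norm (Bh - B))\<^sup>2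
                 \<le> C * sig\<^sup>2 * max (real (r\<^sup>2 * (p1 + p2)) / real n) (real r * eps\<^sup>2))))"
proof (rule exI[of _ "1 / rate_const\<^sup>2"], rule conjI[rotated], rule exI[of _ "4 * rate_const\<^sup>2"],
    rule conjI[rotated], rule exI[of _ "1::real"], rule conjI[rotated], intro allI impI)
  show "0 < 1 / rate_const\<^sup>2" "0 < 4 * rate_const\<^sup>2" "0 < (1::real)" by (simp_all add: rate_const_def)
  fix p1 p2 r n :: nat and sig :: real and S :: "real mat" and eps :: real
    and Q :: "((nat \<times> nat \<Rightarrow> real) \<times> real) measure" and B :: "real mat"
  assume p: "1 \<le> p1" "1 \<le> p2" "1 \<le> r" and n: "1 \<le> n" and sig: "0 < sig"
    and S: "covariance_matrix (p1 * p2) S" and eps: "0 \<le> eps" "eps < 1"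
    and Q: "prob_space Q" "sets Q = sets (data_space p1 p2)" and B_rank: "B \<in> low_rank_set p1 p2 r"
    and small: "eps\<^sup>2 + real (r * (p1 + p2)) / real n \<le> 1 / rate_const\<^sup>2"
  interpret matrix_regression p1 p2 r sig S B
    by unfold_locales (use p sig S B_rank in \<open>auto simp: low_rank_set_def\<close>)
  let ?PM = "PiM {..<n} (\<lambda>_. mixture eps (model p1 p2 S sig B) Q)"
  let ?\<kappa> = "kappa p1 p2 r S"
  define \<beta> where "\<beta> = real (r * (p1 + p2)) / real n + eps\<^sup>2"
  define m where "m = max (real (r * (p1 + p2)) / real n) (eps\<^sup>2)"
  have \<beta>: "\<beta> \<le> 1 / rate_const\<^sup>2" using small by (simp add: \<beta>_def)
  have \<beta>0: "0 \<le> \<beta>" by (simp add: \<beta>_def)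
  have n\<beta>: "real n * \<beta> = real (r * (p1 + p2)) + real n * eps\<^sup>2"
    using n by (simp add: \<beta>_def field_simps)
  obtain E where E: "E \<in> sets ?PM" "1 - exp (- (real n * \<beta>)) \<le> measure ?PM E"
    and est: "\<And>\<omega> Bh. \<omega> \<in> E \<Longrightarrow> is_depth_maximizer p1 p2 r n \<omega> Bh \<Longrightarrow>
      (\<Sum>k<p1 * p2. (whiten (Bh - B) k)\<^sup>2) \<le> (sig * (rate_const * sqrt \<beta>))\<^sup>2"
    using estimation_event[OF B_rank n eps(1) less_imp_le[OF eps(2)] Q \<beta>_def \<beta>] by blast
  \<comment> \<open>The 2 comes from bounding the sum \<beta> by twice the maximum. The rank bound 2
    r in the nuclear norm doubles it once more, whence the constant 4
    \<open>rate_const\<close>^2.\<close>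
  define c where "c = 2 * rate_const\<^sup>2 * sig\<^sup>2 * m"
  have "real (r * (p1 + p2)) / real n \<le> m" "eps\<^sup>2 \<le> m" by (simp_all only: m_def max.cobounded1 max.cobounded2)
  then have "\<beta> \<le> 2 * m" unfolding \<beta>_def by linarith
  then have "rate_const\<^sup>2 * sig\<^sup>2 * \<beta> \<le> rate_const\<^sup>2 * sig\<^sup>2 * (2 * m)" by (intro mult_left_mono) auto
  then have c_ge: "(sig * (rate_const * sqrt \<beta>))\<^sup>2 \<le> c"
    using \<beta>0 by (simp add: c_def power_mult_distrib mult_ac)
  have c0: "0 \<le> c" using c_ge zero_le_power2 order_trans by blast
  have c_le: "c \<le> 4 * rate_const\<^sup>2 * sig\<^sup>2 * m" using c0 by (simp add: c_def)
  have rm: "real r * m = max (real (r\<^sup>2 * (p1 + p2)) / real n) (real r * eps\<^sup>2)"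
    unfolding m_def by (subst max_mult_distrib_left) (simp add: power2_eq_square mult.assoc)
  show "\<exists>E \<in> sets ?PM.
        measure ?PM E \<ge> 1 - exp (- 1 * (real (r * (p1 + p2)) + real n * eps\<^sup>2)) \<and>
        (\<forall>\<omega> \<in> E. \<forall>Bh. is_depth_maximizer p1 p2 r n \<omega> Bh \<longrightarrow>
           (let D = vec_of_mat p1 p2 (Bh - B);
                \<kappa> = kappa p1 p2 r S
            in (psd_sqrt S *\<^sub>v D) \<bullet> (psd_sqrt S *\<^sub>v D)
                 \<le> 4 * rate_const\<^sup>2 * sig\<^sup>2 * max (real (r * (p1 + p2)) / real n) (eps\<^sup>2)
             \<and> \<kappa>\<^sup>2 * (frob_norm (Bh - B))\<^sup>2
                 \<le> 4 * rate_const\<^sup>2 * sig\<^sup>2 * max (real (r * (p1 + p2)) / real n) (eps\<^sup>2)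
             \<and> \<kappa>\<^sup>2 * (nuclear_norm (Bh - B))\<^sup>2
                 \<le> 4 * rate_const\<^sup>2 * sig\<^sup>2 * max (real (r\<^sup>2 * (p1 + p2)) / real n) (real r * eps\<^sup>2)))"
    unfolding Let_def m_def[symmetric] rm[symmetric] whiten_norm
  proof (intro bexI[of _ E] conjI ballI allI impI)
    show "E \<in> sets ?PM" by (rule E)
    show "1 - exp (- 1 * (real (r * (p1 + p2)) + real n * eps\<^sup>2)) \<le> measure ?PM E"
      using E(2) by (simp only: n\<beta> mult_minus1)
    fix \<omega> Bh assume \<omega>: "\<omega> \<in> E" and max: "is_depth_maximizer p1 p2 r n \<omega> Bh"
    have le: "(\<Sum>k<p1 * p2. (whiten (Bh - B) k)\<^sup>2) \<le> c"
      using est[OF \<omega> max] c_ge by linarith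
    have Bh: "Bh \<in> low_rank_set p1 p2 r" using max by (simp add: is_depth_maximizer_def)
    note eb = error_bounds[OF B_rank Bh le c0]
    show "(\<Sum>k<p1 * p2. (whiten (Bh - B) k)\<^sup>2) \<le> 4 * rate_const\<^sup>2 * sig\<^sup>2 * m"
      using le c_le by linarith
    show "?\<kappa>\<^sup>2 * (frob_norm (Bh - B))\<^sup>2 \<le> 4 * rate_const\<^sup>2 * sig\<^sup>2 * m"
      using eb(1) c_le by linarith
    show "?\<kappa>\<^sup>2 * (nuclear_norm (Bh - B))\<^sup>2 \<le> 4 * rate_const\<^sup>2 * sig\<^sup>2 * (real r * m)"
      using eb(2) by (simp add: c_def mult_ac)
  qed
qed

end
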